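(* Let $\hat f_{\lambda,n,M}$ be the STIT regression forest estimator with lifetime $\lambda>0$, normalized associated zonoid $\Pi\subset\mathbb{R}^D$, $n$ samples and $M\ge1$ trees. Assume that $X$ has intrinsic dimension $d$, i.e. the support of the distribution of $X$ is contained in a $d$-dimensional linear subspace $\mathcal S$ of $\mathbb{R}^D$, and that $f\in\mathcal C^{0,\beta}(L)$ for some $\beta\in(0,1]$ and $L>0$. If $\lambda_n\sim L^{2/(d+2\beta)}n^{1/(d+2\beta)}$ as $n\to\infty$, then $$R(\hat f_{\lambda_n,n,M})=O\left(L^{2d/(d+2\beta)}\,n^{-2\beta/(d+2\beta)}\right)\qquad(n\to\infty),$$ which is the minimax rate for the class $\mathcal C^{0,\beta}(L)$ on $\mathbb{R}^d$.
   Context: STIT tessellations. Let $\varphi$ be an even Borel probability measure on the unit sphere $\mathbb{S}^{D-1}$ whose support contains $D$ linearly independent vectors. Write $H(u,t)=\{x\in\mathbb{R}^D:\langle x,u\rangle=t\}$, $h(K,u)=\sup_{x\in K}\langle u,x\rangle$ for the support function of a convex body $K$, and $\Lambda([K])=\int_{\mathbb{S}^{D-1}}(h(K,u)+h(K,-u))\,d\varphi(u)$. For a compact convex window $K$ and lifetime $\lambda>0$, a random partition of $K$, denoted $\mathcal Q(K,\lambda)$, is generated as follows: draw $\delta$ exponential with rate $\Lambda([K])$; if $\delta>\lambda$ stop; otherwise split $K$ into two cells by the random hyperplane $H(U,T)$, where $U$ has law $\frac{h(K,u)+h(K,-u)}{\Lambda([K])}d\varphi(u)$ and, given $U$, $T$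 is uniform on $[-h(K,-U),h(K,U)]$; then repeat independently in each of the two cells with lifetime $\lambda-\delta$, until the lifetime expires. A random tessellation of $\mathbb{R}^D$ is a random locally finite collection of compact convex polytopes (cells) with pairwise disjoint interiors covering $\mathbb{R}^D$; it is stationary if its law is translation invariant. The STIT tessellation $\mathcal{P}(\lambda)$ with lifetime $\lambda$ and directional distribution $\varphi$ is the stationary random tessellation of $\mathbb{R}^D$ (it exists and is unique in law) whose union of cell boundaries, restricted to the interior of any compact convex window $K$, has the law of the union of the cell boundaries of the random partition $\mathcal Q(K,\lambda)$ of $K$, restricted to the interior of $K$. Its normalized associated zonoid is the convex body $\Pi$ with $h(\Pi,v)=\frac12\int_{\mathbb{S}^{D-1}}|\langle u,v\rangle|\,d\varphi(u)$, $v\in\mathbb{R}^D$. Regression setting. $W\subset\mathbb{R}^D$ is a non-empty compact convex $D$-dimensional set. The data $\mathcal D_n=\{(X_1,Y_1),\dots,(X_n,Y_n)\}$ are i.i.d. copies of $(X,Y)\in W\times\mathbb{R}$ with $\mathbb{E}[Y^2]<\infty$; $X$ has law $\mu$; $Y=f(X)+\varepsilon$ with $f(X)=\mathbb{E}[Y|X]$, $\mathbb{E}[\varepsilon|X]=0$, $\mathrm{Var}(\varepsilon|X)=\sigma^2<\infty$ a.s. For a random tessellation $\mathcal P$, the tree estimator is $\hat f_n(x,\mathcal P)=\frac{1}{\mathcal N_n(x)}\sum_{i=1}^n 1_{\{X_i\in Z_x\}}Y_i$, where $Z_x$ is the cell of $\mathcal P$ containing $x$ and $\mathcal N_n(x)=\sum_{i=1}^n1_{\{X_i\in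 Z_x\}}$, with value $0$ if $\mathcal N_n(x)=0$. The STIT forest estimator is $\hat f_{\lambda,n,M}(x)=\frac1M\sum_{m=1}^M\hat f_n(x,\mathcal P_m)$, where $\mathcal P_1,\dots,\mathcal P_M$ are i.i.d. copies of $\mathcal P(\lambda)\cap W$, independent of $\mathcal D_n$ and of $X$. Its risk is $R(\hat f_{\lambda,n,M})=\mathbb{E}[(\hat f_{\lambda,n,M}(X)-f(X))^2]$, where $X\sim\mu$ is independent of $\mathcal D_n$. Hölder class. $\mathcal C^{0,\beta}(L)$ is the set of $f:W\to\mathbb{R}$ with $|f(x)-f(y)|\le L\|x-y\|^\beta$ and $|f(x)|\le L$ for all $x,y\in W$. Minimax rate. It is a known result that the minimax rate (in $n$, for quadratic risk) for $\mathcal C^{k,\beta}(L)$ on a $d$-dimensional domain is $n^{-2(k+\beta)/(2(k+\beta)+d)}$; the phrase "minimax rate" refers to this exponent. The $O(\cdot)$ is as $n\to\infty$ with everything else ($d,D,\beta,L,\Pi,\mathcal S,W,f,\sigma$) fixed. *)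

theory Defs
  imports "HOL-Probability.Probability" "HOL-Library.Landau_Symbols"
begin

section \<open>Convex bodies and directional distributions\<close>

definition support_function :: "'a::euclidean_space set \<Rightarrow> 'a \<Rightarrow> real" where
  "support_function K u = (SUP x\<in>K. u \<bullet> x)"

definition measure_support :: "'a::topological_space measure \<Rightarrow> 'a set" where
  "measure_support \<mu> =
     {x \<in> space \<mu>. \<forall>U. open U \<and> x \<in> U \<longrightarrow> emeasure \<mu> (U \<inter> space \<mu>) > 0}"

definition directional_distribution :: "'a::euclidean_space measure \<Rightarrow> bool" where
  "directional_distribution \<phi> \<longleftrightarrow>
     prob_space \<phi> \<and>
     sets \<phi> = sets (restrict_space borel (sphere 0 1)) \<and>
     distr \<phi> \<phi> uminus = \<phi> \<and>
     (\<exists>B \<subseteq> measure_support \<phi>. independent B \<and> card B = DIM('a))"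

definition normalized_associated_zonoid :: "'a::euclidean_space measure \<Rightarrow> 'a set \<Rightarrow> bool" where
  "normalized_associated_zonoid \<phi> Z \<longleftrightarrow>
     compact Z \<and> convex Z \<and> Z \<noteq> {} \<and>
     (\<forall>v. support_function Z v = (\<integral>u. \<bar>u \<bullet> v\<bar> \<partial>\<phi>) / 2)"

section \<open>The random partition of a window\<close>

definition hitting_rate :: "'a::euclidean_space measure \<Rightarrow> 'a set \<Rightarrow> real" where
  "hitting_rate \<phi> K = (\<integral>u. support_function K u + support_function K (- u) \<partial>\<phi>)"

text \<open>The joint law of the normal \<open>U\<close> and the offset \<open>T\<close> of the hyperplane splitting \<open>K\<close>.\<close>

definition split_law :: "'a::euclidean_space measure \<Rightarrow> 'a set \<Rightarrow> ('a \<times> real) measure" where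
  "split_law \<phi> K =
     density \<phi> (\<lambda>u. ennreal ((support_function K u + support_function K (- u)) / hitting_rate \<phi> K))
       \<bind> (\<lambda>u. uniform_measure lborel {- support_function K (- u) .. support_function K u}
       \<bind> (\<lambda>t. return borel (u, t)))"

definition lower_part :: "'a::euclidean_space set \<Rightarrow> 'a \<times> real \<Rightarrow> 'a set" where
  "lower_part K p = K \<inter> {x. x \<bullet> fst p \<le> snd p}"

definition upper_part :: "'a::euclidean_space set \<Rightarrow> 'a \<times> real \<Rightarrow> 'a set" where
  "upper_part K p = K \<inter> {x. x \<bullet> fst p \<ge> snd p}"

text \<open>
  A realisation of the splitting procedure is recorded as a finite binary tree: an inner node
  carries the hyperplane that splits the cell, a leaf is a cell that survives until the lifetime
  expires.  The recursion is read as a least fixed point: \<open>partition_approx \<phi> n K l\<close> is the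
  sub-probability law of the outcome on the event that the recursion depth is less than \<open>n\<close>;
  these laws increase with \<open>n\<close>.
\<close>

primrec partition_approx ::
  "'a::euclidean_space measure \<Rightarrow> nat \<Rightarrow> 'a set \<Rightarrow> real \<Rightarrow> ('a \<times> real) tree measure" where
  "partition_approx \<phi> 0 = (\<lambda>K l. null_measure (tree_sigma borel))"
| "partition_approx \<phi> (Suc n) = (\<lambda>K l.
     density lborel (\<lambda>s. ennreal (exponential_density (hitting_rate \<phi> K) s)) \<bind> (\<lambda>s.
       if s > l then return (tree_sigma borel) Leaf
       else split_law \<phi> K \<bind> (\<lambda>p.
         partition_approx \<phi> n (lower_part K p) (l - s) \<bind> (\<lambda>a.
         partition_approx \<phi> n (upper_part K p) (l - s) \<bind> (\<lambda>b.
         return (tree_sigma borel) (Node a p b))))))"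

definition partition_law ::
  "'a::euclidean_space measure \<Rightarrow> 'a set \<Rightarrow> real \<Rightarrow> ('a \<times> real) tree measure" where
  "partition_law \<phi> K l = (SUP n. partition_approx \<phi> n K l)"

primrec tree_cells :: "('a::euclidean_space \<times> real) tree \<Rightarrow> 'a set \<Rightarrow> 'a set set" where
  "tree_cells Leaf = (\<lambda>K. {K})"
| "tree_cells (Node a p b) = (\<lambda>K. tree_cells a (lower_part K p) \<union> tree_cells b (upper_part K p))"

section \<open>Random tessellations\<close>

definition tessellation :: "'a::euclidean_space set set \<Rightarrow> bool" where
  "tessellation T \<longleftrightarrow>
     (\<forall>c\<in>T. polytope c \<and> interior c \<noteq> {}) \<and>
     (\<forall>c\<in>T. \<forall>c'\<in>T. c \<noteq> c' \<longrightarrow> interior c \<inter> interior c' = {}) \<and>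
     (\<forall>C. compact C \<longrightarrow> finite {c\<in>T. c \<inter> C \<noteq> {}}) \<and>
     \<Union>T = UNIV"

definition boundary_union :: "'a::euclidean_space set set \<Rightarrow> 'a set" where
  "boundary_union T = (\<Union>c\<in>T. frontier c)"

text \<open>
  The \<open>\<sigma>\<close>-algebra of random closed sets, generated by the events of hitting a compact set
  (the Borel sets of the Fell topology).  A tessellation is determined by the union of its cell
  boundaries, the cells being the closures of the connected components of the complement, so
  tessellations carry the \<open>\<sigma>\<close>-algebra pulled back along \<open>boundary_union\<close>.
\<close>

definition hitting_space :: "'a::euclidean_space set measure" where
  "hitting_space = sigma UNIV {{F. F \<inter> C \<noteq> {}} | C. compact C}"

definition tessellation_space :: "'a::euclidean_space set set measure" where
  "tessellation_space = vimage_algebra {T. tessellation T} boundary_union hitting_space"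

definition stationary_tessellation ::
  "'w measure \<Rightarrow> ('w \<Rightarrow> 'a::euclidean_space set set) \<Rightarrow> bool" where
  "stationary_tessellation Pr T \<longleftrightarrow>
     T \<in> measurable Pr tessellation_space \<and>
     (\<forall>a. distr Pr tessellation_space (\<lambda>\<omega>. (\<lambda>c. (+) a ` c) ` T \<omega>) = distr Pr tessellation_space T)"

text \<open>
  Windows without interior points are left out: for these the restriction to the interior
  is empty, and a single point is hit with rate \<open>0\<close>.
\<close>

definition stit_tessellation ::
  "'a::euclidean_space measure \<Rightarrow> real \<Rightarrow> 'w measure \<Rightarrow> ('w \<Rightarrow> 'a set set) \<Rightarrow> bool" where
  "stit_tessellation \<phi> l Pr T \<longleftrightarrow>
     stationary_tessellation Pr T \<and>
     (\<forall>K. compact K \<and> convex K \<and> interior K \<noteq> {} \<longrightarrow>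
        distr Pr hitting_space (\<lambda>\<omega>. boundary_union (T \<omega>) \<inter> interior K) =
        distr (partition_law \<phi> K l) hitting_space
          (\<lambda>t. boundary_union (tree_cells t K) \<inter> interior K))"

definition restrict_tessellation :: "'a set set \<Rightarrow> 'a set \<Rightarrow> 'a set set" where
  "restrict_tessellation T W = {c \<inter> W | c. c \<in> T \<and> c \<inter> W \<noteq> {}}"

section \<open>Regression forests\<close>

text \<open>
  A point on a common boundary lies in several cells and is assigned their union.  For a
  stationary tessellation a given point almost surely lies in exactly one cell.
\<close>

definition cell_of :: "'a set set \<Rightarrow> 'a \<Rightarrow> 'a set" where
  "cell_of T x = \<Union>{c\<in>T. x \<in> c}"

definition tree_estimator :: "nat \<Rightarrow> (nat \<Rightarrow> 'a \<times> real) \<Rightarrow> 'a set set \<Rightarrow> 'a \<Rightarrow> real" where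
  "tree_estimator n D T x =
     (let N = card {i\<in>{1..n}. fst (D i) \<in> cell_of T x}
      in if N = 0 then 0
         else (\<Sum>i=1..n. indicator (cell_of T x) (fst (D i)) * snd (D i)) / real N)"

definition forest_estimator ::
  "nat \<Rightarrow> nat \<Rightarrow> (nat \<Rightarrow> 'a \<times> real) \<Rightarrow> (nat \<Rightarrow> 'a set set) \<Rightarrow> 'a \<Rightarrow> real" where
  "forest_estimator n M D Ts x = (\<Sum>m=1..M. tree_estimator n D (Ts m) x) / real M"

text \<open>
  The data are \<open>(X i, Y i)\<close> with \<open>1 \<le> i \<le> n\<close>; the point \<open>X 0\<close> at which the error is
  evaluated is not among them.
\<close>

definition forest_risk ::
  "'w measure \<Rightarrow> 'a set \<Rightarrow> ('a \<Rightarrow> real) \<Rightarrow> (nat \<Rightarrow> 'w \<Rightarrow> 'a) \<Rightarrow> (nat \<Rightarrow> 'w \<Rightarrow> real) \<Rightarrow>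
     nat \<Rightarrow> nat \<Rightarrow> (nat \<Rightarrow> 'w \<Rightarrow> 'a set set) \<Rightarrow> ennreal" where
  "forest_risk Pr W f X Y n M T =
     (\<integral>\<^sup>+ \<omega>. ennreal ((forest_estimator n M (\<lambda>i. (X i \<omega>, Y i \<omega>))
                (\<lambda>m. restrict_tessellation (T m \<omega>) W) (X 0 \<omega>) - f (X 0 \<omega>))\<^sup>2) \<partial>Pr)"

definition holder_class :: "'a::metric_space set \<Rightarrow> real \<Rightarrow> real \<Rightarrow> ('a \<Rightarrow> real) set" where
  "holder_class W \<beta> L =
     {f. (\<forall>x\<in>W. \<forall>y\<in>W. \<bar>f x - f y\<bar> \<le> L * dist x y powr \<beta>) \<and> (\<forall>x\<in>W. \<bar>f x\<bar> \<le> L)}"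

text \<open>Conditional expectation and variance of \<open>Z\<close> given \<open>X\<close>, as random variables.\<close>

definition cond_expectation ::
  "'w measure \<Rightarrow> ('w \<Rightarrow> 'a::topological_space) \<Rightarrow> ('w \<Rightarrow> real) \<Rightarrow> 'w \<Rightarrow> real" where
  "cond_expectation Pr X Z = real_cond_exp Pr (vimage_algebra (space Pr) X borel) Z"

definition cond_variance ::
  "'w measure \<Rightarrow> ('w \<Rightarrow> 'a::topological_space) \<Rightarrow> ('w \<Rightarrow> real) \<Rightarrow> 'w \<Rightarrow> real" where
  "cond_variance Pr X Z = cond_expectation Pr X (\<lambda>\<omega>. (Z \<omega> - cond_expectation Pr X Z \<omega>)\<^sup>2)"

text \<open>The library's \<open>indep_var\<close> requires both random elements to have the same type.\<close>

definition independent_elements ::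
  "'w measure \<Rightarrow> 'a measure \<Rightarrow> ('w \<Rightarrow> 'a) \<Rightarrow> 'b measure \<Rightarrow> ('w \<Rightarrow> 'b) \<Rightarrow> bool" where
  "independent_elements Pr A F B G \<longleftrightarrow>
     F \<in> measurable Pr A \<and> G \<in> measurable Pr B \<and>
     prob_space.indep_set Pr (sets (vimage_algebra (space Pr) F A)) (sets (vimage_algebra (space Pr) G B))"

text \<open>
  The minimax rate in the sample size \<open>n\<close>, for quadratic risk, of the class of
  functions on a \<open>d\<close>-dimensional domain whose derivatives of order \<open>k\<close> are
  \<open>\<beta>\<close>-Hoelder continuous.
\<close>

definition minimax_rate :: "nat \<Rightarrow> real \<Rightarrow> nat \<Rightarrow> nat \<Rightarrow> real" where
  "minimax_rate k \<beta> d n = real n powr (- (2 * (real k + \<beta>)) / (2 * (real k + \<beta>) + real d))"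

end

theory Submission
  imports Defs
begin

text \<open>
  The law of the partition is used only through upper bounds.  Call a cell alive if it meets a given
  ball, or if it contains a given point \<open>x\<close> and meets a given cone with apex \<open>x\<close> outside a
  ball around \<open>x\<close>.  Conditioning on the first split shows that the expected number of alive leaves is at
  most \<open>exp (l * c)\<close> whenever an alive cell \<open>K\<close> has at most \<open>1 + c / hitting_rate \<phi> K\<close>
  alive children on average.  For a ball of radius \<open>r\<close> one can take \<open>c = 2 * r\<close>; for a cone
  around a direction in the support of \<open>\<phi>\<close>, cut off at distance \<open>\<rho>\<close> from its apex, \<open>c\<close> is
  a negative multiple of \<open>\<rho>\<close>.  Hence a ball of radius \<open>1 / l\<close> meets a bounded number of cells in mean, and
  the diameter of the cell of a point has exponential tails on the scale \<open>1 / l\<close>.  Covering the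
  support of the design by order of \<open>l ^ d\<close> balls of radius \<open>1 / l\<close> bounds the number of
  relevant cells, which by exchangeability of the sample controls the variance term, while the diameter
  controls the bias.  Averaging trees does not increase the risk, by convexity.
\<close>

section \<open>Random compact sets\<close>

text \<open>The tessellation is tied to the partition law only through the law of its cell
  boundaries inside a window, as a random closed set. Every quantity is therefore expressed by the
  boundary: points off it share a cell iff their segment misses it (\<open>linked\<close>), and
  cells are counted by points of a countable dense set whose joining segments all meet it
  (\<open>sep_count\<close>). On the tree side no measurability of leaf counts or of the map to
  boundaries is established; lower integrals and one-sided inequalities do the work. The recursion
  binds kernels indexed by the current cell, which calls for a sigma-algebra on compact sets and
  joint measurability of cutting. The ball bound also yields that a fixed point almost surely avoids
  the boundary: around a boundary point two cells meet every ball, so 1 + P(x on the boundary) is at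
  most exp (2 * r * l), and r tends to 0. In the variance term the reciprocal 1/N of the cell size
  is replaced by 2/(N + 1): the evaluation point then counts as one more sample point, and
  reciprocal cell sizes summed over all n + 1 points give the number of occupied cells.\<close>

definition compact_sets :: "'a::euclidean_space set measure" where
  "compact_sets = restrict_space hitting_space {K. compact K}"

lemma space_hitting_space [simp]: "space hitting_space = UNIV"
  by (simp add: hitting_space_def)

lemma hitting_sets [measurable]: "compact C \<Longrightarrow> {F. F \<inter> C \<noteq> {}} \<in> sets hitting_space"
  unfolding hitting_space_def by (rule in_measure_of) auto

lemma measurable_hitting_spaceI:
  assumes "\<And>C. compact C \<Longrightarrow> {\<omega> \<in> space M. f \<omega> \<inter> C \<noteq> {}} \<in> sets M"
  shows "f \<in> measurable M hitting_space"
  unfolding hitting_space_def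
  by (rule measurable_measure_of) (use assms in \<open>auto simp: vimage_def Int_def conj_commute\<close>)

lemma space_compact_sets: "space compact_sets = {K. compact K}"
  by (simp add: compact_sets_def space_restrict_space)

lemma measurable_compact_setsI:
  assumes "\<And>\<omega>. \<omega> \<in> space M \<Longrightarrow> compact (f \<omega>)"
    and "\<And>C. compact C \<Longrightarrow> {\<omega> \<in> space M. f \<omega> \<inter> C \<noteq> {}} \<in> sets M"
  shows "f \<in> measurable M compact_sets"
  unfolding compact_sets_def
  by (rule measurable_restrict_space2) (use assms measurable_hitting_spaceI in auto)

lemma compact_sets_hit: "compact C \<Longrightarrow> {K \<in> space compact_sets. K \<inter> C \<noteq> {}} \<in> sets compact_sets"
  using hitting_sets[of C]
  by (auto simp: compact_sets_def sets_restrict_space space_restrict_space intro!: image_eqI[of _ _ "{F. F \<inter> C \<noteq> {}}"])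

lemma compact_sets_nonempty: "{K \<in> space compact_sets. K \<noteq> {}} \<in> sets compact_sets"
proof -
  have "{K \<in> space compact_sets. K \<noteq> {}} =
      (\<Union>m::nat. {K \<in> space compact_sets. K \<inter> cball (0::'a) (real m) \<noteq> {}})"
    using real_arch_simple by (fastforce simp: dist_norm)
  also have "\<dots> \<in> sets compact_sets"
    by (intro sets.countable_UN') (auto intro: compact_sets_hit)
  finally show ?thesis .
qed

lemma compact_halfspace: "compact K \<Longrightarrow> compact (K \<inter> {x. x \<bullet> u \<le> t})"
  by (intro compact_Int_closed closed_Collect_le continuous_intros)

lemma compact_lower_part [simp]: "compact K \<Longrightarrow> compact (lower_part K p)"
  unfolding lower_part_def by (rule compact_halfspace)

lemma upper_part_eq: "upper_part K p = lower_part K (- p)"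
  by (auto simp: upper_part_def lower_part_def)

lemma compact_upper_part [simp]: "compact K \<Longrightarrow> compact (upper_part K p)"
  by (simp add: upper_part_eq)

text \<open>Turns hitting by a cut set, jointly in \<open>K\<close> and \<open>p\<close>, into
  countably many conditions in which \<open>K\<close> only meets fixed compact sets. Replacing
  \<open>p\<close> by \<open>q\<close> within 1/(k+1) changes
  \<open>x \<bullet> fst p - snd p\<close> by at most (R+1)/(k+1) on \<open>C\<close>, hence the
  slack; conversely the slack disappears in the limit by compactness of
  \<open>K \<inter> C\<close>.\<close>

lemma halfspace_hit_iff:
  fixes K C :: "'a::euclidean_space set" and D :: "('a \<times> real) set"
  assumes K: "compact K" and C: "compact C" and R: "\<And>x. x \<in> C \<Longrightarrow> norm x \<le> R" "0 \<le> R"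
    and D: "\<And>p e. 0 < e \<Longrightarrow> \<exists>q\<in>D. dist p q < e"
  shows "lower_part K p \<inter> C \<noteq> {} \<longleftrightarrow>
     (\<forall>k::nat. \<exists>q\<in>D. dist p q < 1 / Suc k \<and> K \<inter> (C \<inter> {x. x \<bullet> fst q \<le> snd q + (R + 1) / Suc k}) \<noteq> {})"
    (is "_ \<longleftrightarrow> ?r")
proof
  assume "lower_part K p \<inter> C \<noteq> {}"
  then obtain x where x: "x \<in> K" "x \<in> C" "x \<bullet> fst p \<le> snd p" by (auto simp: lower_part_def)
  show ?r
  proof
    fix k :: nat
    obtain q where q: "q \<in> D" "dist p q < 1 / Suc k" using D[of "1 / Suc k" p] by auto
    have 1: "norm (fst q - fst p) \<le> 1 / Suc k" "\<bar>snd q - snd p\<bar> \<le> 1 / Suc k"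
      using q(2) dist_fst_le[of p q] dist_snd_le[of p q]
      by (simp_all add: dist_norm norm_minus_commute abs_minus_commute)
    have "x \<bullet> (fst q - fst p) \<le> norm x * norm (fst q - fst p)" by (rule norm_cauchy_schwarz)
    also have "\<dots> \<le> R * (1 / Suc k)" using R x 1 by (intro mult_mono) auto
    finally have "x \<bullet> fst q \<le> snd q + (R + 1) / Suc k"
      using x(3) 1(2) by (simp add: inner_diff_right add_divide_distrib)
    then show "\<exists>q\<in>D. dist p q < 1 / Suc k \<and> K \<inter> (C \<inter> {x. x \<bullet> fst q \<le> snd q + (R + 1) / Suc k}) \<noteq> {}"
      using q x by blast
  qed
next
  assume r: ?r
  \<comment> \<open>The slack doubles: once for the enlarged half-space of \<open>q\<close>, once
    for returning from \<open>q\<close> to \<open>p\<close>.\<close>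
  have "\<exists>x\<in>K \<inter> C. x \<bullet> fst p \<le> snd p + 2 * (R + 1) / Suc k" for k
  proof -
    obtain q x where q: "dist p q < 1 / Suc k" and x: "x \<in> K" "x \<in> C" "x \<bullet> fst q \<le> snd q + (R + 1) / Suc k"
      using r by blast
    have 1: "norm (fst p - fst q) \<le> 1 / Suc k" "\<bar>snd q - snd p\<bar> \<le> 1 / Suc k"
      using q dist_fst_le[of p q] dist_snd_le[of p q]
      by (simp_all add: dist_norm abs_minus_commute)
    have "x \<bullet> (fst p - fst q) \<le> norm x * norm (fst p - fst q)" by (rule norm_cauchy_schwarz)
    also have "\<dots> \<le> R * (1 / Suc k)" using R x 1 by (intro mult_mono) auto
    finally show ?thesis
      using x 1(2) by (intro bexI[of _ x]) (simp_all add: inner_diff_right add_divide_distrib ring_distribs)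
  qed
  then obtain x where x: "\<And>k. x k \<in> K \<inter> C" "\<And>k::nat. x k \<bullet> fst p \<le> snd p + 2 * (R + 1) / Suc k"
    by metis
  obtain l s where l: "l \<in> K \<inter> C" "strict_mono s" "(x \<circ> s) \<longlonglongrightarrow> l"
    using compact_Int_closed[OF K compact_imp_closed[OF C]] x(1) unfolding compact_def by meson
  have "(\<lambda>k. x (s k) \<bullet> fst p) \<longlonglongrightarrow> l \<bullet> fst p"
    using l(3) by (auto intro!: tendsto_intros simp: comp_def)
  moreover have "(\<lambda>k. snd p + 2 * (R + 1) * inverse (real (Suc (s k)))) \<longlonglongrightarrow> snd p + 2 * (R + 1) * 0"
    by (intro tendsto_intros LIMSEQ_subseq_LIMSEQ[OF LIMSEQ_inverse_real_of_nat l(2), unfolded comp_def])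
  ultimately have "l \<bullet> fst p \<le> snd p + 2 * (R + 1) * 0"
    by (rule LIMSEQ_le) (use x(2) in \<open>auto simp: divide_inverse\<close>)
  then show "lower_part K p \<inter> C \<noteq> {}" using l(1) by (auto simp: lower_part_def)
qed

text \<open>Joint measurability in cell and hyperplane lets the cells of the recursion serve as
  parameters of kernels; upper parts follow by negating the hyperplane.\<close>

lemma measurable_lower_part:
  "(\<lambda>(K, p). lower_part K p) \<in> measurable (compact_sets \<Otimes>\<^sub>M borel) (compact_sets :: 'a::euclidean_space set measure)"
proof (rule measurable_compact_setsI)
  fix C :: "'a set" assume C: "compact C"
  obtain D :: "('a \<times> real) set" where D: "countable D" "\<And>X. open X \<Longrightarrow> X \<noteq> {} \<Longrightarrow> \<exists>d\<in>D. d \<in> X"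
    using countable_dense_setE by blast
  have D': "\<exists>q\<in>D. dist p q < e" if "0 < e" for p e
    using D(2)[of "ball p e"] that by (auto simp: mem_ball)
  obtain R where R: "0 < R" "\<And>x. x \<in> C \<Longrightarrow> norm x \<le> R"
    using compact_imp_bounded[OF C] unfolding bounded_pos by auto
  let ?M = "compact_sets \<Otimes>\<^sub>M borel :: ('a set \<times> 'a \<times> real) measure"
  have "{\<omega> \<in> space ?M. (case \<omega> of (K, p) \<Rightarrow> lower_part K p) \<inter> C \<noteq> {}} =
    {\<omega> \<in> space ?M. \<forall>k::nat. \<exists>q\<in>D. dist (snd \<omega>) q < 1 / Suc k \<and>
        fst \<omega> \<in> {K \<in> space compact_sets. K \<inter> (C \<inter> {x. x \<bullet> fst q \<le> snd q + (R + 1) / Suc k}) \<noteq> {}}}"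
  proof (rule Collect_cong, rule conj_cong[OF refl])
    fix \<omega> :: "'a set \<times> _" assume "\<omega> \<in> space ?M"
    then have K: "compact (fst \<omega>)" "fst \<omega> \<in> space compact_sets"
      by (auto simp: space_pair_measure space_compact_sets)
    show "(case \<omega> of (K, p) \<Rightarrow> lower_part K p) \<inter> C \<noteq> {} \<longleftrightarrow> (\<forall>k::nat. \<exists>q\<in>D. dist (snd \<omega>) q < 1 / Suc k \<and>
        fst \<omega> \<in> {K \<in> space compact_sets. K \<inter> (C \<inter> {x. x \<bullet> fst q \<le> snd q + (R + 1) / Suc k}) \<noteq> {}})"
      using halfspace_hit_iff[OF K(1) C R(2) _ D', of "snd \<omega>"] R(1) K(2)
      by (simp add: split_beta)
  qed
  also have "\<dots> \<in> sets ?M"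
    using D(1) compact_sets_hit[OF compact_halfspace[OF C]] by (measurable; auto)
  finally show "{\<omega> \<in> space ?M. (case \<omega> of (K, p) \<Rightarrow> lower_part K p) \<inter> C \<noteq> {}} \<in> sets ?M" .
qed (auto simp: space_pair_measure space_compact_sets)

lemma measurable_lower_part' [measurable (raw)]:
  assumes "f \<in> measurable M compact_sets" "g \<in> borel_measurable M"
  shows "(\<lambda>\<omega>. lower_part (f \<omega>) (g \<omega>)) \<in> measurable M compact_sets"
  using measurable_compose[OF measurable_Pair[OF assms] measurable_lower_part] by simp

lemma measurable_upper_part' [measurable (raw)]:
  assumes "f \<in> measurable M compact_sets" "g \<in> borel_measurable M"
  shows "(\<lambda>\<omega>. upper_part (f \<omega>) (g \<omega>)) \<in> measurable M compact_sets"
  unfolding upper_part_eq by (intro measurable_lower_part' assms borel_measurable_uminus)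

lemma support_function_bdd: "compact K \<Longrightarrow> bdd_above ((\<lambda>x. u \<bullet> x) ` K)"
  by (intro bounded_imp_bdd_above compact_imp_bounded compact_continuous_image continuous_intros)

lemma support_function_attained:
  assumes "compact K" "K \<noteq> {}"
  obtains x where "x \<in> K" "support_function K u = u \<bullet> x"
proof -
  obtain x where x: "x \<in> K" "\<And>y. y \<in> K \<Longrightarrow> u \<bullet> y \<le> u \<bullet> x"
    using continuous_attains_sup[OF assms, of "\<lambda>x. u \<bullet> x"] continuous_on_inner[OF continuous_on_const continuous_on_id]
    by blast
  then have "support_function K u = u \<bullet> x"
    unfolding support_function_def by (intro cSup_eq_maximum) auto
  then show ?thesis using x that by blast
qed

lemma support_function_ge: "compact K \<Longrightarrow> x \<in> K \<Longrightarrow> u \<bullet> x \<le> support_function K u"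
  unfolding support_function_def by (rule cSUP_upper) (auto intro: support_function_bdd)

text \<open>The support function reaches \<open>c\<close> exactly when a certain half-space cut is
  non-empty, so its superlevel sets reduce to \<open>measurable_lower_part\<close>. The empty cell
  is treated apart because \<open>Sup {}\<close> is an unspecified real.\<close>

lemma measurable_support_function:
  "(\<lambda>(K, u). support_function K u) \<in> borel_measurable (compact_sets \<Otimes>\<^sub>M (borel :: 'a::euclidean_space measure))"
proof (rule borel_measurableI_ge)
  fix c :: real
  let ?M = "compact_sets \<Otimes>\<^sub>M (borel :: 'a measure)"
  have *: "c \<le> support_function K u \<longleftrightarrow> lower_part K (- u, - c) \<noteq> {}" if K: "K \<noteq> {}" "compact K" for K and u :: 'a
  proof -
    obtain x where "x \<in> K" "support_function K u = u \<bullet> x" by (rule support_function_attained[OF K(2,1)])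
    moreover have "y \<in> K \<Longrightarrow> u \<bullet> y \<le> support_function K u" for y by (rule support_function_ge[OF K(2)])
    ultimately show ?thesis by (force simp: lower_part_def inner_commute)
  qed
  have [measurable]: "Measurable.pred compact_sets (\<lambda>K :: 'a set. K = {})"
    using sets.compl_sets[OF compact_sets_nonempty] unfolding pred_def
    by (rule back_subst) auto
  have "{\<omega> \<in> space ?M. c \<le> (case \<omega> of (K, u) \<Rightarrow> support_function K u)} =
     {\<omega> \<in> space ?M. if fst \<omega> = {} then c \<le> Sup {} else \<not> lower_part (fst \<omega>) (- snd \<omega>, - c) = {}}"
  proof (rule Collect_cong, rule conj_cong[OF refl])
    fix \<omega> :: "'a set \<times> _" assume "\<omega> \<in> space ?M"
    then have K: "compact (fst \<omega>)" by (auto simp: space_pair_measure space_compact_sets)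
    show "c \<le> (case \<omega> of (K, u) \<Rightarrow> support_function K u) \<longleftrightarrow>
        (if fst \<omega> = {} then c \<le> Sup {} else \<not> lower_part (fst \<omega>) (- snd \<omega>, - c) = {})"
      using *[OF _ K] by (cases "fst \<omega> = {}") (simp_all add: support_function_def split_beta)
  qed
  also have "\<dots> \<in> sets ?M"
    by measurable
  finally show "{\<omega> \<in> space ?M. c \<le> (case \<omega> of (K, u) \<Rightarrow> support_function K u)} \<in> sets ?M" .
qed

lemma measurable_support_function' [measurable (raw)]:
  assumes "f \<in> measurable M compact_sets" "g \<in> borel_measurable M"
  shows "(\<lambda>\<omega>. support_function (f \<omega>) (g \<omega>)) \<in> borel_measurable M"
  using measurable_compose[OF measurable_Pair[OF assms] measurable_support_function] by simp

section \<open>Measurability of the partition law\<close>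

text \<open>Mass at most 1 is asked for rather than mass 1: the splitting data of degenerate cells
  (zero rate or zero width) may have total mass 0, and the kernels must be defined on all of
  \<open>compact_sets\<close>.\<close>

lemma measurable_density_kernel:
  assumes "sigma_finite_measure N" "space N \<noteq> {}"
    and w: "(\<lambda>(a, u). w a u) \<in> borel_measurable (M \<Otimes>\<^sub>M N)"
    and le: "\<And>a. a \<in> space M \<Longrightarrow> (\<integral>\<^sup>+ u. w a u \<partial>N) \<le> 1"
  shows "(\<lambda>a. density N (w a)) \<in> measurable M (subprob_algebra N)"
proof (rule measurable_subprob_algebra)
  interpret sigma_finite_measure N by fact
  fix a assume a: "a \<in> space M"
  have [measurable]: "w a \<in> borel_measurable N"
    using measurable_compose[OF measurable_Pair1'[OF a] w] by simp
  show "subprob_space (density N (w a))"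
    using le[OF a] assms(2) by (intro subprob_spaceI) (simp_all add: emeasure_density cong: nn_integral_cong)
next
  interpret sigma_finite_measure N by fact
  fix A assume [measurable]: "A \<in> sets N"
  note [measurable] = w[unfolded split_beta']
  have "(\<lambda>a. \<integral>\<^sup>+u. w a u * indicator A u \<partial>N) \<in> borel_measurable M"
    by (rule borel_measurable_nn_integral) measurable
  moreover have "emeasure (density N (w a)) A = (\<integral>\<^sup>+u. w a u * indicator A u \<partial>N)" if "a \<in> space M" for a
    using measurable_compose[OF measurable_Pair1'[OF that] w] by (simp add: emeasure_density)
  ultimately show "(\<lambda>a. emeasure (density N (w a)) A) \<in> borel_measurable M"
    by (simp cong: measurable_cong)
qed simp

lemma measurable_uniform_interval:
  assumes [measurable]: "f \<in> borel_measurable M" "g \<in> borel_measurable M"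
  shows "(\<lambda>\<omega>. uniform_measure lborel {f \<omega> .. g \<omega> :: real}) \<in> measurable M (subprob_algebra borel)"
proof -
  have "(\<lambda>\<omega>. density lborel (\<lambda>t. indicator {f \<omega> .. g \<omega>} t / emeasure lborel {f \<omega> .. g \<omega>}))
      \<in> measurable M (subprob_algebra lborel)"
  proof (rule measurable_density_kernel)
    have "(\<lambda>x. (if f (fst x) \<le> snd x \<and> snd x \<le> g (fst x) then 1 else 0) /
        (if f (fst x) \<le> g (fst x) then ennreal (g (fst x) - f (fst x)) else 0))
       \<in> borel_measurable (M \<Otimes>\<^sub>M lborel)"
      by measurable
    also have "(\<lambda>x. (if f (fst x) \<le> snd x \<and> snd x \<le> g (fst x) then 1 else 0) /
        (if f (fst x) \<le> g (fst x) then ennreal (g (fst x) - f (fst x)) else 0)) =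
       (\<lambda>(a, t). indicator {f a .. g a} t / emeasure lborel {f a .. g a})"
      by (auto simp: indicator_def)
    finally show "(\<lambda>(a, t). indicator {f a .. g a} t / emeasure lborel {f a .. g a}) \<in> borel_measurable (M \<Otimes>\<^sub>M lborel)" .
    fix a
    show "(\<integral>\<^sup>+t. indicator {f a .. g a} t / emeasure lborel {f a .. g a} \<partial>lborel) \<le> 1"
      by (subst nn_integral_divide, simp, cases "f a < g a")
        (auto simp: ennreal_divide_self emeasure_lborel_Icc_eq)
  qed (auto intro: lborel.sigma_finite_measure_axioms)
  then show ?thesis
    unfolding uniform_measure_def by (simp cong: subprob_algebra_cong)
qed

lemma measurable_exponential_kernel:
  assumes [measurable]: "f \<in> borel_measurable M"
  shows "(\<lambda>\<omega>. density lborel (\<lambda>s. ennreal (exponential_density (f \<omega>) s))) \<in> measurable M (subprob_algebra borel)"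
proof -
  have "(\<lambda>\<omega>. density lborel (\<lambda>s. ennreal (exponential_density (f \<omega>) s))) \<in> measurable M (subprob_algebra lborel)"
  proof (rule measurable_density_kernel)
    show "(\<lambda>(a, s). ennreal (exponential_density (f a) s)) \<in> borel_measurable (M \<Otimes>\<^sub>M lborel)"
      unfolding exponential_density_def by measurable
    fix a
    show "(\<integral>\<^sup>+s. ennreal (exponential_density (f a) s) \<partial>lborel) \<le> 1"
    proof (cases "0 < f a")
      case True
      from prob_space_exponential_density[OF this] show ?thesis
        by (auto simp: prob_space_def prob_space_axioms_def emeasure_density)
    next
      case False
      then have "exponential_density (f a) s \<le> 0" for s
        by (auto simp: exponential_density_def mult_nonpos_nonneg)
      then have "ennreal (exponential_density (f a) s) = 0" for s
        by (simp add: ennreal_neg)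
      then show ?thesis by simp
    qed
  qed (auto intro: lborel.sigma_finite_measure_axioms)
  then show ?thesis by (simp cong: subprob_algebra_cong)
qed

definition width :: "'a::euclidean_space set \<Rightarrow> 'a \<Rightarrow> real" where
  "width K u = support_function K u + support_function K (- u)"

lemma width_nonneg: "compact K \<Longrightarrow> K \<noteq> {} \<Longrightarrow> 0 \<le> width K u"
  using support_function_ge[of K _ u] support_function_ge[of K _ "- u"]
  unfolding width_def by (force dest: meta_spec)

lemma measurable_width [measurable (raw)]:
  assumes [measurable]: "f \<in> measurable M compact_sets" "g \<in> borel_measurable M"
  shows "(\<lambda>\<omega>. width (f \<omega>) (g \<omega>)) \<in> borel_measurable M"
  unfolding width_def by measurable

locale direction_law =
  fixes \<phi> :: "'a::euclidean_space measure"
  assumes directional: "directional_distribution \<phi>"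
begin

lemma sets_\<phi> [measurable_cong]: "sets \<phi> = sets (restrict_space borel (sphere 0 1))"
  using directional by (simp add: directional_distribution_def)

lemma space_\<phi>: "space \<phi> = sphere 0 1"
  using sets_eq_imp_space_eq[OF sets_\<phi>] by (simp add: space_restrict_space)

sublocale prob_space \<phi>
  using directional by (simp add: directional_distribution_def)

lemma measurable_ident_\<phi> [measurable]: "(\<lambda>u. u) \<in> borel_measurable \<phi>"
  by (simp add: measurable_cong_sets[OF sets_\<phi> refl] measurable_restrict_space1)

lemma hitting_rate_eq_integral_width: "hitting_rate \<phi> K = (\<integral>u. width K u \<partial>\<phi>)"
  by (simp add: hitting_rate_def width_def)

lemma measurable_hitting_rate [measurable]: "hitting_rate \<phi> \<in> borel_measurable compact_sets"
  unfolding hitting_rate_eq_integral_width by measurable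

lemma integrable_width:
  assumes "compact K"
  shows "integrable \<phi> (width K)"
proof (cases "K = {}")
  case True
  then have "width K = (\<lambda>u. Sup {} + Sup {})" by (simp add: width_def support_function_def fun_eq_iff)
  then show ?thesis by simp
next
  case False
  obtain R where R: "\<And>x. x \<in> K \<Longrightarrow> norm x \<le> R"
    using compact_imp_bounded[OF assms] unfolding bounded_iff by auto
  have "support_function K u \<le> R" if "norm u = 1" for u
  proof -
    obtain x where "x \<in> K" "support_function K u = u \<bullet> x" using support_function_attained[OF assms False] by blast
    then show ?thesis using norm_cauchy_schwarz[of u x] R[of x] that by auto
  qed
  from this[of "- u" for u] this have "norm (width K u) \<le> 2 * R" if "u \<in> space \<phi>" for u
    using that width_nonneg[OF assms False, of u] by (fastforce simp: space_\<phi> width_def)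
  moreover have "width K \<in> borel_measurable \<phi>"
    using assms by (auto simp: space_compact_sets intro!: measurable_width)
  ultimately show ?thesis by (intro integrable_const_bound[where B="2*R"]) auto
qed

text \<open>The mass is 1, or 0 when the rate vanishes, because division by 0 yields 0.\<close>

lemma split_density_le:
  assumes "compact K"
  shows "(\<integral>\<^sup>+u. ennreal (width K u / hitting_rate \<phi> K) \<partial>\<phi>) \<le> 1"
proof (cases "K = {}")
  case True
  then have "width K = (\<lambda>u. Sup {} + Sup {})" by (simp add: width_def support_function_def fun_eq_iff)
  then obtain c where "width K = (\<lambda>u. c)" by blast
  then show ?thesis by (cases "c = 0") (auto simp: hitting_rate_eq_integral_width emeasure_space_1 prob_space)
next
  case False
  have "(\<integral>\<^sup>+u. ennreal (width K u / hitting_rate \<phi> K) \<partial>\<phi>) = ennreal (\<integral>u. width K u / hitting_rate \<phi> K \<partial>\<phi>)"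
    using integrable_width[OF assms] width_nonneg[OF assms False]
    by (intro nn_integral_eq_integral) (auto simp: hitting_rate_eq_integral_width integral_nonneg_AE)
  also have "\<dots> \<le> ennreal 1"
    by (intro ennreal_leI) (simp add: hitting_rate_eq_integral_width divide_le_eq_1)
  finally show ?thesis by simp
qed

lemma measurable_split_law [measurable]: "split_law \<phi> \<in> measurable compact_sets (subprob_algebra borel)"
proof -
  have 1: "(\<lambda>K. density \<phi> (\<lambda>u. ennreal (width K u / hitting_rate \<phi> K))) \<in> measurable compact_sets (subprob_algebra \<phi>)"
    by (rule measurable_density_kernel)
      (use split_density_le not_empty in \<open>auto simp: space_compact_sets intro: sigma_finite_measure_axioms\<close>)
  have 2: "(\<lambda>x. uniform_measure lborel {- support_function (fst x) (- snd x) .. support_function (fst x) (snd x)})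
      \<in> measurable (compact_sets \<Otimes>\<^sub>M \<phi>) (subprob_algebra borel)"
    by (rule measurable_uniform_interval) measurable
  have 3: "(\<lambda>x. return borel (snd (fst x), snd x)) \<in> measurable ((compact_sets \<Otimes>\<^sub>M \<phi>) \<Otimes>\<^sub>M borel) (subprob_algebra (borel :: ('a \<times> real) measure))"
    by measurable
  show ?thesis
    unfolding split_law_def[abs_def] width_def[symmetric]
    by (rule measurable_bind[OF 1], rule measurable_bind[OF 2 3])
qed

lemma measurable_partition_approx:
  "(\<lambda>x. partition_approx \<phi> n (fst x) (snd x)) \<in> measurable (compact_sets \<Otimes>\<^sub>M borel) (subprob_algebra (tree_sigma borel))"
proof (induction n)
  case 0
  have "space (tree_sigma (borel :: ('a \<times> real) measure)) \<noteq> {}" by (auto simp: space_tree_sigma)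
  then show ?case by simp
next
  case (Suc n)
  note [measurable] = measurable_compose[OF _ Suc.IH, of "\<lambda>x. (f x, g x)" for f g, simplified]
  have 1: "(\<lambda>x. density lborel (\<lambda>s. ennreal (exponential_density (hitting_rate \<phi> (fst x)) s)))
     \<in> measurable (compact_sets \<Otimes>\<^sub>M (borel :: real measure)) (subprob_algebra borel)"
    by (rule measurable_exponential_kernel) measurable
  have 2: "(\<lambda>x. split_law \<phi> (fst (fst x))) \<in> measurable ((compact_sets \<Otimes>\<^sub>M borel) \<Otimes>\<^sub>M borel) (subprob_algebra borel)"
    by measurable
  \<comment> \<open>The coordinates of \<open>?M\<close> are, from the inside out, the cell, the
    lifetime, the waiting time and the hyperplane; the two subtrees are appended later.\<close>
  let ?M = "(((compact_sets :: 'a set measure) \<Otimes>\<^sub>M (borel :: real measure)) \<Otimes>\<^sub>M (borel :: real measure)) \<Otimes>\<^sub>M (borel :: ('a \<times> real) measure)"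
  have 3: "(\<lambda>x. partition_approx \<phi> n (lower_part (fst (fst (fst x))) (snd x)) (snd (fst (fst x)) - snd (fst x)))
      \<in> measurable ?M (subprob_algebra (tree_sigma borel))"
    by measurable
  have 4: "(\<lambda>x. partition_approx \<phi> n (upper_part (fst (fst (fst (fst x)))) (snd (fst x))) (snd (fst (fst (fst x))) - snd (fst (fst x))))
      \<in> measurable (?M \<Otimes>\<^sub>M tree_sigma borel) (subprob_algebra (tree_sigma borel))"
    by measurable
  have 5: "(\<lambda>x. return (tree_sigma borel) (Node (snd (fst x)) (snd (fst (fst x))) (snd x)))
      \<in> measurable ((?M \<Otimes>\<^sub>M tree_sigma borel) \<Otimes>\<^sub>M tree_sigma borel) (subprob_algebra (tree_sigma borel))"
    by measurable
  show ?case
    unfolding partition_approx.simps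
    apply (rule measurable_bind[OF 1])
    apply (rule measurable_If)
      apply (simp add: space_subprob_algebra subprob_space_return)
     apply (rule measurable_bind[OF 2], rule measurable_bind[OF 3], rule measurable_bind[OF 4 5])
    apply measurable
    done
qed

end

section \<open>Lower integrals of possibly non-measurable functions\<close>

lemma nn_integral_leI_measurable:
  assumes "\<And>g. g \<in> borel_measurable M \<Longrightarrow> (\<And>x. g x \<le> f x) \<Longrightarrow> (\<integral>\<^sup>+x. g x \<partial>M) \<le> c"
  shows "(\<integral>\<^sup>+x. f x \<partial>M) \<le> c"
  unfolding nn_integral_def[of M f]
proof (rule SUP_least, clarify)
  fix g assume g: "simple_function M g" "g \<le> f"
  then have "integral\<^sup>S M g = (\<integral>\<^sup>+x. g x \<partial>M)" by (simp add: nn_integral_eq_simple_integral)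
  also have "\<dots> \<le> c" using g by (intro assms) (auto intro: borel_measurable_simple_function simp: le_fun_def)
  finally show "integral\<^sup>S M g \<le> c" .
qed

text \<open>
  For a non-measurable function \<open>nn_integral\<close> is a lower integral, which is superadditive but in
  general not subadditive; adding a constant is harmless.
\<close>

lemma nn_integral_const_add_le:
  "(\<integral>\<^sup>+x. c + f x \<partial>M) \<le> c * emeasure M (space M) + (\<integral>\<^sup>+x. f x \<partial>M)"
proof (cases "c = \<infinity>")
  case True
  show ?thesis
  proof (cases "emeasure M (space M) = 0")
    case True
    then have "AE x in M. False" by (intro AE_I[of _ _ "space M"]) auto
    then have "(\<integral>\<^sup>+x. c + f x \<partial>M) = (\<integral>\<^sup>+x. 0 \<partial>M)" by (intro nn_integral_cong_AE) auto
    then show ?thesis by simp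
  next
    case False
    then show ?thesis using True by (simp add: ennreal_top_mult)
  qed
next
  case False
  show ?thesis
  proof (rule nn_integral_leI_measurable)
    fix g assume [measurable]: "g \<in> borel_measurable M" and g: "\<And>x. g x \<le> c + f x"
    have "(\<integral>\<^sup>+x. g x \<partial>M) \<le> (\<integral>\<^sup>+x. c + (g x - c) \<partial>M)"
      by (intro nn_integral_mono) (metis add.commute diff_add_self_ennreal ennreal_diff_self le_cases le_iff_add order_refl)
    also have "\<dots> = c * emeasure M (space M) + (\<integral>\<^sup>+x. g x - c \<partial>M)"
      by (simp add: nn_integral_add)
    also have "(\<integral>\<^sup>+x. g x - c \<partial>M) \<le> (\<integral>\<^sup>+x. f x \<partial>M)"
      using g False by (intro nn_integral_mono) (simp add: ennreal_minus_le_iff)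
    finally show "(\<integral>\<^sup>+x. g x \<partial>M) \<le> c * emeasure M (space M) + (\<integral>\<^sup>+x. f x \<partial>M)" by (simp add: add_left_mono)
  qed
qed

lemma nn_integral_superadd:
  "(\<integral>\<^sup>+x. f x \<partial>M) + (\<integral>\<^sup>+x. g x \<partial>M) \<le> (\<integral>\<^sup>+x. f x + g x \<partial>M)"
proof -
  let ?S = "\<lambda>f. {s. simple_function M s \<and> s \<le> f}"
  have "(\<lambda>_. 0) \<in> ?S f" for f :: "'a \<Rightarrow> ennreal" by (simp add: le_fun_def)
  then have ne: "?S f \<noteq> {}" for f :: "'a \<Rightarrow> ennreal" by blast
  have 1: "integral\<^sup>S M s + integral\<^sup>S M t \<le> (\<integral>\<^sup>+x. f x + g x \<partial>M)" if "s \<in> ?S f" "t \<in> ?S g" for s t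
  proof -
    have "integral\<^sup>S M s + integral\<^sup>S M t = integral\<^sup>S M (\<lambda>x. s x + t x)"
      using that by (simp add: simple_integral_add)
    also have "\<dots> \<le> (\<integral>\<^sup>+x. f x + g x \<partial>M)"
      unfolding nn_integral_def[of M "\<lambda>x. f x + g x"] using that
      by (intro SUP_upper) (auto simp: le_fun_def add_mono)
    finally show ?thesis .
  qed
  show ?thesis
    unfolding nn_integral_def[of M f] nn_integral_def[of M g]
    unfolding ennreal_SUP_add_left[OF ne[of f], symmetric]
  proof (rule SUP_least)
    fix s assume s: "s \<in> ?S f"
    show "integral\<^sup>S M s + Sup (integral\<^sup>S M ` ?S g) \<le> (\<integral>\<^sup>+x. f x + g x \<partial>M)"
      using SUP_least[of "?S g" "\<lambda>t. integral\<^sup>S M s + integral\<^sup>S M t", OF 1[OF s]]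
      by (simp only: ennreal_SUP_add_right[OF ne[of g]])
  qed
qed

lemma nn_integral_sum_le:
  "finite I \<Longrightarrow> (\<Sum>i\<in>I. \<integral>\<^sup>+x. f i x \<partial>M) \<le> (\<integral>\<^sup>+x. (\<Sum>i\<in>I. f i x) \<partial>M)"
proof (induction I rule: finite_induct)
  case (insert i I)
  then have "(\<Sum>i\<in>insert i I. \<integral>\<^sup>+x. f i x \<partial>M) \<le> (\<integral>\<^sup>+x. f i x \<partial>M) + (\<integral>\<^sup>+x. (\<Sum>i\<in>I. f i x) \<partial>M)"
    by (simp add: add_left_mono)
  also have "\<dots> \<le> (\<integral>\<^sup>+x. f i x + (\<Sum>i\<in>I. f i x) \<partial>M)" by (rule nn_integral_superadd)
  finally show ?case using insert by simp
qed simp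

text \<open>
  The distribution of a non-measurable map is either the zero measure or still given by preimages,
  so that the inequality needs no measurability of \<open>g\<close>.
\<close>

lemma nn_integral_distr_le:
  "(\<integral>\<^sup>+y. H y \<partial>distr M N g) \<le> (\<integral>\<^sup>+x. H (g x) \<partial>M)"
proof -
  let ?D = "distr M N g"
  have em: "y * emeasure ?D A \<le> (\<integral>\<^sup>+x. y * indicator A (g x) \<partial>M)" for y A
  proof (cases "g -` A \<inter> space M \<in> sets M")
    case True
    have "y * emeasure ?D A \<le> y * emeasure M (g -` A \<inter> space M)"
      unfolding distr_def emeasure_measure_of_conv by (auto intro: mult_left_mono)
    also have "\<dots> = (\<integral>\<^sup>+x. y * indicator (g -` A \<inter> space M) x \<partial>M)"
      using True by (simp add: nn_integral_cmult_indicator)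
    also have "\<dots> = (\<integral>\<^sup>+x. y * indicator A (g x) \<partial>M)"
      by (intro nn_integral_cong) (auto simp: indicator_def)
    finally show ?thesis .
  next
    case False
    then have "emeasure ?D A = 0"
      unfolding distr_def emeasure_measure_of_conv by (auto simp: emeasure_notin_sets)
    then show ?thesis by simp
  qed
  show ?thesis
    unfolding nn_integral_def[of ?D]
  proof (rule SUP_least, clarify)
    fix s assume s: "simple_function ?D s" "s \<le> H"
    have fin: "finite (s ` space ?D)" using s(1) by (simp add: simple_function_def)
    have "integral\<^sup>S ?D s = (\<Sum>y\<in>s ` space ?D. y * emeasure ?D (s -` {y} \<inter> space ?D))"
      by (simp add: simple_integral_def)
    also have "\<dots> \<le> (\<Sum>y\<in>s ` space ?D. \<integral>\<^sup>+x. y * indicator (s -` {y} \<inter> space ?D) (g x) \<partial>M)"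
      by (intro sum_mono em)
    also have "\<dots> \<le> (\<integral>\<^sup>+x. (\<Sum>y\<in>s ` space ?D. y * indicator (s -` {y} \<inter> space ?D) (g x)) \<partial>M)"
      by (rule nn_integral_sum_le[OF fin])
    also have "\<dots> \<le> (\<integral>\<^sup>+x. H (g x) \<partial>M)"
    proof (rule nn_integral_mono)
      fix x
      show "(\<Sum>y\<in>s ` space ?D. y * indicator (s -` {y} \<inter> space ?D) (g x)) \<le> H (g x)"
      proof (cases "g x \<in> space ?D")
        case True
        have "(\<Sum>y\<in>s ` space ?D. y * indicator (s -` {y} \<inter> space ?D) (g x)) =
            (\<Sum>y\<in>{s (g x)}. y * indicator (s -` {y} \<inter> space ?D) (g x))"
          using True fin by (intro sum.mono_neutral_right) (auto simp: indicator_def)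
        also have "\<dots> \<le> H (g x)" using s(2) by (auto simp: le_fun_def indicator_def)
        finally show ?thesis .
      qed simp
    qed
    finally show "integral\<^sup>S ?D s \<le> (\<integral>\<^sup>+x. H (g x) \<partial>M)" .
  qed
qed

text \<open>For a simple function the integral is a finite sum of measures of level sets. On an
  increasing chain the supremum measure is the setwise supremum, which commutes with the finite sum.
  The function \<open>f\<close> is arbitrary: only its simple minorants are used.\<close>

lemma nn_integral_SUP_measure_le:
  fixes M :: "nat \<Rightarrow> 'b measure"
  assumes sets: "\<And>n. sets (M n) = sets N" and inc: "incseq M"
    and c: "\<And>n. (\<integral>\<^sup>+x. f x \<partial>M n) \<le> c"
  shows "(\<integral>\<^sup>+x. f x \<partial>(SUP n. M n)) \<le> c"
  unfolding nn_integral_def[of "SUP n. M n"]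
proof (rule SUP_least, clarify)
  let ?D = "SUP n. M n"
  have setsD: "sets ?D = sets N" using sets by (intro sets_SUP) auto
  have sp: "space ?D = space N" "space (M n) = space N" for n
    using sets_eq_imp_space_eq[OF setsD] sets_eq_imp_space_eq[OF sets] by auto
  have ch: "Complete_Partial_Order.chain (\<le>) (range M)"
    using inc by (auto simp: Complete_Partial_Order.chain_def incseq_def) (metis le_cases)
  fix s assume s: "simple_function ?D s" "s \<le> f"
  have sn: "simple_function (M n) s" for n
    using s(1) by (simp add: simple_function_def sp setsD sets)
  have "integral\<^sup>S ?D s = (\<Sum>y\<in>s ` space N. y * emeasure ?D (s -` {y} \<inter> space N))"
    by (simp add: simple_integral_def sp)
  also have "\<dots> = (\<Sum>y\<in>s ` space N. SUP n. y * emeasure (M n) (s -` {y} \<inter> space N))"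
  proof (intro sum.cong refl)
    fix y assume "y \<in> s ` space N"
    then have "s -` {y} \<inter> space N \<in> sets N" using s(1) by (auto simp: simple_function_def sp setsD)
    then show "y * emeasure ?D (s -` {y} \<inter> space N) = (SUP n. y * emeasure (M n) (s -` {y} \<inter> space N))"
      using sets ch by (subst emeasure_SUP_chain[where N=N]) (auto simp: SUP_mult_left_ennreal)
  qed
  also have "\<dots> = (SUP n. \<Sum>y\<in>s ` space N. y * emeasure (M n) (s -` {y} \<inter> space N))"
  proof (rule ennreal_SUP_sum[symmetric])
    fix y
    show "incseq (\<lambda>n. y * emeasure (M n) (s -` {y} \<inter> space N))"
      using inc sets by (auto simp: incseq_def intro!: mult_left_mono le_measureD3)
  qed
  also have "\<dots> = (SUP n. integral\<^sup>S (M n) s)"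
    by (simp add: simple_integral_def sp)
  also have "\<dots> \<le> c"
  proof (rule SUP_least)
    fix n
    have "integral\<^sup>S (M n) s = (\<integral>\<^sup>+x. s x \<partial>M n)" using sn by (simp add: nn_integral_eq_simple_integral)
    also have "\<dots> \<le> (\<integral>\<^sup>+x. f x \<partial>M n)" using s(2) by (intro nn_integral_mono) (auto simp: le_fun_def)
    finally show "integral\<^sup>S (M n) s \<le> c" using c order_trans by blast
  qed
  finally show "integral\<^sup>S ?D s \<le> c" .
qed

text \<open>
  A null normal does not define a hyperplane and occurs with probability \<open>0\<close>; the value \<open>\<infinity>\<close> keeps
  \<open>leafcount\<close> an upper bound on such trees as well.
\<close>

primrec leafcount :: "('a::euclidean_space set \<Rightarrow> bool) \<Rightarrow> ('a \<times> real) tree \<Rightarrow> 'a set \<Rightarrow> ennreal" where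
  "leafcount alive Leaf = (\<lambda>K. of_bool (alive K))"
| "leafcount alive (Node a p b) = (\<lambda>K. if fst p = 0 then \<infinity>
     else leafcount alive a (lower_part K p) + leafcount alive b (upper_part K p))"

section \<open>Integration against the split law and the truncated partition laws\<close>

declare partition_approx.simps(2) [simp del]

context direction_law
begin

lemma nn_integral_split_law:
  assumes K: "compact K" and [measurable]: "G \<in> borel_measurable borel"
  shows "(\<integral>\<^sup>+p. G p \<partial>split_law \<phi> K) = (\<integral>\<^sup>+u. ennreal (width K u / hitting_rate \<phi> K) *
     ((\<integral>\<^sup>+t. G (u, t) * indicator {- support_function K (- u) .. support_function K u} t \<partial>lborel) / ennreal (width K u)) \<partial>\<phi>)"
proof -
  have K': "K \<in> space compact_sets" using K by (simp add: space_compact_sets)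
  have [measurable]: "width K \<in> borel_measurable \<phi>" "support_function K \<in> borel_measurable \<phi>"
      "(\<lambda>u. support_function K (- u)) \<in> borel_measurable \<phi>"
    by (rule borel_measurable_integrable[OF integrable_width[OF K]])
      (use K' in \<open>auto intro!: measurable_support_function'\<close>)
  let ?U = "\<lambda>u. uniform_measure lborel {- support_function K (- u) .. support_function K u}"
  have 1: "?U \<in> measurable \<phi> (subprob_algebra borel)"
    by (rule measurable_uniform_interval) measurable
  have 2: "(\<lambda>u. ?U u \<bind> (\<lambda>t. return borel (u, t))) \<in> measurable \<phi> (subprob_algebra borel)"
    by (rule measurable_bind[OF 1]) measurable
  have "(\<integral>\<^sup>+p. G p \<partial>split_law \<phi> K) =
     (\<integral>\<^sup>+u. ennreal (width K u / hitting_rate \<phi> K) * (\<integral>\<^sup>+p. G p \<partial>(?U u \<bind> (\<lambda>t. return borel (u, t)))) \<partial>\<phi>)"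
    unfolding split_law_def width_def[symmetric]
    using nn_integral_measurable_subprob_algebra[of G borel] 2
    by (subst nn_integral_bind[where B=borel]) (auto simp: nn_integral_density intro: measurable_compose)
  also have "\<dots> = (\<integral>\<^sup>+u. ennreal (width K u / hitting_rate \<phi> K) *
     ((\<integral>\<^sup>+t. G (u, t) * indicator {- support_function K (- u) .. support_function K u} t \<partial>lborel) / ennreal (width K u)) \<partial>\<phi>)"
  proof (rule nn_integral_cong)
    fix u
    have "(\<lambda>t. return borel (u, t)) \<in> measurable (?U u) (subprob_algebra (borel :: ('a \<times> real) measure))"
      by measurable
    then have "(\<integral>\<^sup>+p. G p \<partial>(?U u \<bind> (\<lambda>t. return borel (u, t)))) = (\<integral>\<^sup>+t. G (u, t) \<partial>?U u)"
      by (subst nn_integral_bind[where B=borel]) (auto simp: nn_integral_return)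
    also have "\<dots> = (\<integral>\<^sup>+t. G (u, t) * indicator {- support_function K (- u) .. support_function K u} t \<partial>lborel) / ennreal (width K u)"
      by (subst nn_integral_uniform_measure) (auto simp: width_def ennreal_neg emeasure_lborel_Icc_eq)
    finally show "ennreal (width K u / hitting_rate \<phi> K) * (\<integral>\<^sup>+p. G p \<partial>(?U u \<bind> (\<lambda>t. return borel (u, t)))) =
      ennreal (width K u / hitting_rate \<phi> K) *
     ((\<integral>\<^sup>+t. G (u, t) * indicator {- support_function K (- u) .. support_function K u} t \<partial>lborel) / ennreal (width K u))"
      by simp
  qed
  finally show ?thesis .
qed

lemma hitting_rate_nonneg: "compact K \<Longrightarrow> K \<noteq> {} \<Longrightarrow> 0 \<le> hitting_rate \<phi> K"
  by (simp add: hitting_rate_eq_integral_width width_nonneg)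

text \<open>The normalisations cancel: rate times width/rate times 1/width is 1, which turns the
  split law into the direction law times Lebesgue measure of the offsets, restricted to hyperplanes
  that hit \<open>K\<close>. Only an inequality is claimed, because zero rate or width makes the
  left integrand 0.\<close>

lemma hitting_rate_split_law_le:
  assumes K: "compact K" "K \<noteq> {}" and G [measurable]: "G \<in> borel_measurable borel"
  shows "ennreal (hitting_rate \<phi> K) * (\<integral>\<^sup>+p. G p \<partial>split_law \<phi> K) \<le>
     (\<integral>\<^sup>+u. (\<integral>\<^sup>+t. G (u, t) * indicator {- support_function K (- u) .. support_function K u} t \<partial>lborel) \<partial>\<phi>)"
proof -
  have K': "K \<in> space compact_sets" using K by (simp add: space_compact_sets)
  have [measurable]: "width K \<in> borel_measurable \<phi>" "support_function K \<in> borel_measurable \<phi>"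
      "(\<lambda>u. support_function K (- u)) \<in> borel_measurable \<phi>"
    by (rule borel_measurable_integrable[OF integrable_width[OF K(1)]])
      (use K' in \<open>auto intro!: measurable_support_function'\<close>)
  have [measurable]: "(\<lambda>x. support_function K (fst x)) \<in> borel_measurable (\<phi> \<Otimes>\<^sub>M lborel)"
      "(\<lambda>x. support_function K (- fst x)) \<in> borel_measurable (\<phi> \<Otimes>\<^sub>M lborel)"
    using measurable_compose[OF measurable_fst[of \<phi> lborel] \<open>support_function K \<in> borel_measurable \<phi>\<close>]
      measurable_compose[OF measurable_fst[of \<phi> lborel] \<open>(\<lambda>u. support_function K (- u)) \<in> borel_measurable \<phi>\<close>]
    by simp_all
  have "(\<lambda>x. (fst x, snd x)) \<in> measurable (\<phi> \<Otimes>\<^sub>M lborel) (borel :: ('a \<times> real) measure)"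
    by measurable
  from measurable_compose[OF this G]
  have [measurable]: "G \<in> borel_measurable (\<phi> \<Otimes>\<^sub>M lborel)" by simp
  have "(\<lambda>x. G x * (if - support_function K (- fst x) \<le> snd x \<and> snd x \<le> support_function K (fst x) then 1 else 0))
      \<in> borel_measurable (\<phi> \<Otimes>\<^sub>M lborel)"
    by measurable
  also have "(\<lambda>x. G x * (if - support_function K (- fst x) \<le> snd x \<and> snd x \<le> support_function K (fst x) then 1 else 0)) =
      (\<lambda>(u, t). G (u, t) * indicator {- support_function K (- u) .. support_function K u} t)"
    by (auto simp: indicator_def)
  finally have [measurable]: "(\<lambda>u. \<integral>\<^sup>+t. G (u, t) * indicator {- support_function K (- u) .. support_function K u} t \<partial>lborel)
      \<in> borel_measurable \<phi>"
    by (rule lborel.borel_measurable_nn_integral)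
  have "ennreal (hitting_rate \<phi> K) * (\<integral>\<^sup>+p. G p \<partial>split_law \<phi> K) =
    (\<integral>\<^sup>+u. ennreal (hitting_rate \<phi> K) * (ennreal (width K u / hitting_rate \<phi> K) *
     ((\<integral>\<^sup>+t. G (u, t) * indicator {- support_function K (- u) .. support_function K u} t \<partial>lborel) / ennreal (width K u))) \<partial>\<phi>)"
    unfolding nn_integral_split_law[OF K(1) G] by (rule nn_integral_cmult[symmetric]) measurable
  also have "\<dots> \<le> (\<integral>\<^sup>+u. (\<integral>\<^sup>+t. G (u, t) * indicator {- support_function K (- u) .. support_function K u} t \<partial>lborel) \<partial>\<phi>)"
  proof (rule nn_integral_mono)
    fix u
    have *: "ennreal L * (ennreal (w / L) * (I / ennreal w)) \<le> I" if "0 \<le> L" "0 \<le> w" for L w I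
    proof (cases "L = 0 \<or> w = 0")
      case False
      then have "ennreal L * ennreal (w / L) = ennreal w"
        using that by (simp add: ennreal_mult'[symmetric])
      then have "ennreal L * (ennreal (w / L) * (I / ennreal w)) = ennreal w * (I / ennreal w)"
        by (simp add: mult.assoc[symmetric])
      also have "\<dots> = I" using False that
        by (simp add: ennreal_times_divide mult.commute[of _ I] ennreal_mult_divide_eq)
      finally show ?thesis by simp
    qed auto
    show "ennreal (hitting_rate \<phi> K) * (ennreal (width K u / hitting_rate \<phi> K) *
     ((\<integral>\<^sup>+t. G (u, t) * indicator {- support_function K (- u) .. support_function K u} t \<partial>lborel) / ennreal (width K u)))
     \<le> (\<integral>\<^sup>+t. G (u, t) * indicator {- support_function K (- u) .. support_function K u} t \<partial>lborel)"
      by (rule *) (use K hitting_rate_nonneg width_nonneg in auto)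
  qed
  finally show ?thesis .
qed

lemma partition_approx_space:
  assumes "compact K"
  shows "sets (partition_approx \<phi> n K l) = sets (tree_sigma borel)" "subprob_space (partition_approx \<phi> n K l)"
proof -
  have "(K, l) \<in> space (compact_sets \<Otimes>\<^sub>M borel)"
    using assms by (simp add: space_pair_measure space_compact_sets)
  from measurable_space[OF measurable_partition_approx this, of n]
  show "sets (partition_approx \<phi> n K l) = sets (tree_sigma borel)" "subprob_space (partition_approx \<phi> n K l)"
    by (auto simp: space_subprob_algebra)
qed

text \<open>The backward equation, obtained by conditioning on the waiting time and the first split.
  For measurable \<open>G\<close> it is exact.\<close>

lemma nn_integral_partition_approx_Suc:
  assumes K: "compact K" and G [measurable]: "G \<in> borel_measurable (tree_sigma borel)"
  shows "(\<integral>\<^sup>+t. G t \<partial>partition_approx \<phi> (Suc n) K l) =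
    (\<integral>\<^sup>+s. ennreal (exponential_density (hitting_rate \<phi> K) s) * (if s > l then G Leaf else
       \<integral>\<^sup>+p. \<integral>\<^sup>+a. \<integral>\<^sup>+b. G (Node a p b) \<partial>partition_approx \<phi> n (upper_part K p) (l - s)
          \<partial>partition_approx \<phi> n (lower_part K p) (l - s) \<partial>split_law \<phi> K) \<partial>lborel)"
proof -
  have [measurable]: "K \<in> space compact_sets" using K by (simp add: space_compact_sets)
  note [measurable] = measurable_compose[OF _ measurable_partition_approx, of "\<lambda>x. (f x, g x)" for f g, simplified]
  let ?T = "tree_sigma borel :: ('a \<times> real) tree measure"
  let ?ret = "\<lambda>p a b. return ?T (Node a p b)"
  let ?A = "\<lambda>s p. partition_approx \<phi> n (lower_part K p) (l - s)"
  let ?B = "\<lambda>s p. partition_approx \<phi> n (upper_part K p) (l - s)"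
  \<comment> \<open>\<open>?k1\<close>, \<open>?k2\<close> and \<open>?k3\<close> are the laws that
    remain after drawing the waiting time, then the hyperplane, then the lower subtree.\<close>
  let ?k3 = "\<lambda>s p a. ?B s p \<bind> (\<lambda>b. ?ret p a b)"
  let ?k2 = "\<lambda>s p. ?A s p \<bind> ?k3 s p"
  let ?k1 = "\<lambda>s. split_law \<phi> K \<bind> ?k2 s"
  have split: "split_law \<phi> K \<in> space (subprob_algebra borel)"
    by (rule measurable_space[OF measurable_split_law \<open>K \<in> space compact_sets\<close>])
  have [measurable]: "a \<in> space ?T" for a by (simp add: space_tree_sigma)
  have m4: "?ret p a \<in> measurable ?T (subprob_algebra ?T)" for p a
    by measurable
  have m3: "(\<lambda>x. ?k3 (fst (fst x)) (snd (fst x)) (snd x)) \<in> measurable ((borel \<Otimes>\<^sub>M borel) \<Otimes>\<^sub>M ?T) (subprob_algebra ?T)"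
    by (rule measurable_bind) measurable
  have m2: "(\<lambda>x. ?k2 (fst x) (snd x)) \<in> measurable (borel \<Otimes>\<^sub>M borel) (subprob_algebra ?T)"
    by (rule measurable_bind[OF _ m3]) measurable
  have m1: "?k1 \<in> measurable borel (subprob_algebra ?T)"
    by (rule measurable_bind[OF measurable_const[OF split] m2])
  have m3': "?k3 s p \<in> measurable ?T (subprob_algebra ?T)" for s p
    using measurable_compose[OF measurable_Pair1'[of "(s, p)"] m3] by (simp add: space_pair_measure)
  have m2': "?k2 s \<in> measurable borel (subprob_algebra ?T)" for s
    using measurable_compose[OF measurable_Pair1'[of s] m2] by simp
  have if_m: "(\<lambda>s. if s > l then return ?T Leaf else ?k1 s) \<in> measurable borel (subprob_algebra ?T)"
    by (rule measurable_If[OF _ m1]) (simp_all add: space_subprob_algebra subprob_space_return)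
  have sets_AB: "sets (?A s p) = sets ?T" "sets (?B s p) = sets ?T" for s p
    using partition_approx_space(1) K by auto
  have sets_split: "sets (split_law \<phi> K) = sets borel" using split by (simp add: space_subprob_algebra)
  have "(\<integral>\<^sup>+t. G t \<partial>partition_approx \<phi> (Suc n) K l) =
    (\<integral>\<^sup>+s. ennreal (exponential_density (hitting_rate \<phi> K) s) *
       (\<integral>\<^sup>+t. G t \<partial>(if s > l then return ?T Leaf else ?k1 s)) \<partial>lborel)"
    unfolding partition_approx.simps(2)
    using measurable_compose[OF if_m nn_integral_measurable_subprob_algebra[OF G]] if_m
    by (subst nn_integral_bind[where B="?T"]) (auto simp: nn_integral_density)
  also have "(\<lambda>s. \<integral>\<^sup>+t. G t \<partial>(if s > l then return ?T Leaf else ?k1 s)) =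
     (\<lambda>s. if s > l then G Leaf else \<integral>\<^sup>+p. \<integral>\<^sup>+a. \<integral>\<^sup>+b. G (Node a p b) \<partial>?B s p \<partial>?A s p \<partial>split_law \<phi> K)"
  proof
    fix s
    have "(\<integral>\<^sup>+t. G t \<partial>?k1 s) = (\<integral>\<^sup>+p. \<integral>\<^sup>+t. G t \<partial>?k2 s p \<partial>split_law \<phi> K)"
      using m2' by (intro nn_integral_bind[where B="?T"]) (auto simp: measurable_cong_sets[OF sets_split refl])
    also have "\<dots> = (\<integral>\<^sup>+p. \<integral>\<^sup>+a. \<integral>\<^sup>+t. G t \<partial>?k3 s p a \<partial>?A s p \<partial>split_law \<phi> K)"
      using m3' by (intro nn_integral_cong nn_integral_bind[where B="?T"]) (auto simp: measurable_cong_sets[OF sets_AB(1) refl])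
    also have "\<dots> = (\<integral>\<^sup>+p. \<integral>\<^sup>+a. \<integral>\<^sup>+b. \<integral>\<^sup>+t. G t \<partial>?ret p a b \<partial>?B s p \<partial>?A s p \<partial>split_law \<phi> K)"
      using m4 by (intro nn_integral_cong nn_integral_bind[where B="?T"]) (auto simp: measurable_cong_sets[OF sets_AB(2) refl])
    also have "\<dots> = (\<integral>\<^sup>+p. \<integral>\<^sup>+a. \<integral>\<^sup>+b. G (Node a p b) \<partial>?B s p \<partial>?A s p \<partial>split_law \<phi> K)"
      by (intro nn_integral_cong nn_integral_return) (auto simp: space_tree_sigma)
    finally show "(\<integral>\<^sup>+t. G t \<partial>(if s > l then return ?T Leaf else ?k1 s)) =
      (if s > l then G Leaf else \<integral>\<^sup>+p. \<integral>\<^sup>+a. \<integral>\<^sup>+b. G (Node a p b) \<partial>?B s p \<partial>?A s p \<partial>split_law \<phi> K)"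
      by (auto simp: nn_integral_return)
  qed
  finally show ?thesis .
qed

text \<open>Applies the equation to measurable minorants of \<open>G\<close>. One inequality
  survives, and the nested integrals on the right are lower integrals; this is the form in which
  \<open>leafcount\<close> can be inserted.\<close>

lemma nn_integral_partition_approx_Suc_le:
  assumes K: "compact K"
  shows "(\<integral>\<^sup>+t. G t \<partial>partition_approx \<phi> (Suc n) K l) \<le>
    (\<integral>\<^sup>+s. ennreal (exponential_density (hitting_rate \<phi> K) s) * (if s > l then G Leaf else
       \<integral>\<^sup>+p. \<integral>\<^sup>+a. \<integral>\<^sup>+b. G (Node a p b) \<partial>partition_approx \<phi> n (upper_part K p) (l - s)
          \<partial>partition_approx \<phi> n (lower_part K p) (l - s) \<partial>split_law \<phi> K) \<partial>lborel)"
proof (rule nn_integral_leI_measurable)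
  fix g assume g: "g \<in> borel_measurable (partition_approx \<phi> (Suc n) K l)" "\<And>t. g t \<le> G t"
  then have "g \<in> borel_measurable (tree_sigma borel)"
    by (simp only: measurable_cong_sets[OF partition_approx_space(1)[OF K] refl])
  note * = nn_integral_partition_approx_Suc[OF K this]
  show "(\<integral>\<^sup>+t. g t \<partial>partition_approx \<phi> (Suc n) K l) \<le>
    (\<integral>\<^sup>+s. ennreal (exponential_density (hitting_rate \<phi> K) s) * (if s > l then G Leaf else
       \<integral>\<^sup>+p. \<integral>\<^sup>+a. \<integral>\<^sup>+b. G (Node a p b) \<partial>partition_approx \<phi> n (upper_part K p) (l - s)
          \<partial>partition_approx \<phi> n (lower_part K p) (l - s) \<partial>split_law \<phi> K) \<partial>lborel)"
    unfolding * by (intro nn_integral_mono mult_left_mono) (auto intro!: nn_integral_mono g)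
qed

text \<open>A larger depth only adds outcomes. In the induction the subtrees are deepened one at a
  time, the upper one first; \<open>G\<close> is generalised because the integral over the upper
  subtree becomes the integrand for the lower one.\<close>

lemma partition_approx_mono:
  assumes "compact K" "G \<in> borel_measurable (tree_sigma borel)"
  shows "(\<integral>\<^sup>+t. G t \<partial>partition_approx \<phi> n K l) \<le> (\<integral>\<^sup>+t. G t \<partial>partition_approx \<phi> (Suc n) K l)"
  using assms
proof (induction n arbitrary: K G l)
  case 0
  then show ?case by simp
next
  case (Suc n)
  note [measurable] = Suc.prems(2)
  let ?A = "\<lambda>n s p. partition_approx \<phi> n (lower_part K p) (l - s)"
  let ?B = "\<lambda>n s p. partition_approx \<phi> n (upper_part K p) (l - s)"
  let ?T = "tree_sigma borel :: ('a \<times> real) tree measure"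
  have [measurable]: "a \<in> space ?T" for a by (simp add: space_tree_sigma)
  have B: "(\<integral>\<^sup>+b. G (Node a p b) \<partial>?B n s p) \<le> (\<integral>\<^sup>+b. G (Node a p b) \<partial>?B (Suc n) s p)" for a p s
    by (rule Suc.IH) (use Suc.prems in simp, measurable)
  have A: "(\<integral>\<^sup>+a. \<integral>\<^sup>+b. G (Node a p b) \<partial>?B (Suc n) s p \<partial>?A n s p) \<le>
      (\<integral>\<^sup>+a. \<integral>\<^sup>+b. G (Node a p b) \<partial>?B (Suc n) s p \<partial>?A (Suc n) s p)" for p s
  proof (rule Suc.IH)
    \<comment> \<open>Sigma-finiteness makes the inner integral measurable in \<open>a\<close>, as
      the induction hypothesis requires of its integrand.\<close>
    have "sigma_finite_measure (?B (Suc n) s p)"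
      by (rule subprob_space_imp_sigma_finite[OF partition_approx_space(2)[OF compact_upper_part[OF Suc.prems(1)]]])
    then interpret sigma_finite_measure "?B (Suc n) s p" .
    have "(\<lambda>(a, b). G (Node a p b)) \<in> borel_measurable (?T \<Otimes>\<^sub>M ?T)"
      by measurable
    also have "borel_measurable (?T \<Otimes>\<^sub>M ?T) = borel_measurable (?T \<Otimes>\<^sub>M ?B (Suc n) s p)"
      using Suc.prems(1) by (intro measurable_cong_sets sets_pair_measure_cong) (simp_all only: partition_approx_space(1) compact_upper_part)
    finally show "(\<lambda>a. \<integral>\<^sup>+b. G (Node a p b) \<partial>?B (Suc n) s p) \<in> borel_measurable ?T"
      by (rule borel_measurable_nn_integral)
  qed (use Suc.prems in simp)
  show ?case
    unfolding nn_integral_partition_approx_Suc[OF Suc.prems, of n] nn_integral_partition_approx_Suc[OF Suc.prems, of "Suc n"]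
    by (intro nn_integral_mono mult_left_mono) (auto intro!: nn_integral_mono order_trans[OF _ A] B)
qed

text \<open>Makes the supremum in \<open>partition_law\<close> one over a chain, so that it can be
  evaluated setwise.\<close>

lemma incseq_partition_approx: 
  assumes "compact K"
  shows "incseq (\<lambda>n. partition_approx \<phi> n K l)"
proof (rule incseq_SucI)
  fix n
  note sets = partition_approx_space(1)[OF assms]
  show "partition_approx \<phi> n K l \<le> partition_approx \<phi> (Suc n) K l"
    unfolding le_measure[OF sets[THEN trans, OF sets[symmetric]]]
  proof
    fix A
    show "emeasure (partition_approx \<phi> n K l) A \<le> emeasure (partition_approx \<phi> (Suc n) K l) A"
    proof (cases "A \<in> sets (tree_sigma borel)")
      case True
      then show ?thesis
        using partition_approx_mono[OF assms, of "indicator A" n l]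
        by (simp add: nn_integral_indicator sets)
    next
      case False
      then show ?thesis by (simp add: emeasure_notin_sets sets)
    qed
  qed
qed

lemma nn_integral_partition_law_le:
  assumes "compact K" "\<And>n. (\<integral>\<^sup>+t. F t \<partial>partition_approx \<phi> n K l) \<le> c"
  shows "(\<integral>\<^sup>+t. F t \<partial>partition_law \<phi> K l) \<le> c"
  unfolding partition_law_def
  using nn_integral_SUP_measure_le[OF partition_approx_space(1) incseq_partition_approx] assms by metis

end

section \<open>A branching bound for the number of leaves\<close>

text \<open>For \<open>r = 0\<close> the value is 0 and not 1: the density of the waiting time is
  then identically 0 and its mass is lost, which is harmless for upper bounds.\<close>

lemma nn_integral_exponential_tail:
  assumes "0 \<le> r"
  shows "(\<integral>\<^sup>+s. ennreal (r * exp (- r * s)) * indicator {l..} s \<partial>lborel) = (if r = 0 then 0 else ennreal (exp (- r * l)))"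
proof (cases "r = 0")
  case False
  then have r: "0 < r" using assms by simp
  have "(\<integral>\<^sup>+s. ennreal (r * exp (- r * s)) * indicator {l..} s \<partial>lborel) = ennreal (0 - (- exp (- r * l)))"
  proof (rule nn_integral_FTC_atLeast)
    show "((\<lambda>s. - exp (- r * s)) \<longlongrightarrow> 0) at_top"
      using r by real_asymp
    fix s
    show "((\<lambda>s. - exp (- r * s)) has_real_derivative r * exp (- r * s)) (at s)"
      by (auto intro!: derivative_eq_intros)
  qed (use r in auto)
  then show ?thesis using False by simp
qed simp

text \<open>Inserts \<open>exp (l * c)\<close> into the right side of the backward equation.
  Survival up to \<open>l\<close> contributes at most \<open>exp (- r * l)\<close>; a split at time
  \<open>s\<close> contributes the second term, whose integral is
  \<open>exp (l * c) - exp (- r * l)\<close>. The condition \<open>0 \<le> r + c\<close> keeps this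
  difference non-negative.\<close>

lemma supersolution_integral:
  assumes r: "0 \<le> r" and rc: "0 \<le> r + c" and l: "0 \<le> (l::real)"
  shows "(\<integral>\<^sup>+s. ennreal (r * exp (- r * s)) * indicator {l..} s + ennreal ((r + c) * exp (l * c) * exp (- (r + c) * s)) * indicator {0..l} s \<partial>lborel)
     \<le> ennreal (exp (l * c))"
proof -
  have "(\<integral>\<^sup>+s. ennreal ((r + c) * exp (l * c) * exp (- (r + c) * s)) * indicator {0..l} s \<partial>lborel) =
      ennreal (- exp (l * c) * exp (- (r + c) * l) - (- exp (l * c) * exp (- (r + c) * 0)))"
  proof (rule nn_integral_FTC_Icc)
    fix s
    show "((\<lambda>s. - exp (l * c) * exp (- (r + c) * s)) has_real_derivative (r + c) * exp (l * c) * exp (- (r + c) * s)) (at s)"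
      by (auto intro!: derivative_eq_intros) (simp add: algebra_simps)
  qed (use rc l in auto)
  also have "\<dots> = ennreal (exp (l * c) - exp (- r * l))"
    by (simp add: exp_add[symmetric] algebra_simps)
  finally have 1: "(\<integral>\<^sup>+s. ennreal ((r + c) * exp (l * c) * exp (- (r + c) * s)) * indicator {0..l} s \<partial>lborel) = ennreal (exp (l * c) - exp (- r * l))" .
  have 2: "- r * l \<le> l * c" using mult_nonneg_nonneg[OF l rc] by (simp add: algebra_simps)
  have "(\<integral>\<^sup>+s. ennreal (r * exp (- r * s)) * indicator {l..} s + ennreal ((r + c) * exp (l * c) * exp (- (r + c) * s)) * indicator {0..l} s \<partial>lborel) \<le>
     ennreal (exp (- r * l)) + ennreal (exp (l * c) - exp (- r * l))"
    by (subst nn_integral_add) (simp_all only: 1 nn_integral_exponential_tail[OF r] split: if_split, simp_all)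
  also have "\<dots> = ennreal (exp (l * c))"
    using 2 by (subst ennreal_plus[symmetric]) auto
  finally show ?thesis .
qed

context direction_law
begin

text \<open>
  The expected number of alive leaves solves a backward equation whose solution is dominated by
  \<open>exp (l * c)\<close> as soon as the mean offspring of an alive cell \<open>K\<close> at its first split is at most
  \<open>1 + c / hitting_rate \<phi> K\<close>.
\<close>

lemma leafcount_partition_approx_le:
  assumes anti: "\<And>K K'. K' \<subseteq> K \<Longrightarrow> alive K' \<Longrightarrow> alive K"
    and G: "G \<in> borel_measurable borel"
    and offspring: "\<And>K u t. compact K \<Longrightarrow> u \<noteq> 0 \<Longrightarrow> of_bool (alive (lower_part K (u, t))) + of_bool (alive (upper_part K (u, t))) \<le> G (u, t)"
    and rate: "\<And>K. compact K \<Longrightarrow> alive K \<Longrightarrow> 0 \<le> hitting_rate \<phi> K \<and> 0 \<le> hitting_rate \<phi> K + c \<and> K \<noteq> {} \<and>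
       (\<integral>\<^sup>+u. (\<integral>\<^sup>+t. G (u, t) * indicator {- support_function K (- u) .. support_function K u} t \<partial>lborel) \<partial>\<phi>) \<le> ennreal (hitting_rate \<phi> K + c)"
    and K: "compact K" and l: "0 \<le> l"
  shows "(\<integral>\<^sup>+t. leafcount alive t K \<partial>partition_approx \<phi> n K l) \<le> of_bool (alive K) * ennreal (exp (l * c))"
  using K l
proof (induction n arbitrary: K l)
  case 0
  then show ?case by simp
next
  case (Suc n)
  note K = \<open>compact K\<close>
  \<comment> \<open>The value \<infinity> at null normals matches \<open>leafcount\<close>; a dead
    cell has offspring 0, because by \<open>anti\<close> no part of it is alive.\<close>
  define B where "B p = (if fst p = 0 then \<infinity> else if alive K then G p else 0)" for p
  have "closed {p :: 'a \<times> real. fst p = 0}"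
    by (intro closed_Collect_eq continuous_intros)
  then have B_meas [measurable]: "B \<in> borel_measurable borel"
    unfolding B_def using G by (intro measurable_If measurable_const) (auto intro: borel_closed)
  let ?A = "\<lambda>s p. partition_approx \<phi> n (lower_part K p) (l - s)"
  let ?B = "\<lambda>s p. partition_approx \<phi> n (upper_part K p) (l - s)"
  have inner: "(\<integral>\<^sup>+p. \<integral>\<^sup>+a. \<integral>\<^sup>+b. leafcount alive (Node a p b) K \<partial>?B s p \<partial>?A s p \<partial>split_law \<phi> K)
      \<le> ennreal (exp ((l - s) * c)) * (\<integral>\<^sup>+p. B p \<partial>split_law \<phi> K)" if s: "s \<le> l" for s
  proof -
    have "(\<integral>\<^sup>+a. \<integral>\<^sup>+b. leafcount alive (Node a p b) K \<partial>?B s p \<partial>?A s p) \<le> ennreal (exp ((l - s) * c)) * B p" for p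
    proof (cases "fst p = 0")
      case True
      then show ?thesis by (simp add: B_def ennreal_mult_top)
    next
      case False
      let ?lc = "\<lambda>t K. leafcount alive t K" and ?e = "ennreal (exp ((l - s) * c))"
      have mass: "x * emeasure (?A s p) (space (?A s p)) \<le> x" "x * emeasure (?B s p) (space (?B s p)) \<le> x" for x
      proof -
        have "x * emeasure N (space N) \<le> x" if "subprob_space N" for N :: "('a \<times> real) tree measure" and x
          using mult_left_mono[OF subprob_space.subprob_emeasure_le_1[OF that], of x] by simp
        then show "x * emeasure (?A s p) (space (?A s p)) \<le> x" "x * emeasure (?B s p) (space (?B s p)) \<le> x"
          using partition_approx_space(2) K by simp_all
      qed
      have "(\<integral>\<^sup>+a. \<integral>\<^sup>+b. ?lc (Node a p b) K \<partial>?B s p \<partial>?A s p) =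
        (\<integral>\<^sup>+a. \<integral>\<^sup>+b. ?lc a (lower_part K p) + ?lc b (upper_part K p) \<partial>?B s p \<partial>?A s p)"
        using False by simp
      \<comment> \<open>Leaf counts may be non-measurable. With one subtree fixed the other summand
        is a constant, so \<open>nn_integral_const_add_le\<close>, used twice, replaces
        additivity.\<close>
      also have "\<dots> \<le> (\<integral>\<^sup>+a. (\<integral>\<^sup>+b. ?lc b (upper_part K p) \<partial>?B s p) + ?lc a (lower_part K p) \<partial>?A s p)"
      proof (rule nn_integral_mono)
        fix a
        have "(\<integral>\<^sup>+b. ?lc a (lower_part K p) + ?lc b (upper_part K p) \<partial>?B s p) \<le>
          ?lc a (lower_part K p) + (\<integral>\<^sup>+b. ?lc b (upper_part K p) \<partial>?B s p)"
          by (rule order_trans[OF nn_integral_const_add_le add_right_mono[OF mass(2)]])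
        then show "(\<integral>\<^sup>+b. ?lc a (lower_part K p) + ?lc b (upper_part K p) \<partial>?B s p) \<le>
          (\<integral>\<^sup>+b. ?lc b (upper_part K p) \<partial>?B s p) + ?lc a (lower_part K p)"
          by (simp only: add.commute)
      qed
      also have "\<dots> \<le> (\<integral>\<^sup>+b. ?lc b (upper_part K p) \<partial>?B s p) + (\<integral>\<^sup>+a. ?lc a (lower_part K p) \<partial>?A s p)"
        by (rule order_trans[OF nn_integral_const_add_le add_right_mono[OF mass(1)]])
      also have "\<dots> \<le> of_bool (alive (upper_part K p)) * ?e + of_bool (alive (lower_part K p)) * ?e"
        using K s by (intro add_mono Suc.IH) auto
      also have "\<dots> = ?e * (of_bool (alive (lower_part K p)) + of_bool (alive (upper_part K p)))"
        by (simp only: distrib_left mult.commute add.commute)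
      also have "\<dots> \<le> ?e * B p"
      proof (rule mult_left_mono)
        show "of_bool (alive (lower_part K p)) + of_bool (alive (upper_part K p)) \<le> B p"
        proof (cases "alive K")
          case True
          then show ?thesis using False offspring[OF K, of "fst p" "snd p"] by (simp add: B_def)
        next
          case alive: False
          have "lower_part K p \<subseteq> K" "upper_part K p \<subseteq> K"
            by (auto simp: lower_part_def upper_part_def)
          then have "\<not> alive (lower_part K p)" "\<not> alive (upper_part K p)"
            using alive anti by blast+
          then show ?thesis by simp
        qed
      qed simp
      finally show ?thesis .
    qed
    then have "(\<integral>\<^sup>+p. \<integral>\<^sup>+a. \<integral>\<^sup>+b. leafcount alive (Node a p b) K \<partial>?B s p \<partial>?A s p \<partial>split_law \<phi> K) \<le>
       (\<integral>\<^sup>+p. ennreal (exp ((l - s) * c)) * B p \<partial>split_law \<phi> K)"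
      by (intro nn_integral_mono)
    also have "\<dots> = ennreal (exp ((l - s) * c)) * (\<integral>\<^sup>+p. B p \<partial>split_law \<phi> K)"
    proof (rule nn_integral_cmult)
      have "sets (split_law \<phi> K) = sets borel"
        using measurable_space[OF measurable_split_law, of K] K by (simp add: space_subprob_algebra space_compact_sets)
      then have "borel_measurable (split_law \<phi> K) = (borel_measurable borel :: ('a \<times> real \<Rightarrow> ennreal) set)"
        by (intro measurable_cong_sets refl)
      then show "B \<in> borel_measurable (split_law \<phi> K)" using B_meas by (simp only:)
    qed
    finally show ?thesis .
  qed
  have "(\<integral>\<^sup>+t. leafcount alive t K \<partial>partition_approx \<phi> (Suc n) K l) \<le>
     (\<integral>\<^sup>+s. ennreal (exponential_density (hitting_rate \<phi> K) s) * (if s > l then of_bool (alive K) else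
       \<integral>\<^sup>+p. \<integral>\<^sup>+a. \<integral>\<^sup>+b. leafcount alive (Node a p b) K \<partial>?B s p \<partial>?A s p \<partial>split_law \<phi> K) \<partial>lborel)"
    using nn_integral_partition_approx_Suc_le[OF K, where G="\<lambda>t. leafcount alive t K" and n=n and l=l] by (simp only: leafcount.simps(1))
  also have "\<dots> \<le> (\<integral>\<^sup>+s. ennreal (exponential_density (hitting_rate \<phi> K) s) * (if s > l then of_bool (alive K) else
       ennreal (exp ((l - s) * c)) * (\<integral>\<^sup>+p. B p \<partial>split_law \<phi> K)) \<partial>lborel)"
    by (intro nn_integral_mono mult_left_mono) (use inner in auto)
  also have "\<dots> \<le> of_bool (alive K) * ennreal (exp (l * c))"
  proof (cases "alive K")
    case False
    have "(\<integral>\<^sup>+p. B p \<partial>split_law \<phi> K) = (\<integral>\<^sup>+u. 0 \<partial>\<phi>)"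
      unfolding nn_integral_split_law[OF K B_meas]
    proof (rule nn_integral_cong)
      fix u assume "u \<in> space \<phi>"
      then have "u \<noteq> 0" by (auto simp: space_\<phi>)
      then show "ennreal (width K u / hitting_rate \<phi> K) * ((\<integral>\<^sup>+t. B (u, t) * indicator {- support_function K (- u) .. support_function K u} t \<partial>lborel) / ennreal (width K u)) = 0"
        using False by (simp add: B_def)
    qed
    then have "(\<integral>\<^sup>+p. B p \<partial>split_law \<phi> K) = 0" by simp
    then show ?thesis using False by (simp cong: if_cong)
  next
    case True
    let ?r = "hitting_rate \<phi> K"
    have r: "0 \<le> ?r" "0 \<le> ?r + c" "K \<noteq> {}" using rate[OF K True] by auto
    \<comment> \<open>Only the product of the rate with the mean offspring is controlled; this
      suffices because the exponential density supplies the factor \<open>?r\<close>.\<close>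
    have "ennreal ?r * (\<integral>\<^sup>+p. B p \<partial>split_law \<phi> K) \<le>
      (\<integral>\<^sup>+u. (\<integral>\<^sup>+t. B (u, t) * indicator {- support_function K (- u) .. support_function K u} t \<partial>lborel) \<partial>\<phi>)"
      by (rule hitting_rate_split_law_le[OF K r(3) B_meas])
    also have "\<dots> = (\<integral>\<^sup>+u. (\<integral>\<^sup>+t. G (u, t) * indicator {- support_function K (- u) .. support_function K u} t \<partial>lborel) \<partial>\<phi>)"
    proof (rule nn_integral_cong)
      fix u assume "u \<in> space \<phi>"
      then have "u \<noteq> 0" by (auto simp: space_\<phi>)
      then show "(\<integral>\<^sup>+t. B (u, t) * indicator {- support_function K (- u) .. support_function K u} t \<partial>lborel) =
          (\<integral>\<^sup>+t. G (u, t) * indicator {- support_function K (- u) .. support_function K u} t \<partial>lborel)"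
        using True by (simp add: B_def)
    qed
    also have "\<dots> \<le> ennreal (?r + c)" using rate[OF K True] by auto
    finally have q: "ennreal ?r * (\<integral>\<^sup>+p. B p \<partial>split_law \<phi> K) \<le> ennreal (?r + c)" .
    have "(\<integral>\<^sup>+s. ennreal (exponential_density ?r s) * (if s > l then of_bool (alive K) else
       ennreal (exp ((l - s) * c)) * (\<integral>\<^sup>+p. B p \<partial>split_law \<phi> K)) \<partial>lborel) \<le>
       (\<integral>\<^sup>+s. ennreal (?r * exp (- ?r * s)) * indicator {l..} s + ennreal ((?r + c) * exp (l * c) * exp (- (?r + c) * s)) * indicator {0..l} s \<partial>lborel)"
    proof (rule nn_integral_mono)
      fix s
      consider "s < 0" | "0 \<le> s" "s \<le> l" | "0 \<le> s" "l < s" by linarith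
      then show "ennreal (exponential_density ?r s) * (if s > l then of_bool (alive K) else
         ennreal (exp ((l - s) * c)) * (\<integral>\<^sup>+p. B p \<partial>split_law \<phi> K)) \<le>
         ennreal (?r * exp (- ?r * s)) * indicator {l..} s + ennreal ((?r + c) * exp (l * c) * exp (- (?r + c) * s)) * indicator {0..l} s"
      proof cases
        case 1
        then show ?thesis by (simp add: exponential_density_def)
      next
        case 2
        have "ennreal (exponential_density ?r s) * (ennreal (exp ((l - s) * c)) * (\<integral>\<^sup>+p. B p \<partial>split_law \<phi> K)) =
           ennreal (exp (- ?r * s) * exp ((l - s) * c)) * (ennreal ?r * (\<integral>\<^sup>+p. B p \<partial>split_law \<phi> K))"
        proof -
          have "exponential_density ?r s = exp (- ?r * s) * ?r"
            using 2 by (simp add: exponential_density_def mult.commute)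
          then have 1: "ennreal (exponential_density ?r s) = ennreal (exp (- ?r * s)) * ennreal ?r"
            by (simp only: ennreal_mult' exp_ge_zero)
          have 2: "ennreal (exp (- ?r * s) * exp ((l - s) * c)) = ennreal (exp (- ?r * s)) * ennreal (exp ((l - s) * c))"
            by (simp only: ennreal_mult' exp_ge_zero)
          show ?thesis unfolding 1 2 by (simp only: mult_ac)
        qed
        also have "\<dots> \<le> ennreal (exp (- ?r * s) * exp ((l - s) * c)) * ennreal (?r + c)"
          by (intro mult_left_mono q) simp
        also have "\<dots> = ennreal (exp (- ?r * s) * exp ((l - s) * c) * (?r + c))"
          by (rule ennreal_mult'[symmetric]) simp
        also have "exp (- ?r * s) * exp ((l - s) * c) = exp (l * c) * exp (- (?r + c) * s)"
          unfolding exp_add[symmetric] by (rule arg_cong[where f=exp]) (simp add: algebra_simps)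
        also have "exp (l * c) * exp (- (?r + c) * s) * (?r + c) = (?r + c) * exp (l * c) * exp (- (?r + c) * s)"
          by (simp only: mult_ac)
        finally show ?thesis using 2 by (simp add: add_increasing)
      next
        case 3
        then show ?thesis using True by (simp add: exponential_density_def mult.commute)
      qed
    qed
    also have "\<dots> \<le> ennreal (exp (l * c))"
      by (rule supersolution_integral) (use r Suc.prems in auto)
    finally show ?thesis using True by simp
  qed
  finally show ?case .
qed

end

section \<open>Cells of the splitting tree\<close>

lemma tree_cells_subset: "c \<in> tree_cells t K \<Longrightarrow> c \<subseteq> K"
  by (induction t arbitrary: K) (fastforce simp: lower_part_def upper_part_def)+

lemma Union_tree_cells: "\<Union> (tree_cells t K) = K"
proof (induction t arbitrary: K)
  case (Node a p b)
  then show ?case by (auto simp: lower_part_def upper_part_def Union_Un_distrib)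
qed simp

lemma closed_lower_part: "closed K \<Longrightarrow> closed (lower_part K p)"
  unfolding lower_part_def by (intro closed_Int closed_Collect_le continuous_intros)

lemma closed_upper_part: "closed K \<Longrightarrow> closed (upper_part K p)"
  by (simp add: upper_part_eq closed_lower_part)

lemma convex_lower_part: "convex K \<Longrightarrow> convex (lower_part K p)"
  unfolding lower_part_def using convex_halfspace_le[of "fst p" "snd p"]
  by (intro convex_Int) (simp_all add: inner_commute)

lemma convex_upper_part: "convex K \<Longrightarrow> convex (upper_part K p)"
  by (simp add: upper_part_eq convex_lower_part)

lemma closed_tree_cells: "closed K \<Longrightarrow> c \<in> tree_cells t K \<Longrightarrow> closed c"
proof (induction t arbitrary: K)
  case (Node a p b)
  then show ?case using closed_lower_part[of K p] closed_upper_part[of K p] by auto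
qed simp

lemma boundary_union_tree_Node:
  "boundary_union (tree_cells (Node a p b) K) =
     boundary_union (tree_cells a (lower_part K p)) \<union> boundary_union (tree_cells b (upper_part K p))"
  by (auto simp: boundary_union_def)

lemma leafcount_ge_1: "c \<in> tree_cells t K \<Longrightarrow> alive c \<Longrightarrow> 1 \<le> leafcount alive t K"
proof (induction t arbitrary: K)
  case (Node a p b)
  then consider "1 \<le> leafcount alive a (lower_part K p)" | "1 \<le> leafcount alive b (upper_part K p)"
    by auto
  then show ?case by cases (auto simp: add_increasing add_increasing2)
qed simp

lemma hyperplane_not_interior:
  assumes "u \<noteq> 0" "z \<bullet> u = t" "S \<subseteq> {x. x \<bullet> u \<le> t}"
  shows "z \<notin> interior S"
proof
  assume "z \<in> interior S"
  then have "z \<in> interior {x. u \<bullet> x \<le> t}" using interior_mono[OF assms(3)] by (auto simp: inner_commute)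
  then show False using assms(1,2) interior_halfspace_le[of u t] by (simp add: inner_commute)
qed

text \<open>Every cell below the cut lies in the closed half-space, so a point of the cutting
  hyperplane is never interior to it. Hence either subtree sees the common face in its own boundary,
  which inductions over the tree need.\<close>

lemma boundary_union_lower_part:
  assumes K: "closed K" and p: "fst p \<noteq> 0" and z: "z \<in> lower_part K p" "z \<bullet> fst p = snd p"
  shows "z \<in> boundary_union (tree_cells a (lower_part K p))"
proof -
  obtain c where c: "c \<in> tree_cells a (lower_part K p)" "z \<in> c"
    using z(1) Union_tree_cells[of a "lower_part K p"] by blast
  have "c \<subseteq> {x. x \<bullet> fst p \<le> snd p}"
    using tree_cells_subset[OF c(1)] by (auto simp: lower_part_def)
  then have "z \<notin> interior c" using hyperplane_not_interior[OF p z(2)] by blast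
  then show ?thesis
    using c closure_subset[of c] by (auto simp: boundary_union_def frontier_def)
qed

lemma boundary_union_upper_part:
  assumes "closed K" "fst p \<noteq> 0" "z \<in> upper_part K p" "z \<bullet> fst p = snd p"
  shows "z \<in> boundary_union (tree_cells a (upper_part K p))"
  using boundary_union_lower_part[of K "- p" z a] assms by (simp add: upper_part_eq)

lemma boundary_union_tree_subset: "closed K \<Longrightarrow> boundary_union (tree_cells t K) \<subseteq> K"
proof -
  assume K: "closed K"
  have "frontier c \<subseteq> K" if "c \<in> tree_cells t K" for c
    using closed_tree_cells[OF K that] tree_cells_subset[OF that] by (auto simp: frontier_def)
  then show ?thesis unfolding boundary_union_def by blast
qed

text \<open>Certifies distinct cells by the boundary set alone. If \<open>F\<close> is the boundary
  of a partition into convex cells, no two points of \<open>J\<close> share a cell interior, so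
  \<open>card J\<close> bounds the number of cells from below; yet only hits of \<open>F\<close>
  with compact sets are mentioned.\<close>

definition separated :: "'a::euclidean_space set \<Rightarrow> 'a set \<Rightarrow> bool" where
  "separated J F \<longleftrightarrow> (\<forall>q\<in>J. q \<notin> F \<and> (\<forall>q'\<in>J. q \<noteq> q' \<longrightarrow> closed_segment q q' \<inter> F \<noteq> {}))"

text \<open>Induction over the tree. At a leaf two separated points would be interior to a convex
  cell whose frontier their segment meets. At a node \<open>J\<close> is divided by the half-spaces:
  a segment between points on the same side stays there, so where it meets the boundary of the other
  subtree it lies on the hyperplane, which is part of its own boundary as well. The set
  \<open>U\<close> accounts for the boundary being known only in the interior of the window.\<close>

lemma card_separated_le_leafcount:
  assumes "closed K" "convex K" "finite J" "J \<subseteq> K \<inter> A \<inter> U"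
    and "separated J (boundary_union (tree_cells t K) \<inter> U)"
  shows "of_nat (card J) \<le> leafcount (\<lambda>K. K \<inter> A \<noteq> {}) t K"
  using assms
proof (induction t arbitrary: K J)
  case Leaf
  have "q = q'" if q: "q \<in> J" "q' \<in> J" for q q'
  proof (rule ccontr)
    assume ne: "q \<noteq> q'"
    have "q \<in> interior K" "q' \<in> interior K"
      using q Leaf.prems by (auto simp: separated_def boundary_union_def frontier_def)
    then have "closed_segment q q' \<subseteq> interior K"
      using convex_interior[OF Leaf.prems(2)] by (simp add: closed_segment_subset)
    then show False using q ne Leaf.prems(5) by (fastforce simp: separated_def boundary_union_def frontier_def)
  qed
  then have "card J \<le> 1" using Leaf.prems(3) by (simp add: card_le_Suc0_iff_eq)
  then have 1: "(of_nat (card J) :: ennreal) \<le> of_nat 1" by (rule of_nat_mono)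
  show ?case
  proof (cases "J = {}")
    case False
    then have "K \<inter> A \<noteq> {}" using Leaf.prems(4) by auto
    then show ?thesis using 1 by simp
  qed simp
next
  case (Node a p b)
  show ?case
  proof (cases "fst p = 0")
    case True
    then show ?thesis by simp
  next
    case False
    note K = Node.prems(1,2)
    let ?L = "lower_part K p" and ?H = "upper_part K p"
    have seg: "closed_segment q q' \<subseteq> ?L" if "q \<in> ?L" "q' \<in> ?L" for q q'
      using that convex_lower_part[OF K(2)] by (simp add: closed_segment_subset)
    have seg': "closed_segment q q' \<subseteq> ?H" if "q \<in> ?H" "q' \<in> ?H" for q q'
      using that convex_upper_part[OF K(2)] by (simp add: closed_segment_subset)
    have on: "z \<bullet> fst p = snd p" if "z \<in> ?L" "z \<in> ?H" for z
      using that by (auto simp: lower_part_def upper_part_def)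
    have subL: "boundary_union (tree_cells a ?L) \<subseteq> ?L" and subH: "boundary_union (tree_cells b ?H) \<subseteq> ?H"
      using boundary_union_tree_subset closed_lower_part closed_upper_part K by blast+
    have sep: "separated J ((boundary_union (tree_cells a ?L) \<union> boundary_union (tree_cells b ?H)) \<inter> U)"
      using Node.prems(5) by (simp only: boundary_union_tree_Node)
    have 1: "of_nat (card (J \<inter> ?L)) \<le> leafcount (\<lambda>K. K \<inter> A \<noteq> {}) a ?L"
    proof (rule Node.IH(1))
      show "separated (J \<inter> ?L) (boundary_union (tree_cells a ?L) \<inter> U)"
        unfolding separated_def
      proof (intro ballI conjI impI)
        fix q q' assume q: "q \<in> J \<inter> ?L" "q' \<in> J \<inter> ?L" "q \<noteq> q'"
        then obtain z where z: "z \<in> closed_segment q q'" "z \<in> U"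
            "z \<in> boundary_union (tree_cells a ?L) \<or> z \<in> boundary_union (tree_cells b ?H)"
          using sep unfolding separated_def by blast
        then have "z \<in> boundary_union (tree_cells a ?L)"
          using q seg[of q q'] subH on[of z] boundary_union_lower_part[OF K(1) False, of z a] by blast
        then show "closed_segment q q' \<inter> (boundary_union (tree_cells a ?L) \<inter> U) \<noteq> {}" using z by blast
      qed (use sep in \<open>auto simp: separated_def\<close>)
    qed (use Node.prems closed_lower_part[of K p] convex_lower_part[of K p] in auto)
    have 2: "of_nat (card (J \<inter> ?H)) \<le> leafcount (\<lambda>K. K \<inter> A \<noteq> {}) b ?H"
    proof (rule Node.IH(2))
      show "separated (J \<inter> ?H) (boundary_union (tree_cells b ?H) \<inter> U)"
        unfolding separated_def
      proof (intro ballI conjI impI)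
        fix q q' assume q: "q \<in> J \<inter> ?H" "q' \<in> J \<inter> ?H" "q \<noteq> q'"
        then obtain z where z: "z \<in> closed_segment q q'" "z \<in> U"
            "z \<in> boundary_union (tree_cells a ?L) \<or> z \<in> boundary_union (tree_cells b ?H)"
          using sep unfolding separated_def by blast
        then have "z \<in> boundary_union (tree_cells b ?H)"
          using q seg'[of q q'] subL on[of z] boundary_union_upper_part[OF K(1) False, of z b] by blast
        then show "closed_segment q q' \<inter> (boundary_union (tree_cells b ?H) \<inter> U) \<noteq> {}" using z by blast
      qed (use sep in \<open>auto simp: separated_def\<close>)
    qed (use Node.prems closed_upper_part[of K p] convex_upper_part[of K p] in auto)
    have "J = (J \<inter> ?L) \<union> (J \<inter> ?H)" using Node.prems(4) by (force simp: lower_part_def upper_part_def)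
    then have "card J \<le> card (J \<inter> ?L) + card (J \<inter> ?H)" by (metis card_Un_le)
    then have "(of_nat (card J) :: ennreal) \<le> of_nat (card (J \<inter> ?L)) + of_nat (card (J \<inter> ?H))"
      by (metis of_nat_add of_nat_mono)
    also have "\<dots> \<le> leafcount (\<lambda>K. K \<inter> A \<noteq> {}) a ?L + leafcount (\<lambda>K. K \<inter> A \<noteq> {}) b ?H"
      by (intro add_mono 1 2)
    finally show ?thesis using False by simp
  qed
qed

text \<open>The segment cannot leave a cell containing \<open>x\<close> without crossing its
  frontier, so \<open>y\<close> lies in the same cell, which is then alive.\<close>

lemma leafcount_cone_ge_1:
  assumes K: "closed K" "x \<in> K" "y \<in> C" and U: "closed_segment x y \<subseteq> U"
    and seg: "closed_segment x y \<inter> (boundary_union (tree_cells t K) \<inter> U) = {}"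
  shows "1 \<le> leafcount (\<lambda>K. x \<in> K \<and> K \<inter> C \<noteq> {}) t K"
proof -
  obtain c where c: "c \<in> tree_cells t K" "x \<in> c" using Union_tree_cells[of t K] K(2) by blast
  have fr: "closed_segment x y \<inter> frontier c = {}"
    using seg U c(1) unfolding boundary_union_def by blast
  have "y \<in> c"
  proof (rule ccontr)
    assume "y \<notin> c"
    then have "closed_segment x y - c \<noteq> {}" "closed_segment x y \<inter> c \<noteq> {}"
      using c(2) ends_in_segment[of x y] by blast+
    then show False using connected_Int_frontier[OF connected_segment(1)] fr by blast
  qed
  then show ?thesis using leafcount_ge_1[OF c(1), of "\<lambda>K. x \<in> K \<and> K \<inter> C \<noteq> {}"] c(2) K(3) by blast
qed

text \<open>A lower estimate, read off the boundary, of the number of cells meeting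
  \<open>A\<close>. Countability of \<open>A\<close> will make it measurable on
  \<open>hitting_space\<close>, and points of a dense set reach every cell.\<close>

definition sep_count :: "'a::euclidean_space set \<Rightarrow> 'a set \<Rightarrow> ennreal" where
  "sep_count A F = (SUP J\<in>{J. finite J \<and> J \<subseteq> A \<and> separated J F}. of_nat (card J))"

lemma sets_separated: "finite J \<Longrightarrow> {F. separated J F} \<in> sets hitting_space"
proof -
  assume J: "finite J"
  have "{F. separated J F} = {F \<in> space hitting_space. \<forall>q\<in>J. \<not> F \<in> {F. F \<inter> {q} \<noteq> {}} \<and> (\<forall>q'\<in>J. q \<noteq> q' \<longrightarrow> F \<in> {F. F \<inter> closed_segment q q' \<noteq> {}})}"
    by (auto simp: separated_def)
  also have "\<dots> \<in> sets hitting_space"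
  proof (intro sets.sets_Collect_finite_All sets.sets_Collect_conj sets.sets_Collect_neg J)
    fix q q'
    show "{F \<in> space hitting_space. F \<in> {F. F \<inter> {q} \<noteq> {}}} \<in> sets hitting_space"
      using hitting_sets[of "{q}"] by simp
    show "{F \<in> space hitting_space. q \<noteq> q' \<longrightarrow> F \<in> {F. F \<inter> closed_segment q q' \<noteq> {}}} \<in> sets hitting_space"
      using hitting_sets[of "closed_segment q q'"] sets.top[of hitting_space] by (cases "q = q'") simp_all
  qed
  finally show ?thesis .
qed

lemma measurable_sep_count:
  assumes "countable A"
  shows "sep_count A \<in> borel_measurable hitting_space"
proof -
  \<comment> \<open>The index set depends on \<open>F\<close>; moving the condition into an
    indicator leaves a supremum over the fixed countable family of finite subsets.\<close>
  have eq: "sep_count A = (\<lambda>F. SUP J\<in>{J. finite J \<and> J \<subseteq> A}. of_nat (card J) * indicator {F. separated J F} F)"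
  proof
    fix F
    show "sep_count A F = (SUP J\<in>{J. finite J \<and> J \<subseteq> A}. of_nat (card J) * indicator {F. separated J F} F)"
      unfolding sep_count_def
    proof (rule antisym; rule SUP_least)
      fix J assume "J \<in> {J. finite J \<and> J \<subseteq> A \<and> separated J F}"
      then show "of_nat (card J) \<le> (SUP J\<in>{J. finite J \<and> J \<subseteq> A}. of_nat (card J) * indicator {F. separated J F} F :: ennreal)"
        by (intro SUP_upper2[of J]) auto
    next
      fix J assume "J \<in> {J. finite J \<and> J \<subseteq> A}"
      then show "of_nat (card J) * indicator {F. separated J F} F \<le> (SUP J\<in>{J. finite J \<and> J \<subseteq> A \<and> separated J F}. of_nat (card J) :: ennreal)"
        by (cases "separated J F") (auto intro!: SUP_upper)
    qed
  qed
  have "countable {J. finite J \<and> J \<subseteq> A}"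
    using countable_Collect_finite_subset[OF assms] .
  then show ?thesis
    unfolding eq
  proof (rule borel_measurable_SUP)
    fix J assume "J \<in> {J. finite J \<and> J \<subseteq> A}"
    then have [measurable]: "{F. separated J F} \<in> sets hitting_space" by (simp add: sets_separated)
    show "(\<lambda>F. of_nat (card J) * indicator {F. separated J F} F :: ennreal) \<in> borel_measurable hitting_space"
      by measurable
  qed
qed

section \<open>Mean offspring for balls and for cones\<close>

lemma of_bool_add_le:
  fixes c :: ennreal
  assumes "\<not> (a \<and> b)" "a \<or> b \<Longrightarrow> 1 \<le> c"
  shows "of_bool a + of_bool b \<le> c"
  using assms by (cases a; cases b) simp_all

context direction_law
begin

lemma leafcount_partition_law_le:
  assumes "\<And>K K'. K' \<subseteq> K \<Longrightarrow> alive K' \<Longrightarrow> alive K"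
    and "G \<in> borel_measurable borel"
    and "\<And>K u t. compact K \<Longrightarrow> u \<noteq> 0 \<Longrightarrow> of_bool (alive (lower_part K (u, t))) + of_bool (alive (upper_part K (u, t))) \<le> G (u, t)"
    and "\<And>K. compact K \<Longrightarrow> alive K \<Longrightarrow> 0 \<le> hitting_rate \<phi> K \<and> 0 \<le> hitting_rate \<phi> K + c \<and> K \<noteq> {} \<and>
       (\<integral>\<^sup>+u. (\<integral>\<^sup>+t. G (u, t) * indicator {- support_function K (- u) .. support_function K u} t \<partial>lborel) \<partial>\<phi>) \<le> ennreal (hitting_rate \<phi> K + c)"
    and "compact K" and "0 \<le> l"
  shows "(\<integral>\<^sup>+t. leafcount alive t K \<partial>partition_law \<phi> K l) \<le> ennreal (exp (l * c))"
proof (rule nn_integral_partition_law_le[OF assms(5)])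
  fix n
  have "(\<integral>\<^sup>+t. leafcount alive t K \<partial>partition_approx \<phi> n K l) \<le> of_bool (alive K) * ennreal (exp (l * c))"
    by (rule leafcount_partition_approx_le[where G=G]) (use assms in auto)
  also have "\<dots> \<le> ennreal (exp (l * c))" by (cases "alive K") auto
  finally show "(\<integral>\<^sup>+t. leafcount alive t K \<partial>partition_approx \<phi> n K l) \<le> ennreal (exp (l * c))" .
qed

text \<open>Both children meet the ball only if the hyperplane meets the closed ball. For a unit
  normal the offsets of such hyperplanes form an interval of length \<open>2 * r\<close>, so the
  offspring integral exceeds \<open>hitting_rate \<phi> K\<close> by at most
  \<open>2 * r\<close>.\<close>

lemma leafcount_ball_le:
  assumes "compact K" "0 \<le> l" "0 \<le> r"
  shows "(\<integral>\<^sup>+t. leafcount (\<lambda>K. K \<inter> ball z r \<noteq> {}) t K \<partial>partition_law \<phi> K l) \<le> ennreal (exp (l * (2 * r)))"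
proof -
  let ?G = "\<lambda>p :: 'a \<times> real. 1 + indicator {p. \<bar>snd p - fst p \<bullet> z\<bar> \<le> r * norm (fst p)} p :: ennreal"
  show ?thesis
  proof (rule leafcount_partition_law_le[where G="?G"])
    have "closed {p :: 'a \<times> real. \<bar>snd p - fst p \<bullet> z\<bar> \<le> r * norm (fst p)}"
      by (intro closed_Collect_le continuous_intros)
    then show "?G \<in> borel_measurable borel"
      by (intro borel_measurable_add borel_measurable_indicator borel_measurable_const borel_closed)
    fix K :: "'a set" and u :: 'a and t :: real
    assume K: "compact K"
    show "of_bool (lower_part K (u, t) \<inter> ball z r \<noteq> {}) + of_bool (upper_part K (u, t) \<inter> ball z r \<noteq> {}) \<le> ?G (u, t)"
    proof (cases "lower_part K (u, t) \<inter> ball z r \<noteq> {} \<and> upper_part K (u, t) \<inter> ball z r \<noteq> {}")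
      case True
      then obtain y y' where "y \<in> lower_part K (u, t) \<inter> ball z r" "y' \<in> upper_part K (u, t) \<inter> ball z r"
        by blast
      then have y: "y \<bullet> u \<le> t" "t \<le> y' \<bullet> u" "norm (y - z) \<le> r" "norm (y' - z) \<le> r"
        by (auto simp: lower_part_def upper_part_def dist_norm norm_minus_commute)
      have "\<bar>(y - z) \<bullet> u\<bar> \<le> r * norm u" "\<bar>(y' - z) \<bullet> u\<bar> \<le> r * norm u"
        using y(3,4) by (blast intro: order_trans[OF Cauchy_Schwarz_ineq2] mult_right_mono norm_ge_zero)+
      then have "\<bar>t - u \<bullet> z\<bar> \<le> r * norm u"
        using y(1,2) unfolding abs_le_iff inner_diff_left inner_commute[of u z] by linarith
      then show ?thesis by (auto simp: of_bool_def)
    qed (auto simp: of_bool_def)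
    assume alive: "K \<inter> ball z r \<noteq> {}"
    then have K0: "K \<noteq> {}" by auto
    have "(\<integral>\<^sup>+u. (\<integral>\<^sup>+t. ?G (u, t) * indicator {- support_function K (- u) .. support_function K u} t \<partial>lborel) \<partial>\<phi>)
      \<le> (\<integral>\<^sup>+u. ennreal (width K u + 2 * r) \<partial>\<phi>)"
    proof (rule nn_integral_mono)
      fix u assume u: "u \<in> space \<phi>"
      let ?I = "{- support_function K (- u) .. support_function K u}"
      have "(\<integral>\<^sup>+t. ?G (u, t) * indicator ?I t \<partial>lborel) \<le> (\<integral>\<^sup>+t. indicator ?I t + indicator {u \<bullet> z - r .. u \<bullet> z + r} t \<partial>lborel)"
        using u by (intro nn_integral_mono) (auto simp: indicator_def space_\<phi>)
      also have "\<dots> = ennreal (width K u) + ennreal (2 * r)"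
        using width_nonneg[OF K K0, of u] assms(3)
        by (subst nn_integral_add) (auto simp: width_def emeasure_lborel_Icc_eq)
      also have "\<dots> = ennreal (width K u + 2 * r)"
        using width_nonneg[OF K K0, of u] assms(3) by simp
      finally show "(\<integral>\<^sup>+t. ?G (u, t) * indicator ?I t \<partial>lborel) \<le> ennreal (width K u + 2 * r)" .
    qed
    also have "\<dots> = ennreal (hitting_rate \<phi> K + 2 * r)"
      using integrable_width[OF K] width_nonneg[OF K K0] assms(3)
      by (subst nn_integral_eq_integral) (auto simp: hitting_rate_eq_integral_width prob_space)
    finally show "0 \<le> hitting_rate \<phi> K \<and> 0 \<le> hitting_rate \<phi> K + 2 * r \<and> K \<noteq> {} \<and>
       (\<integral>\<^sup>+u. (\<integral>\<^sup>+t. ?G (u, t) * indicator {- support_function K (- u) .. support_function K u} t \<partial>lborel) \<partial>\<phi>)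
        \<le> ennreal (hitting_rate \<phi> K + 2 * r)"
      using hitting_rate_nonneg[OF K K0] K0 assms(3) by simp
  qed (use assms in auto)
qed

text \<open>Shaped so that one interval of offsets, for every normal near \<open>b\<close>, cuts
  \<open>x\<close> off from the whole set.\<close>

definition far_cone :: "'a \<Rightarrow> 'a \<Rightarrow> real \<Rightarrow> real \<Rightarrow> 'a set" where
  "far_cone x b \<kappa> \<rho> = {y. \<rho> < norm (y - x) \<and> \<kappa> * norm (y - x) < b \<bullet> (y - x)}"

text \<open>Passing from \<open>b\<close> to a normal within \<kappa>/2 of it costs at most half of
  the cone inequality; the other half leaves a gap of width \<kappa> * \<rho> / 2 common to the
  whole cone.\<close>

lemma inner_cone:
  assumes "y \<in> far_cone x b \<kappa> \<rho>" "u \<in> ball b (\<kappa> / 2)" "0 < \<kappa>"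
  shows "u \<bullet> x + \<kappa> * \<rho> / 2 < u \<bullet> y"
proof -
  have "(b - u) \<bullet> (y - x) \<le> norm (b - u) * norm (y - x)" by (rule norm_cauchy_schwarz)
  also have "\<dots> \<le> \<kappa> / 2 * norm (y - x)" using assms(2) by (intro mult_right_mono) (auto simp: dist_norm)
  finally have "b \<bullet> (y - x) - \<kappa> / 2 * norm (y - x) \<le> u \<bullet> (y - x)" by (simp add: inner_diff_left)
  moreover have "\<kappa> * \<rho> \<le> \<kappa> * norm (y - x)" using assms(1,3) by (auto simp: far_cone_def)
  ultimately show ?thesis using assms(1) by (simp add: far_cone_def inner_diff_right)
qed

text \<open>An alive child must contain \<open>x\<close>, so apart from hyperplanes through
  \<open>x\<close>, collected in \<open>E\<close>, there is at most one. Hyperplanes in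
  \<open>S\<close> separate \<open>x\<close> from the cone and leave none. For each normal near
  \<open>b\<close> their offsets form an interval of length \<kappa> * \<rho> / 2, all of which hits
  an alive \<open>K\<close>; weighted by the mass of such normals, this is the amount by which the
  offspring integral falls short of the rate.\<close>

lemma leafcount_cone_le:
  assumes "compact K" "0 \<le> l" "0 < \<kappa>" "0 < \<rho>"
  shows "(\<integral>\<^sup>+t. leafcount (\<lambda>K. x \<in> K \<and> K \<inter> far_cone x b \<kappa> \<rho> \<noteq> {}) t K \<partial>partition_law \<phi> K l)
    \<le> ennreal (exp (- l * (measure \<phi> (ball b (\<kappa> / 2) \<inter> sphere 0 1) * \<kappa> * \<rho> / 2)))"
proof -
  let ?C = "far_cone x b \<kappa> \<rho>" and ?B = "ball b (\<kappa> / 2)"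
  let ?s = "measure \<phi> (?B \<inter> sphere 0 1) * \<kappa> * \<rho> / 2"
  define S where "S = {p :: 'a \<times> real. fst p \<in> ?B \<and> fst p \<bullet> x < snd p \<and> snd p < fst p \<bullet> x + \<kappa> * \<rho> / 2}"
  define E where "E = {p :: 'a \<times> real. snd p = fst p \<bullet> x}"
  let ?G = "\<lambda>p. indicator E p + indicator (- S) p :: ennreal"
  have "(\<integral>\<^sup>+t. leafcount (\<lambda>K. x \<in> K \<and> K \<inter> ?C \<noteq> {}) t K \<partial>partition_law \<phi> K l)
    \<le> ennreal (exp (l * (- ?s)))"
  proof (rule leafcount_partition_law_le[where G="?G"])
    have "S = {p. dist b (fst p) < \<kappa> / 2} \<inter> {p. fst p \<bullet> x < snd p} \<inter> {p. snd p < fst p \<bullet> x + \<kappa> * \<rho> / 2}"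
      by (auto simp: S_def)
    also have "open \<dots>"
      by (intro open_Int open_Collect_less continuous_intros)
    finally have "open S" .
    moreover have "closed E" unfolding E_def
      by (intro closed_Collect_eq continuous_intros)
    ultimately show "?G \<in> borel_measurable borel"
      by (intro borel_measurable_add borel_measurable_indicator borel_closed) auto
    fix K :: "'a set" and u :: 'a and t :: real
    assume K: "compact K"
    show "of_bool (x \<in> lower_part K (u, t) \<and> lower_part K (u, t) \<inter> ?C \<noteq> {}) +
        of_bool (x \<in> upper_part K (u, t) \<and> upper_part K (u, t) \<inter> ?C \<noteq> {}) \<le> ?G (u, t)"
    proof (cases "t = u \<bullet> x")
      case True
      then have "(u, t) \<in> E" "(u, t) \<notin> S" by (auto simp: E_def S_def)
      then show ?thesis by (auto simp: of_bool_def)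
    next
      case False
      have "\<not> (x \<in> upper_part K (u, t) \<and> upper_part K (u, t) \<inter> ?C \<noteq> {})
          \<and> \<not> (x \<in> lower_part K (u, t) \<and> lower_part K (u, t) \<inter> ?C \<noteq> {})" if "(u, t) \<in> S"
      proof -
        have u: "u \<in> ?B" "u \<bullet> x < t" "t < u \<bullet> x + \<kappa> * \<rho> / 2" using that by (auto simp: S_def)
        have "x \<notin> upper_part K (u, t)" using u(2) by (simp add: upper_part_def inner_commute)
        moreover have "y \<notin> lower_part K (u, t)" if "y \<in> ?C" for y
          using inner_cone[OF that u(1) assms(3)] u(3) by (simp add: lower_part_def inner_commute)
        ultimately show ?thesis by blast
      qed
      moreover have "\<not> (x \<in> upper_part K (u, t) \<and> x \<in> lower_part K (u, t))"
        using False by (auto simp: lower_part_def upper_part_def inner_commute)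
      ultimately show ?thesis
        by (intro of_bool_add_le) (blast, metis (no_types) ComplI add_increasing indicator_simps(1) order_refl zero_le)
    qed
    assume alive: "x \<in> K \<and> K \<inter> ?C \<noteq> {}"
    then obtain y where y: "y \<in> K" "y \<in> ?C" and K0: "K \<noteq> {}" by auto
    \<comment> \<open>The length of the offsets that hit \<open>K\<close> without separating. It is
      non-negative because \<open>K\<close> contains \<open>x\<close> and a cone point, so the
      separating interval lies inside the hitting interval.\<close>
    define J where "J u = width K u - indicator ?B u * (\<kappa> * \<rho> / 2)" for u
    have J: "(\<integral>\<^sup>+t. ?G (u, t) * indicator {- support_function K (- u) .. support_function K u} t \<partial>lborel) = ennreal (J u)"
        "0 \<le> J u" for u
    proof -
      let ?I = "{- support_function K (- u) .. support_function K u}"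
      let ?S = "{t. (u, t) \<in> S}"
      have S: "?S = (if u \<in> ?B then {u \<bullet> x <..< u \<bullet> x + \<kappa> * \<rho> / 2} else {})"
        by (auto simp: S_def)
      have w: "emeasure lborel ?I = ennreal (width K u)"
        using width_nonneg[OF K K0, of u] by (simp add: width_def emeasure_lborel_Icc_eq)
      have "- support_function K (- u) \<le> u \<bullet> x" "u \<in> ?B \<Longrightarrow> u \<bullet> x + \<kappa> * \<rho> / 2 \<le> support_function K u"
        using support_function_ge[OF K, of x "- u"] support_function_ge[OF K y(1), of u] alive
          inner_cone[OF y(2) _ assms(3), of u] by auto
      then have sub: "?S \<subseteq> ?I" and le: "u \<in> ?B \<Longrightarrow> \<kappa> * \<rho> / 2 \<le> width K u" unfolding S by (auto simp: width_def)
      then show "0 \<le> J u" using width_nonneg[OF K K0, of u] by (cases "u \<in> ?B") (auto simp: J_def)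
      have "AE t in lborel. t \<noteq> u \<bullet> x" by (rule AE_lborel_singleton)
      then have "(\<integral>\<^sup>+t. ?G (u, t) * indicator ?I t \<partial>lborel) = (\<integral>\<^sup>+t. indicator (?I - ?S) t \<partial>lborel)"
        by (intro nn_integral_cong_AE) (auto simp: indicator_def E_def elim!: eventually_mono)
      also have "\<dots> = emeasure lborel (?I - ?S)"
        unfolding S by (intro nn_integral_indicator) auto
      also have "\<dots> = emeasure lborel ?I - emeasure lborel ?S"
        using sub assms(3,4) unfolding S by (intro emeasure_Diff) (auto split: if_splits)
      also have "\<dots> = ennreal (J u)"
        unfolding w S using assms(3,4) le by (cases "u \<in> ?B") (auto simp: J_def ennreal_minus)
      finally show "(\<integral>\<^sup>+t. ?G (u, t) * indicator ?I t \<partial>lborel) = ennreal (J u)" .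
    qed
    have Bs: "?B \<inter> sphere 0 1 \<in> sets \<phi>"
      by (auto simp: sets_\<phi> sets_restrict_space)
    have J_eq: "J u = width K u - indicator (?B \<inter> sphere 0 1) u * (\<kappa> * \<rho> / 2)" if "u \<in> space \<phi>" for u
      using that by (auto simp: J_def space_\<phi> indicator_def)
    have "emeasure \<phi> (?B \<inter> sphere 0 1) < \<infinity>"
      unfolding infinity_ennreal_def less_top[symmetric] by (rule emeasure_finite)
    then have ind: "integrable \<phi> (\<lambda>u. indicator (?B \<inter> sphere 0 1) u * (\<kappa> * \<rho> / 2))"
      by (intro integrable_mult_left integrable_real_indicator Bs)
    have "integrable \<phi> (\<lambda>u. width K u - indicator (?B \<inter> sphere 0 1) u * (\<kappa> * \<rho> / 2))"
      by (intro Bochner_Integration.integrable_diff ind integrable_width K)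
    then have int1: "integrable \<phi> J" using J_eq by (simp cong: Bochner_Integration.integrable_cong)
    have "(\<integral>u. J u \<partial>\<phi>) = (\<integral>u. width K u - indicator (?B \<inter> sphere 0 1) u * (\<kappa> * \<rho> / 2) \<partial>\<phi>)"
      using J_eq by (intro Bochner_Integration.integral_cong) auto
    also have "\<dots> = hitting_rate \<phi> K - ?s"
      using Bs unfolding Bochner_Integration.integral_diff[OF integrable_width[OF K] ind]
      by (simp add: hitting_rate_eq_integral_width sets.Int_space_eq2)
    finally have int2: "(\<integral>u. J u \<partial>\<phi>) = hitting_rate \<phi> K - ?s" .
    note int = int1 int2
    have "(\<integral>\<^sup>+u. (\<integral>\<^sup>+t. ?G (u, t) * indicator {- support_function K (- u) .. support_function K u} t \<partial>lborel) \<partial>\<phi>) = ennreal (hitting_rate \<phi> K - ?s)"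
      unfolding J(1) using int J(2) by (subst nn_integral_eq_integral) auto
    \<comment> \<open>This is the side condition \<open>0 \<le> hitting_rate \<phi> K + c\<close> of
      the branching bound, automatic because an alive cell is wide enough in the directions near
      \<open>b\<close>.\<close>
    moreover have "0 \<le> hitting_rate \<phi> K - ?s"
      unfolding int(2)[symmetric] using J(2) by simp
    ultimately show "0 \<le> hitting_rate \<phi> K \<and> 0 \<le> hitting_rate \<phi> K + - ?s \<and> K \<noteq> {} \<and>
       (\<integral>\<^sup>+u. (\<integral>\<^sup>+t. ?G (u, t) * indicator {- support_function K (- u) .. support_function K u} t \<partial>lborel) \<partial>\<phi>)
        \<le> ennreal (hitting_rate \<phi> K + - ?s)"
      using hitting_rate_nonneg[OF K K0] K0 by simp
  qed (use assms in auto)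
  then show ?thesis by simp
qed

end

section \<open>From the window partition to the stationary tessellation\<close>

lemma measurable_boundary_union [measurable]: "boundary_union \<in> measurable tessellation_space hitting_space"
  unfolding tessellation_space_def by (rule measurable_vimage_algebra1) simp

lemma space_tessellation_space: "space tessellation_space = {T. tessellation T}"
  by (simp add: tessellation_space_def)

text \<open>The open ball is a countable union of closed balls, some of them possibly empty, and
  these turn hits of the truncated set into hits with compact sets.\<close>

lemma measurable_Int_ball: "(\<lambda>F. F \<inter> ball 0 R) \<in> measurable hitting_space hitting_space"
proof (rule measurable_hitting_spaceI)
  fix C :: "'a set" assume C: "compact C"
  have *: "x \<in> ball 0 R \<longleftrightarrow> (\<exists>k::nat. x \<in> cball 0 (R - 1 / Suc k))" for x :: 'a
  proof
    assume "x \<in> ball 0 R"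
    then obtain k where "1 / Suc k < R - norm x" using nat_approx_posE[of "R - norm x"] by (auto simp: dist_norm)
    then show "\<exists>k::nat. x \<in> cball 0 (R - 1 / Suc k)" by (intro exI[of _ k]) (simp add: dist_norm)
  next
    assume "\<exists>k::nat. x \<in> cball 0 (R - 1 / Suc k)"
    then obtain k :: nat where "norm x \<le> R - 1 / Suc k" by auto
    moreover have "0 < 1 / real (Suc k)" by simp
    ultimately have "norm x < R" by linarith
    then show "x \<in> ball 0 R" by simp
  qed
  have "{F \<in> space hitting_space. (F \<inter> ball 0 R) \<inter> C \<noteq> {}} = (\<Union>k::nat. {F. F \<inter> (cball 0 (R - 1 / Suc k) \<inter> C) \<noteq> {}})"
  proof -
    have "ball 0 R = (\<Union>k::nat. cball (0::'a) (R - 1 / Suc k))" using * by blast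
    then show ?thesis by auto
  qed
  also have "\<dots> \<in> sets hitting_space"
    using C by (intro sets.countable_UN) (auto intro!: hitting_sets compact_Int)
  finally show "{F \<in> space hitting_space. (F \<inter> ball 0 R) \<inter> C \<noteq> {}} \<in> sets hitting_space" .
qed

lemma stit_tessellation_measurable:
  "stit_tessellation \<phi> l Pr T \<Longrightarrow> T \<in> measurable Pr tessellation_space"
  by (simp add: stit_tessellation_def stationary_tessellation_def)

text \<open>The window is a closed ball, whose interior is the open one. On the tessellation side
  the change of variables is an equality by measurability; on the tree side
  \<open>nn_integral_distr_le\<close> gives the one inequality that upper bounds need.\<close>

lemma stit_tessellation_transfer:
  fixes T :: "'w \<Rightarrow> 'a::euclidean_space set set"
  assumes stit: "stit_tessellation \<phi> l Pr T" and R: "0 < R" and H: "H \<in> borel_measurable hitting_space"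
  shows "(\<integral>\<^sup>+\<omega>. H (boundary_union (T \<omega>) \<inter> ball 0 R) \<partial>Pr) \<le>
     (\<integral>\<^sup>+t. H (boundary_union (tree_cells t (cball 0 R)) \<inter> ball 0 R) \<partial>partition_law \<phi> (cball 0 R) l)"
proof -
  have m: "(\<lambda>\<omega>. boundary_union (T \<omega>) \<inter> ball 0 R) \<in> measurable Pr hitting_space"
    by (intro measurable_compose[OF _ measurable_Int_ball] measurable_compose[OF _ measurable_boundary_union]
        stit_tessellation_measurable[OF stit])
  have int: "interior (cball 0 R) = ball (0::'a) R" by simp
  have "distr Pr hitting_space (\<lambda>\<omega>. boundary_union (T \<omega>) \<inter> ball 0 R) =
    distr (partition_law \<phi> (cball 0 R) l) hitting_space (\<lambda>t. boundary_union (tree_cells t (cball 0 R)) \<inter> ball 0 R)"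
    using stit R unfolding stit_tessellation_def by (elim conjE allE[of _ "cball 0 R"]) simp
  moreover have "(\<integral>\<^sup>+\<omega>. H (boundary_union (T \<omega>) \<inter> ball 0 R) \<partial>Pr) =
      (\<integral>\<^sup>+F. H F \<partial>distr Pr hitting_space (\<lambda>\<omega>. boundary_union (T \<omega>) \<inter> ball 0 R))"
    using m H by (simp add: nn_integral_distr)
  ultimately show ?thesis using nn_integral_distr_le by metis
qed

text \<open>Segments between points of a convex window stay inside it, so truncating the boundary to
  the window changes nothing.\<close>

lemma separated_Int_convex:
  assumes "convex U" "J \<subseteq> U"
  shows "separated J (F \<inter> U) \<longleftrightarrow> separated J F"
proof -
  have "closed_segment q q' \<inter> (F \<inter> U) = closed_segment q q' \<inter> F" if "q \<in> J" "q' \<in> J" for q q'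
    using that assms closed_segment_subset[of q U q'] by blast
  moreover have "q \<in> F \<inter> U \<longleftrightarrow> q \<in> F" if "q \<in> J" for q using that assms by auto
  ultimately show ?thesis by (simp add: separated_def cong: ball_cong)
qed

context direction_law
begin

text \<open>The bound does not involve \<open>R\<close>: the window only has to contain
  \<open>A\<close>.\<close>

lemma stit_sep_count_le:
  assumes stit: "stit_tessellation \<phi> l Pr T" and l: "0 \<le> l" and r: "0 \<le> r" and R: "0 < R"
    and A: "countable A" "A \<subseteq> ball z r \<inter> ball 0 R"
  shows "(\<integral>\<^sup>+\<omega>. sep_count A (boundary_union (T \<omega>)) \<partial>Pr) \<le> ennreal (exp (2 * r * l))"
proof -
  have "(\<integral>\<^sup>+\<omega>. sep_count A (boundary_union (T \<omega>)) \<partial>Pr) = (\<integral>\<^sup>+\<omega>. sep_count A (boundary_union (T \<omega>) \<inter> ball 0 R) \<partial>Pr)"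
  proof (rule nn_integral_cong)
    fix \<omega>
    have "{J. finite J \<and> J \<subseteq> A \<and> separated J (boundary_union (T \<omega>))} =
        {J. finite J \<and> J \<subseteq> A \<and> separated J (boundary_union (T \<omega>) \<inter> ball 0 R)}"
      using A(2) separated_Int_convex[of "ball 0 R"] by blast
    then show "sep_count A (boundary_union (T \<omega>)) = sep_count A (boundary_union (T \<omega>) \<inter> ball 0 R)"
      by (simp only: sep_count_def)
  qed
  also have "\<dots> \<le> (\<integral>\<^sup>+t. sep_count A (boundary_union (tree_cells t (cball 0 R)) \<inter> ball 0 R) \<partial>partition_law \<phi> (cball 0 R) l)"
    by (rule stit_tessellation_transfer[OF stit R measurable_sep_count[OF A(1)]])
  also have "\<dots> \<le> (\<integral>\<^sup>+t. leafcount (\<lambda>K. K \<inter> ball z r \<noteq> {}) t (cball 0 R) \<partial>partition_law \<phi> (cball 0 R) l)"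
  proof (rule nn_integral_mono)
    fix t
    show "sep_count A (boundary_union (tree_cells t (cball 0 R)) \<inter> ball 0 R) \<le> leafcount (\<lambda>K. K \<inter> ball z r \<noteq> {}) t (cball 0 R)"
      unfolding sep_count_def
    proof (rule SUP_least, clarify)
      fix J assume J: "finite J" "J \<subseteq> A" "separated J (boundary_union (tree_cells t (cball 0 R)) \<inter> ball 0 R)"
      show "of_nat (card J) \<le> leafcount (\<lambda>K. K \<inter> ball z r \<noteq> {}) t (cball 0 R)"
        by (rule card_separated_le_leafcount[OF _ _ J(1) _ J(3)]) (use J(2) A(2) ball_subset_cball in auto)
    qed
  qed
  also have "\<dots> \<le> ennreal (exp (l * (2 * r)))"
    by (rule leafcount_ball_le) (use l r in auto)
  finally show ?thesis by (simp add: mult_ac)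
qed

text \<open>The countable set \<open>Q\<close> stands in for the cone so that the event is
  measurable in the boundary; a point of \<open>Q\<close> joined to \<open>x\<close> off the
  boundary forces a leaf that contains \<open>x\<close> and meets the cone.\<close>

lemma stit_cone_le:
  assumes stit: "stit_tessellation \<phi> l Pr T" and l: "0 \<le> l" and pos: "0 < R" "0 < \<kappa>" "0 < \<rho>"
    and x: "x \<in> ball 0 R" and Q: "countable Q" "Q \<subseteq> far_cone x b \<kappa> \<rho> \<inter> ball 0 R"
  shows "(\<integral>\<^sup>+\<omega>. of_bool (\<exists>q\<in>Q. closed_segment x q \<inter> boundary_union (T \<omega>) = {}) \<partial>Pr) \<le>
     ennreal (exp (- l * (measure \<phi> (ball b (\<kappa> / 2) \<inter> sphere 0 1) * \<kappa> * \<rho> / 2)))"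
proof -
  let ?H = "\<lambda>F. of_bool (\<exists>q\<in>Q. closed_segment x q \<inter> F = {}) :: ennreal"
  let ?E = "\<lambda>q. {F. F \<inter> closed_segment x q \<noteq> {}}"
  have "(\<Union>q\<in>Q. space hitting_space - ?E q) \<in> sets hitting_space"
  proof (rule sets.countable_UN'[OF Q(1)])
    show "(\<lambda>q. space hitting_space - ?E q) ` Q \<subseteq> sets hitting_space"
      by (rule image_subsetI, rule sets.compl_sets, rule hitting_sets, rule compact_segment)
  qed
  moreover have "?H = indicator (\<Union>q\<in>Q. space hitting_space - ?E q)"
  proof
    fix F
    have "(\<exists>q\<in>Q. closed_segment x q \<inter> F = {}) \<longleftrightarrow> F \<in> (\<Union>q\<in>Q. space hitting_space - ?E q)"
      by (simp add: Int_commute)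
    then show "?H F = indicator (\<Union>q\<in>Q. space hitting_space - ?E q) F"
      by (simp only: indicator_def of_bool_def)
  qed
  ultimately have H: "?H \<in> borel_measurable hitting_space" by (simp only: borel_measurable_indicator)
  have seg: "closed_segment x q \<subseteq> ball 0 R" if "q \<in> Q" for q
    using that Q(2) x by (intro closed_segment_subset) auto
  have "(\<integral>\<^sup>+\<omega>. ?H (boundary_union (T \<omega>)) \<partial>Pr) = (\<integral>\<^sup>+\<omega>. ?H (boundary_union (T \<omega>) \<inter> ball 0 R) \<partial>Pr)"
  proof (rule nn_integral_cong)
    fix \<omega>
    have "closed_segment x q \<inter> boundary_union (T \<omega>) = closed_segment x q \<inter> (boundary_union (T \<omega>) \<inter> ball 0 R)" if "q \<in> Q" for q
      using seg[OF that] by blast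
    then show "?H (boundary_union (T \<omega>)) = ?H (boundary_union (T \<omega>) \<inter> ball 0 R)" by (simp cong: bex_cong)
  qed
  also have "\<dots> \<le> (\<integral>\<^sup>+t. ?H (boundary_union (tree_cells t (cball 0 R)) \<inter> ball 0 R) \<partial>partition_law \<phi> (cball 0 R) l)"
    by (rule stit_tessellation_transfer[OF stit pos(1) H])
  also have "\<dots> \<le> (\<integral>\<^sup>+t. leafcount (\<lambda>K. x \<in> K \<and> K \<inter> far_cone x b \<kappa> \<rho> \<noteq> {}) t (cball 0 R) \<partial>partition_law \<phi> (cball 0 R) l)"
  proof (rule nn_integral_mono)
    fix t
    show "?H (boundary_union (tree_cells t (cball 0 R)) \<inter> ball 0 R) \<le> leafcount (\<lambda>K. x \<in> K \<and> K \<inter> far_cone x b \<kappa> \<rho> \<noteq> {}) t (cball 0 R)"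
    proof (cases "\<exists>q\<in>Q. closed_segment x q \<inter> (boundary_union (tree_cells t (cball 0 R)) \<inter> ball 0 R) = {}")
      case True
      then obtain q where q: "q \<in> Q" "closed_segment x q \<inter> (boundary_union (tree_cells t (cball 0 R)) \<inter> ball 0 R) = {}" by blast
      have "q \<in> far_cone x b \<kappa> \<rho>" "x \<in> cball 0 R" "closed (cball (0::'a) R)" using x q(1) Q(2) by auto
      then have "1 \<le> leafcount (\<lambda>K. x \<in> K \<and> K \<inter> far_cone x b \<kappa> \<rho> \<noteq> {}) t (cball 0 R)"
        using leafcount_cone_ge_1[OF _ _ _ seg[OF q(1)] q(2)] by blast
      then show ?thesis using True by simp
    qed simp
  qed
  also have "\<dots> \<le> ennreal (exp (- l * (measure \<phi> (ball b (\<kappa> / 2) \<inter> sphere 0 1) * \<kappa> * \<rho> / 2)))"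
    by (rule leafcount_cone_le) (use l pos in auto)
  finally show ?thesis .
qed

end

section \<open>Cells of a tessellation\<close>

text \<open>Encodes lying in the interior of a common cell (\<open>linked_iff_interior\<close>) in a
  form that depends on the tessellation only through its boundary.\<close>

definition linked :: "'a::euclidean_space set set \<Rightarrow> 'a \<Rightarrow> 'a \<Rightarrow> bool" where
  "linked T x y \<longleftrightarrow> closed_segment x y \<inter> boundary_union T = {}"

lemma linked_refl_iff: "linked T x x \<longleftrightarrow> x \<notin> boundary_union T"
  by (simp add: linked_def)

lemma linked_sym: "linked T x y \<Longrightarrow> linked T y x"
  by (simp add: linked_def closed_segment_commute)

lemma linked_notin_boundary: "linked T x y \<Longrightarrow> x \<notin> boundary_union T" "linked T x y \<Longrightarrow> y \<notin> boundary_union T"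
  using ends_in_segment[of x y] by (auto simp: linked_def)

lemma tessellation_cellD:
  assumes "tessellation T" "c \<in> T"
  shows "convex c" "closed c" "interior c \<noteq> {}" "closure (interior c) = c"
proof -
  have c: "polytope c" "interior c \<noteq> {}" using assms by (auto simp: tessellation_def)
  then show "convex c" "closed c" "interior c \<noteq> {}" 
    by (auto intro: polytope_imp_convex polytope_imp_closed)
  then show "closure (interior c) = c" using convex_closure_interior[of c] by simp
qed

text \<open>A cell is the closure of its interior, so the open set \<open>interior c\<close>, being
  disjoint from \<open>interior c'\<close>, is disjoint from \<open>c'\<close>.\<close>

lemma tessellation_cell_unique:
  assumes "tessellation T" "c \<in> T" "x \<in> interior c" "c' \<in> T" "x \<in> c'"
  shows "c' = c"
proof (rule ccontr)
  assume "c' \<noteq> c"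
  then have "interior c \<inter> interior c' = {}" using assms unfolding tessellation_def by blast
  then have "interior c \<inter> closure (interior c') = {}"
    using open_Int_closure_eq_empty[OF open_interior] by blast
  then show False using assms(3,5) unfolding tessellation_cellD(4)[OF assms(1,4)] by blast
qed

lemma tessellation_cover:
  assumes "tessellation T"
  shows "\<exists>c\<in>T. x \<in> c"
proof -
  have "x \<in> \<Union>T" using assms by (simp add: tessellation_def)
  then show ?thesis by blast
qed

lemma interior_notin_boundary:
  assumes "tessellation T" "c \<in> T" "x \<in> interior c"
  shows "x \<notin> boundary_union T"
proof
  assume "x \<in> boundary_union T"
  then obtain c' where c': "c' \<in> T" "x \<in> frontier c'" by (auto simp: boundary_union_def)
  then have "x \<in> c'" using tessellation_cellD(2)[OF assms(1) c'(1)] frontier_subset_closed by blast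
  then have "c' = c" using tessellation_cell_unique assms c' by blast
  then show False using c' assms by (simp add: frontier_def)
qed

lemma notin_boundary_interior:
  assumes "tessellation T" "x \<notin> boundary_union T" "c \<in> T" "x \<in> c"
  shows "x \<in> interior c"
proof (rule ccontr)
  assume "x \<notin> interior c"
  then have "x \<in> frontier c" using assms(4) closure_subset by (auto simp: frontier_def)
  then show False using assms by (auto simp: boundary_union_def)
qed

text \<open>A segment that leaves \<open>c\<close> crosses its frontier; conversely the interior of
  the convex cell contains the segment and carries no boundary.\<close>

lemma linked_iff_interior:
  assumes T: "tessellation T" and c: "c \<in> T" "x \<in> interior c"
  shows "linked T x y \<longleftrightarrow> y \<in> interior c"
proof
  assume l: "linked T x y"
  have "y \<in> c"
  proof (rule ccontr)
    assume "y \<notin> c"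
    then have "closed_segment x y - c \<noteq> {}" "closed_segment x y \<inter> c \<noteq> {}"
      using c(2) interior_subset ends_in_segment[of x y] by blast+
    then have "closed_segment x y \<inter> frontier c \<noteq> {}" using connected_Int_frontier[OF connected_segment(1)] by blast
    then show False using l c(1) by (auto simp: linked_def boundary_union_def)
  qed
  then show "y \<in> interior c"
    using notin_boundary_interior[OF T linked_notin_boundary(2)[OF l] c(1)] by blast
next
  assume "y \<in> interior c"
  then have "closed_segment x y \<subseteq> interior c"
    using c(2) convex_interior[OF tessellation_cellD(1)[OF T c(1)]] by (simp add: closed_segment_subset)
  then show "linked T x y" using interior_notin_boundary[OF T c(1)] unfolding linked_def by blast
qed

lemma notin_boundary_obtain:
  assumes "tessellation T" "x \<notin> boundary_union T"
  obtains c where "c \<in> T" "x \<in> interior c"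
  using tessellation_cover[OF assms(1), of x] notin_boundary_interior[OF assms] by blast

text \<open>Missing a closed set along segments is not transitive in general; here both segments
  stay inside one convex cell.\<close>

lemma linked_trans:
  assumes "tessellation T" "linked T x y" "linked T y z"
  shows "linked T x z"
proof -
  obtain c where "c \<in> T" "x \<in> interior c"
    using notin_boundary_obtain[OF assms(1) linked_notin_boundary(1)[OF assms(2)]] .
  then show ?thesis using assms linked_iff_interior by metis
qed

text \<open>By local finiteness only finitely many cells come within distance 1 of a given
  point.\<close>

lemma closed_boundary_union:
  assumes T: "tessellation T"
  shows "closed (boundary_union T)"
  unfolding closed_def
proof (rule open_subopen[THEN iffD2, rule_format])
  fix x assume x: "x \<in> - boundary_union T"
  let ?C = "{c \<in> T. c \<inter> cball x 1 \<noteq> {}}"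
  let ?U = "ball x 1 - \<Union>(frontier ` ?C)"
  have "finite ?C" using T by (auto simp: tessellation_def)
  then have "open ?U" by (intro open_Diff closed_Union) auto
  moreover have "x \<in> ?U" using x by (auto simp: boundary_union_def)
  moreover have "z \<notin> boundary_union T" if z: "z \<in> ?U" for z
  proof
    assume "z \<in> boundary_union T"
    then obtain c where c: "c \<in> T" "z \<in> frontier c" by (auto simp: boundary_union_def)
    then have "z \<in> c" using tessellation_cellD(2)[OF T c(1)] frontier_subset_closed by blast
    then have "c \<in> ?C" using c z ball_subset_cball by blast
    then show False using z c(2) by blast
  qed
  ultimately show "\<exists>U. open U \<and> x \<in> U \<and> U \<subseteq> - boundary_union T" by blast
qed

text \<open>Off the boundary \<open>cell_of\<close> collapses to a single cell, and cutting it with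
  \<open>W\<close> is invisible to points of \<open>W\<close>.\<close>

lemma cell_of_restrict_tessellation:
  assumes T: "tessellation T" and x: "x \<in> W" "x \<notin> boundary_union T" and y: "y \<in> W" "y \<notin> boundary_union T"
  shows "y \<in> cell_of (restrict_tessellation T W) x \<longleftrightarrow> linked T x y"
proof -
  obtain c where c: "c \<in> T" "x \<in> interior c" using notin_boundary_obtain[OF T x(2)] .
  have "x \<in> c" using c interior_subset by blast
  have "{k \<in> restrict_tessellation T W. x \<in> k} = {c \<inter> W}"
    unfolding restrict_tessellation_def
    using c \<open>x \<in> c\<close> x(1) tessellation_cell_unique[OF T c] by blast
  then have "cell_of (restrict_tessellation T W) x = c \<inter> W" by (simp add: cell_of_def)
  then have "y \<in> cell_of (restrict_tessellation T W) x \<longleftrightarrow> y \<in> c" using y(1) by simp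
  also have "\<dots> \<longleftrightarrow> y \<in> interior c"
    using notin_boundary_interior[OF T y(2) c(1)] interior_subset by blast
  also have "\<dots> \<longleftrightarrow> linked T x y" using linked_iff_interior[OF T c] by simp
  finally show ?thesis .
qed

text \<open>The compact segment has positive distance \<open>d\<close> from the closed boundary.
  Moving the endpoints by less than d/3 moves each point of the segment by at most d/3, which leaves
  room for a further neighbourhood of radius d/3.\<close>

lemma linked_nearby:
  assumes T: "tessellation T" and l: "linked T x y"
  shows "\<exists>e>0. \<forall>x' y'. dist x x' < e \<longrightarrow> dist y y' < e \<longrightarrow> 
     (\<forall>z. (\<exists>s\<in>closed_segment x' y'. dist s z \<le> e) \<longrightarrow> z \<notin> boundary_union T)"
proof -
  obtain d where d: "d > 0" "\<And>s z. s \<in> closed_segment x y \<Longrightarrow> z \<in> boundary_union T \<Longrightarrow> d \<le> dist s z"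
    using separate_compact_closed[OF compact_segment closed_boundary_union[OF T], of x y] l
    unfolding linked_def by blast
  show ?thesis
  proof (intro exI[of _ "d / 3"] conjI allI impI)
    fix x' y' z
    assume x': "dist x x' < d / 3" "dist y y' < d / 3" and "\<exists>s\<in>closed_segment x' y'. dist s z \<le> d / 3"
    then obtain u where u: "0 \<le> u" "u \<le> 1" "dist ((1 - u) *\<^sub>R x' + u *\<^sub>R y') z \<le> d / 3"
      by (auto simp: closed_segment_def)
    have "(1 - u) *\<^sub>R x + u *\<^sub>R y - ((1 - u) *\<^sub>R x' + u *\<^sub>R y') = (1 - u) *\<^sub>R (x - x') + u *\<^sub>R (y - y')"
      by (simp add: algebra_simps)
    also have "norm \<dots> \<le> (1 - u) * norm (x - x') + u * norm (y - y')"
      using u by (intro norm_triangle_le) simp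
    also have "\<dots> \<le> (1 - u) * (d / 3) + u * (d / 3)"
      using u x' by (intro add_mono mult_left_mono) (auto simp: dist_norm)
    also have "\<dots> = d / 3" by (simp only: distrib_right[symmetric]) simp
    finally have "dist ((1 - u) *\<^sub>R x + u *\<^sub>R y) z < d"
      using u(3) d(1) dist_triangle[of "(1 - u) *\<^sub>R x + u *\<^sub>R y" z "(1 - u) *\<^sub>R x' + u *\<^sub>R y'"]
      by (simp add: dist_norm)
    moreover have "(1 - u) *\<^sub>R x + u *\<^sub>R y \<in> closed_segment x y" using u by (auto simp: closed_segment_def)
    ultimately show "z \<notin> boundary_union T" using d(2) by force
  qed (use d in simp)
qed

lemma linked_openD:
  assumes T: "tessellation T" and l: "linked T x y"
  shows "\<exists>e>0. \<forall>y'. dist y y' < e \<longrightarrow> linked T x y'"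
proof -
  obtain e where e: "e > 0" "\<And>x' y' z. dist x x' < e \<Longrightarrow> dist y y' < e \<Longrightarrow> 
     (\<exists>s\<in>closed_segment x' y'. dist s z \<le> e) \<Longrightarrow> z \<notin> boundary_union T"
    using linked_nearby[OF T l] by blast
  have "linked T x y'" if "dist y y' < e" for y'
  proof -
    have "z \<notin> boundary_union T" if "z \<in> closed_segment x y'" for z
      using e(1) e(2)[of x y' z] \<open>dist y y' < e\<close> that by (metis dist_self less_imp_le)
    then show ?thesis by (auto simp: linked_def)
  qed
  then show ?thesis using e(1) by blast
qed

text \<open>The relation holds iff, for some \<open>p\<close> and \<open>q\<close> of a countable
  dense set near the endpoints, a closed neighbourhood of the segment from \<open>p\<close> to
  \<open>q\<close> misses the boundary. These neighbourhoods are fixed compact sets, so joint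
  measurability in points and tessellation follows by countable unions.\<close>

lemma measurable_linked [measurable (raw)]:
  fixes f g :: "'b \<Rightarrow> 'a::euclidean_space"
  assumes f [measurable]: "f \<in> borel_measurable M" and g [measurable]: "g \<in> borel_measurable M"
    and h [measurable]: "h \<in> measurable M tessellation_space"
  shows "Measurable.pred M (\<lambda>\<omega>. linked (h \<omega>) (f \<omega>) (g \<omega>))"
proof -
  obtain D :: "'a set" where D: "countable D" "\<And>X. open X \<Longrightarrow> X \<noteq> {} \<Longrightarrow> \<exists>d\<in>D. d \<in> X"
    using countable_dense_setE by blast
  let ?N = "\<lambda>p q (k::nat). (\<Union>s\<in>closed_segment p q. cball s (1 / Suc k)) :: 'a set"
  have N: "compact (?N p q k)" for p q k
  proof -
    have "?N p q k = (\<Union>s\<in>closed_segment p q. \<Union>z\<in>cball 0 (1 / Suc k). {s + z})"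
    proof (intro SUP_cong refl)
      fix s :: 'a
      show "cball s (1 / Suc k) = (\<Union>z\<in>cball 0 (1 / Suc k). {s + z})"
        by (auto simp: dist_norm norm_minus_commute intro!: bexI[of _ "_ - s"])
    qed
    then show ?thesis using compact_sums'[of "closed_segment p q" "cball 0 (1 / Suc k)"] by auto
  qed
  have eq: "linked (h \<omega>) (f \<omega>) (g \<omega>) \<longleftrightarrow> (\<exists>p\<in>D. \<exists>q\<in>D. \<exists>k::nat. dist (f \<omega>) p < 1 / Suc k \<and> dist (g \<omega>) q < 1 / Suc k \<and>
      \<not> boundary_union (h \<omega>) \<in> {F. F \<inter> ?N p q k \<noteq> {}})" (is "_ \<longleftrightarrow> ?r") if "\<omega> \<in> space M" for \<omega>
  proof
    have T: "tessellation (h \<omega>)" using measurable_space[OF h that] by (simp add: space_tessellation_space)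
    let ?x = "f \<omega>" and ?y = "g \<omega>"
    assume "linked (h \<omega>) ?x ?y"
    then obtain e where e: "e > 0" "\<And>x' y' z. dist ?x x' < e \<Longrightarrow> dist ?y y' < e \<Longrightarrow> 
       (\<exists>s\<in>closed_segment x' y'. dist s z \<le> e) \<Longrightarrow> z \<notin> boundary_union (h \<omega>)"
      using linked_nearby[OF T] by blast
    obtain k where k: "1 / Suc k < e" using nat_approx_posE[OF e(1)] by auto
    obtain p where p: "p \<in> D" "dist ?x p < 1 / Suc k" using D(2)[of "ball ?x (1 / Suc k)"] by (auto simp del: of_nat_Suc)
    obtain q where q: "q \<in> D" "dist ?y q < 1 / Suc k" using D(2)[of "ball ?y (1 / Suc k)"] by (auto simp del: of_nat_Suc)
    have "z \<notin> boundary_union (h \<omega>)" if z: "z \<in> ?N p q k" for z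
    proof (rule e(2)[of p q])
      show "dist ?x p < e" "dist ?y q < e" using p q k by linarith+
      obtain s where s: "s \<in> closed_segment p q" "dist s z \<le> 1 / Suc k" using z unfolding UN_iff mem_cball by blast
      have "dist s z \<le> e" using s(2) k by linarith
      then show "\<exists>s\<in>closed_segment p q. dist s z \<le> e" using s(1) by blast
    qed
    then have "\<not> boundary_union (h \<omega>) \<in> {F. F \<inter> ?N p q k \<noteq> {}}" by blast
    then show ?r using p q by blast
  next
    assume ?r
    then obtain p q and k :: nat where pq: "dist (f \<omega>) p < 1 / Suc k" "dist (g \<omega>) q < 1 / Suc k" "boundary_union (h \<omega>) \<inter> ?N p q k = {}"
      by blast
    have "s \<in> ?N p q k" if s: "s \<in> closed_segment (f \<omega>) (g \<omega>)" for s
    proof -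
      obtain u where u: "0 \<le> u" "u \<le> 1" "s = (1 - u) *\<^sub>R f \<omega> + u *\<^sub>R g \<omega>" using s by (auto simp: closed_segment_def)
      let ?s = "(1 - u) *\<^sub>R p + u *\<^sub>R q"
      have "?s - s = (1 - u) *\<^sub>R (p - f \<omega>) + u *\<^sub>R (q - g \<omega>)"
        by (simp add: u(3) algebra_simps)
      also have "norm \<dots> \<le> (1 - u) * norm (p - f \<omega>) + u * norm (q - g \<omega>)"
        using u by (intro norm_triangle_le) simp
      also have "\<dots> \<le> (1 - u) * (1 / Suc k) + u * (1 / Suc k)"
        using u pq by (intro add_mono mult_left_mono) (auto simp: dist_norm norm_minus_commute simp del: of_nat_Suc)
      also have "\<dots> = 1 / Suc k" by (simp only: distrib_right[symmetric]) simp
      finally have "dist ?s s \<le> 1 / Suc k" by (simp add: dist_norm)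
      moreover have "?s \<in> closed_segment p q" using u by (auto simp: closed_segment_def)
      ultimately show ?thesis unfolding UN_iff mem_cball by blast
    qed
    then show "linked (h \<omega>) (f \<omega>) (g \<omega>)" using pq(3) unfolding linked_def by blast
  qed
  have b: "{\<omega> \<in> space M. boundary_union (h \<omega>) \<in> {F. F \<inter> ?N p q k \<noteq> {}}} \<in> sets M" for p q k
  proof -
    have "(\<lambda>\<omega>. boundary_union (h \<omega>)) -` {F. F \<inter> ?N p q k \<noteq> {}} \<inter> space M \<in> sets M"
      by (rule measurable_sets[OF measurable_compose[OF h measurable_boundary_union] hitting_sets[OF N]])
    then show ?thesis by (simp only: vimage_def Int_def mem_Collect_eq conj_commute)
  qed
  have "{\<omega> \<in> space M. \<exists>p\<in>D. \<exists>q\<in>D. \<exists>k::nat. dist (f \<omega>) p < 1 / Suc k \<and> dist (g \<omega>) q < 1 / Suc k \<and>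
      \<not> boundary_union (h \<omega>) \<in> {F. F \<inter> ?N p q k \<noteq> {}}} \<in> sets M"
  proof (rule sets.sets_Collect_countable_Ex'[OF _ D(1)], rule sets.sets_Collect_countable_Ex'[OF _ D(1)],
      rule sets.sets_Collect_countable_Ex)
    fix p q and k :: nat
    have "{\<omega> \<in> space M. dist (f \<omega>) p < 1 / Suc k} \<in> sets M" by measurable
    moreover have "{\<omega> \<in> space M. dist (g \<omega>) q < 1 / Suc k} \<in> sets M" by measurable
    ultimately show "{\<omega> \<in> space M. dist (f \<omega>) p < 1 / Suc k \<and> dist (g \<omega>) q < 1 / Suc k \<and>
      \<not> boundary_union (h \<omega>) \<in> {F. F \<inter> ?N p q k \<noteq> {}}} \<in> sets M"
      by (intro sets.sets_Collect_conj sets.sets_Collect_neg b)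
  qed
  also have "{\<omega> \<in> space M. \<exists>p\<in>D. \<exists>q\<in>D. \<exists>k::nat. dist (f \<omega>) p < 1 / Suc k \<and> dist (g \<omega>) q < 1 / Suc k \<and>
      \<not> boundary_union (h \<omega>) \<in> {F. F \<inter> ?N p q k \<noteq> {}}} = {\<omega> \<in> space M. linked (h \<omega>) (f \<omega>) (g \<omega>)}"
    by (rule Collect_cong, rule conj_cong[OF refl]) (rule eq[symmetric])
  finally show ?thesis by (simp only: pred_def)
qed

section \<open>Cells seen through a countable dense set\<close>

definition dense_set :: "'a::topological_space set \<Rightarrow> bool" where
  "dense_set D \<longleftrightarrow> countable D \<and> (\<forall>X. open X \<longrightarrow> X \<noteq> {} \<longrightarrow> (\<exists>d\<in>D. d \<in> X))"

text \<open>Being linked is an open condition, so each \<open>x i\<close> can be moved within its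
  cell to a point of \<open>D\<close>; transitivity keeps the moved points unlinked, hence distinct
  and separated.\<close>

lemma card_unlinked_le_sep_count:
  fixes x :: "'i \<Rightarrow> 'a::euclidean_space"
  assumes T: "tessellation T" and D: "dense_set D" and U: "open U" and J: "finite J"
    and x: "\<And>i. i \<in> J \<Longrightarrow> x i \<in> U" "\<And>i. i \<in> J \<Longrightarrow> x i \<notin> boundary_union T"
    and ne: "\<And>i j. i \<in> J \<Longrightarrow> j \<in> J \<Longrightarrow> i \<noteq> j \<Longrightarrow> \<not> linked T (x i) (x j)"
  shows "of_nat (card J) \<le> sep_count (D \<inter> U) (boundary_union T)"
proof -
  have "\<exists>q. q \<in> D \<inter> U \<and> linked T (x i) q" if i: "i \<in> J" for i
  proof -
    have "linked T (x i) (x i)" using x(2)[OF i] by (simp add: linked_refl_iff)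
    then obtain e where e: "e > 0" "\<And>y. dist (x i) y < e \<Longrightarrow> linked T (x i) y"
      using linked_openD[OF T] by blast
    have "open (ball (x i) e \<inter> U)" "x i \<in> ball (x i) e \<inter> U" using U e(1) x(1)[OF i] by auto
    then obtain q where "q \<in> D" "q \<in> ball (x i) e \<inter> U" using D unfolding dense_set_def by blast
    then show ?thesis using e(2) by auto
  qed
  then obtain q where q: "\<And>i. i \<in> J \<Longrightarrow> q i \<in> D \<inter> U" "\<And>i. i \<in> J \<Longrightarrow> linked T (x i) (q i)" by metis
  have nq: "\<not> linked T (q i) (q j)" if "i \<in> J" "j \<in> J" "i \<noteq> j" for i j
  proof
    assume "linked T (q i) (q j)"
    then have "linked T (x i) (x j)"
      using linked_trans[OF T linked_trans[OF T q(2)[OF that(1)]] linked_sym[OF q(2)[OF that(2)]]] by blast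
    then show False using ne that by blast
  qed
  have nb: "q i \<notin> boundary_union T" if "i \<in> J" for i by (rule linked_notin_boundary(2)[OF q(2)[OF that]])
  have inj: "inj_on q J"
  proof (rule inj_onI, rule ccontr)
    fix i j assume ij: "i \<in> J" "j \<in> J" "q i = q j" "i \<noteq> j"
    then have "linked T (q i) (q j)" using nb[OF ij(1)] by (simp add: linked_refl_iff)
    then show False using nq ij by blast
  qed
  have "separated (q ` J) (boundary_union T)"
    unfolding separated_def
  proof (intro ballI conjI impI)
    fix a b assume a: "a \<in> q ` J" and b: "b \<in> q ` J" and "a \<noteq> b"
    then obtain i j where "i \<in> J" "j \<in> J" "a = q i" "b = q j" "i \<noteq> j" by blast
    then show "closed_segment a b \<inter> boundary_union T \<noteq> {}" using nq by (simp add: linked_def)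
  qed (use nb in blast)
  then have "q ` J \<in> {J. finite J \<and> J \<subseteq> D \<inter> U \<and> separated J (boundary_union T)}"
    using J q(1) by blast
  then have "of_nat (card (q ` J)) \<le> sep_count (D \<inter> U) (boundary_union T)"
    unfolding sep_count_def by (rule SUP_upper)
  then show ?thesis using inj by (simp add: card_image)
qed

text \<open>Near a boundary point the ball meets the interiors of two different cells and so
  contains two separated points; off the boundary the cell of the point itself gives one.\<close>

lemma boundary_le_sep_count:
  fixes x :: "'a::euclidean_space"
  assumes T: "tessellation T" and D: "dense_set D" and r: "0 < r"
  shows "1 + of_bool (x \<in> boundary_union T) \<le> sep_count (D \<inter> ball x r) (boundary_union T)"
proof (cases "x \<in> boundary_union T")
  case False
  have "of_nat (card {x}) \<le> sep_count (D \<inter> ball x r) (boundary_union T)"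
    by (rule card_unlinked_le_sep_count[OF T D, where x="\<lambda>x. x"]) (use False r in auto)
  then show ?thesis using False by simp
next
  case True
  then obtain c where c: "c \<in> T" "x \<in> frontier c" by (auto simp: boundary_union_def)
  have "x \<in> c" using c tessellation_cellD(2)[OF T c(1)] frontier_subset_closed by blast
  then have "x \<in> closure (interior c)" using tessellation_cellD(4)[OF T c(1)] by simp
  then obtain y where y: "y \<in> interior c" "y \<in> ball x r"
    using r unfolding closure_approachable by (metis dist_commute mem_ball)
  \<comment> \<open>A point \<open>w\<close> outside \<open>c\<close> need not be interior to its
    own cell \<open>c'\<close>. As \<open>c'\<close> is the closure of its interior, an interior
    point \<open>z\<close> of it exists still inside the ball and outside \<open>c\<close>.\<close>
  have "x \<in> closure (- c)" using c(2) by (auto simp: frontier_def closure_complement)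
  then obtain w where w: "w \<in> - c" "w \<in> ball x r"
    using r unfolding closure_approachable by (metis dist_commute mem_ball)
  obtain c' where c': "c' \<in> T" "w \<in> c'" using tessellation_cover[OF T] by blast
  have "open (ball x r - c)" "w \<in> ball x r - c" using w tessellation_cellD(2)[OF T c(1)] by auto
  moreover have "w \<in> closure (interior c')" using c'(2) tessellation_cellD(4)[OF T c'(1)] by simp
  ultimately have "(ball x r - c) \<inter> interior c' \<noteq> {}"
    using open_Int_closure_eq_empty[of "ball x r - c" "interior c'"] by blast
  then obtain z where z: "z \<in> ball x r" "z \<notin> c" "z \<in> interior c'" by blast
  have yz: "y \<notin> boundary_union T" "z \<notin> boundary_union T"
    using interior_notin_boundary[OF T] c(1) c'(1) y z by blast+
  have "z \<notin> interior c" using z(2) interior_subset by blast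
  then have l: "\<not> linked T y z" using linked_iff_interior[OF T c(1) y(1)] by simp
  then have l': "\<not> linked T z y" using linked_sym by blast
  have "y \<noteq> z" using y(1) z(2) interior_subset by blast
  have "of_nat (card {y, z}) \<le> sep_count (D \<inter> ball x r) (boundary_union T)"
    by (rule card_unlinked_le_sep_count[OF T D, where x="\<lambda>x. x"]) (use y z l l' yz in auto)
  then show ?thesis using True \<open>y \<noteq> z\<close> by simp
qed

text \<open>The mean count in a ball of radius \<open>r\<close> is at least 1 plus the probability
  in question and at most \<open>exp (2 * r * l)\<close>; then \<open>r\<close> tends to 0. What
  matters is that the branching bound tends to exactly 1.\<close>

lemma (in direction_law) stit_boundary_null:
  assumes Pr: "prob_space Pr" and stit: "stit_tessellation \<phi> l Pr T" and l: "0 \<le> l" and D: "dense_set (D :: 'a set)"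
  shows "AE \<omega> in Pr. x \<notin> boundary_union (T \<omega>)"
proof -
  interpret Pr: prob_space Pr by fact
  note T = stit_tessellation_measurable[OF stit]
  have tess: "tessellation (T \<omega>)" if "\<omega> \<in> space Pr" for \<omega>
    using measurable_space[OF T that] by (simp add: space_tessellation_space)
  have "{\<omega> \<in> space Pr. \<not> linked (T \<omega>) x x} \<in> sets Pr"
    by (rule sets.sets_Collect_neg, rule measurable_linked[unfolded pred_def]) (use T in auto)
  then have A: "{\<omega> \<in> space Pr. x \<in> boundary_union (T \<omega>)} \<in> sets Pr" (is "?A \<in> _")
    by (simp add: linked_refl_iff)
  have bound: "1 + Pr.prob ?A \<le> exp (2 * r * l)" if r: "0 < r" for r
  proof -
    have "ennreal (1 + Pr.prob ?A) = 1 + emeasure Pr ?A"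
      by (simp add: Pr.emeasure_eq_measure)
    also have "\<dots> = (\<integral>\<^sup>+\<omega>. 1 + indicator ?A \<omega> \<partial>Pr)"
      using A by (simp add: nn_integral_add Pr.emeasure_space_1)
    also have "\<dots> \<le> (\<integral>\<^sup>+\<omega>. sep_count (D \<inter> ball x r) (boundary_union (T \<omega>)) \<partial>Pr)"
    proof (rule nn_integral_mono)
      fix \<omega> assume \<omega>: "\<omega> \<in> space Pr"
      have "indicator ?A \<omega> = (of_bool (x \<in> boundary_union (T \<omega>)) :: ennreal)" using \<omega> by (simp add: indicator_def)
      then show "1 + indicator ?A \<omega> \<le> sep_count (D \<inter> ball x r) (boundary_union (T \<omega>))"
        using boundary_le_sep_count[OF tess[OF \<omega>] D r, of x] by simp
    qed
    also have "\<dots> \<le> ennreal (exp (2 * r * l))"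
    proof (rule stit_sep_count_le[OF stit l, where R="norm x + r + 1" and z=x])
      have "y \<in> ball 0 (norm x + r + 1)" if "y \<in> ball x r" for y
        using that norm_triangle_ineq2[of y x] by (simp add: dist_norm norm_minus_commute)
      then show "D \<inter> ball x r \<subseteq> ball x r \<inter> ball 0 (norm x + r + 1)" by blast
      show "countable (D \<inter> ball x r)" using D unfolding dense_set_def by blast
      show "0 < norm x + r + 1" using r norm_ge_zero[of x] by linarith
    qed (use r in simp)
    finally show ?thesis by (simp only: ennreal_le_iff[OF exp_ge_zero])
  qed
  have "1 + Pr.prob ?A \<le> exp (2 * 0 * l)"
  proof (rule LIMSEQ_le_const)
    show "(\<lambda>n. exp (2 * inverse (real (Suc n)) * l)) \<longlonglongrightarrow> exp (2 * 0 * l)"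
      by (intro tendsto_intros LIMSEQ_inverse_real_of_nat)
    show "\<exists>N. \<forall>n\<ge>N. 1 + Pr.prob ?A \<le> exp (2 * inverse (real (Suc n)) * l)"
      using bound by (auto simp del: of_nat_Suc)
  qed
  then have "Pr.prob ?A = 0" using measure_nonneg[of Pr ?A] by simp
  then have "emeasure Pr ?A = 0" by (simp add: Pr.emeasure_eq_measure)
  then show ?thesis using A by (intro AE_I[of _ _ ?A]) auto
qed

text \<open>A class with k members contributes k times 1/k, so the sum counts classes;
  \<open>J\<close> holds one representative of each.\<close>

lemma sum_inverse_card_class:
  assumes I: "finite I" and refl: "\<And>i. i \<in> I \<Longrightarrow> R i i"
    and sym: "\<And>i j. R i j \<Longrightarrow> R j i" and trans: "\<And>i j k. R i j \<Longrightarrow> R j k \<Longrightarrow> R i k"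
  shows "\<exists>J\<subseteq>I. (\<forall>i\<in>J. \<forall>j\<in>J. i \<noteq> j \<longrightarrow> \<not> R i j) \<and> (\<Sum>i\<in>I. 1 / real (card {j \<in> I. R i j})) = real (card J)"
proof -
  let ?cl = "\<lambda>i. {j \<in> I. R i j}"
  have cl_eq: "?cl i = ?cl j \<longleftrightarrow> R i j" if "i \<in> I" "j \<in> I" for i j
  proof
    assume "?cl i = ?cl j"
    then have "j \<in> ?cl i" using refl[OF that(2)] that(2) by simp
    then show "R i j" by simp
  next
    assume "R i j"
    then show "?cl i = ?cl j" using sym trans by blast
  qed
  have "(\<Sum>i\<in>I. 1 / real (card (?cl i))) = (\<Sum>C\<in>?cl ` I. \<Sum>i\<in>{i \<in> I. ?cl i = C}. 1 / real (card (?cl i)))"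
    using I by (rule sum.image_gen)
  also have "\<dots> = (\<Sum>C\<in>?cl ` I. 1)"
  proof (rule sum.cong[OF HOL.refl])
    fix C assume "C \<in> ?cl ` I"
    then obtain i where i: "i \<in> I" "C = ?cl i" by blast
    have *: "{k \<in> I. ?cl k = C} = C"
      using cl_eq[OF _ i(1)] sym unfolding i(2) by blast
    have "(\<Sum>k\<in>{k \<in> I. ?cl k = C}. 1 / real (card (?cl k))) = (\<Sum>k\<in>{k \<in> I. ?cl k = C}. 1 / real (card C))"
      by (rule sum.cong) auto
    also have "\<dots> = real (card C) * (1 / real (card C))"
      unfolding * by simp
    also have "\<dots> = 1"
    proof -
      have "finite C" "i \<in> C" using I i refl by auto
      then have "card C \<noteq> 0" by auto
      then show ?thesis by simp
    qed
    finally show "(\<Sum>k\<in>{k \<in> I. ?cl k = C}. 1 / real (card (?cl k))) = 1" .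
  qed
  finally have eq: "(\<Sum>i\<in>I. 1 / real (card (?cl i))) = real (card (?cl ` I))" by simp
  have "\<exists>J\<subseteq>I. inj_on ?cl J \<and> ?cl ` I = ?cl ` J"
    by (rule subset_image_inj[THEN iffD1, OF order_refl])
  then obtain J where J: "J \<subseteq> I" "inj_on ?cl J" "?cl ` I = ?cl ` J"
    by (elim exE conjE)
  then have "card (?cl ` I) = card J" using card_image[OF J(2)] by simp
  moreover have "\<not> R i j" if "i \<in> J" "j \<in> J" "i \<noteq> j" for i j
    using that J(1,2) cl_eq[of i j] unfolding inj_on_def by blast
  ultimately show ?thesis using eq J(1) by auto
qed

text \<open>The left side is the number of occupied cells. One representative of each is assigned to
  the balls of the cover that contain it; within a ball the representatives are pairwise
  unlinked.\<close>

lemma sum_inverse_cells_le: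
  fixes x :: "'i \<Rightarrow> 'a::euclidean_space"
  assumes T: "tessellation T" and D: "dense_set D" and I: "finite I" and Z: "finite Z"
    and x: "\<And>i. i \<in> I \<Longrightarrow> x i \<notin> boundary_union T" "\<And>i. i \<in> I \<Longrightarrow> \<exists>z\<in>Z. x i \<in> ball z r" "\<And>i. i \<in> I \<Longrightarrow> x i \<in> ball 0 R"
  shows "ennreal (\<Sum>i\<in>I. 1 / real (card {j \<in> I. linked T (x i) (x j)})) \<le>
    (\<Sum>z\<in>Z. sep_count (D \<inter> (ball z r \<inter> ball 0 R)) (boundary_union T))"
proof -
  have "\<exists>J\<subseteq>I. (\<forall>i\<in>J. \<forall>j\<in>J. i \<noteq> j \<longrightarrow> \<not> linked T (x i) (x j)) \<and>
      (\<Sum>i\<in>I. 1 / real (card {j \<in> I. linked T (x i) (x j)})) = real (card J)"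
  proof (rule sum_inverse_card_class[OF I])
    show "linked T (x i) (x i)" if "i \<in> I" for i using x(1)[OF that] by (simp add: linked_refl_iff)
  qed (erule linked_sym, erule (1) linked_trans[OF T])
  then obtain J where J: "J \<subseteq> I" "\<And>i j. i \<in> J \<Longrightarrow> j \<in> J \<Longrightarrow> i \<noteq> j \<Longrightarrow> \<not> linked T (x i) (x j)"
    "(\<Sum>i\<in>I. 1 / real (card {j \<in> I. linked T (x i) (x j)})) = real (card J)"
    by blast
  have finJ: "finite J" using J(1) I finite_subset by blast
  let ?J = "\<lambda>z. {i \<in> J. x i \<in> ball z r}"
  have "J = (\<Union>z\<in>Z. ?J z)" using x(2) J(1) by blast
  then have "card J \<le> (\<Sum>z\<in>Z. card (?J z))" using card_UN_le[OF Z, of ?J] by metis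
  then have "(of_nat (card J) :: ennreal) \<le> (\<Sum>z\<in>Z. of_nat (card (?J z)))"
    by (metis of_nat_mono of_nat_sum)
  also have "\<dots> \<le> (\<Sum>z\<in>Z. sep_count (D \<inter> (ball z r \<inter> ball 0 R)) (boundary_union T))"
  proof (rule sum_mono)
    fix z
    show "of_nat (card (?J z)) \<le> sep_count (D \<inter> (ball z r \<inter> ball 0 R)) (boundary_union T)"
      by (rule card_unlinked_le_sep_count[OF T D]) (use J x finJ in auto)
  qed
  finally show ?thesis unfolding J(3) by (simp add: ennreal_of_nat_eq_real_of_nat)
qed

section \<open>Directions of the splits and the size of a cell\<close>

context direction_law
begin

lemma uminus_measurable_\<phi>: "uminus \<in> measurable \<phi> \<phi>"
proof -
  have "uminus \<in> measurable (restrict_space borel (sphere 0 1)) (restrict_space borel (sphere (0::'a) 1))"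
    by (rule measurable_restrict_space3) auto
  then show ?thesis by (simp only: measurable_cong_sets[OF sets_\<phi> sets_\<phi>])
qed

lemma measure_ball_uminus: "measure \<phi> (ball (- b) e \<inter> sphere 0 1) = measure \<phi> (ball b e \<inter> sphere 0 1)"
proof -
  have A: "ball (- b) e \<inter> sphere 0 1 \<in> sets \<phi>"
    by (auto simp: sets_\<phi> sets_restrict_space)
  have even: "distr \<phi> \<phi> uminus = \<phi>" using directional by (simp add: directional_distribution_def)
  have "measure \<phi> (ball (- b) e \<inter> sphere 0 1) = measure (distr \<phi> \<phi> uminus) (ball (- b) e \<inter> sphere 0 1)"
    by (simp only: even)
  also have "\<dots> = measure \<phi> (uminus -` (ball (- b) e \<inter> sphere 0 1) \<inter> space \<phi>)"
    by (rule measure_distr[OF uminus_measurable_\<phi> A])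
  also have "uminus -` (ball (- b) e \<inter> sphere 0 1) \<inter> space \<phi> = ball b e \<inter> sphere 0 1"
  proof -
    have "dist (- b) (- u) = dist b u" for u by (simp add: dist_norm norm_minus_commute)
    then show ?thesis by (auto simp: space_\<phi>)
  qed
  finally show ?thesis .
qed

text \<open>The sum of \<open>\<bar>b \<bullet> v\<bar>\<close> over a basis taken from the support
  has a positive minimum on the sphere, and some basis vector contributes its share. Adding the
  negatives of the basis removes the absolute value; their neighbourhoods have the same mass because
  the direction law is even.\<close>

lemma spanning_directions:
  "\<exists>B \<kappa> m. finite B \<and> 0 < \<kappa> \<and> 0 < m \<and> (\<forall>v::'a. v \<noteq> 0 \<longrightarrow> (\<exists>b\<in>B. \<kappa> * norm v < b \<bullet> v)) \<and>
     (\<forall>b\<in>B. m \<le> measure \<phi> (ball b (\<kappa> / 2) \<inter> sphere 0 1))"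
proof -
  obtain B where B: "B \<subseteq> measure_support \<phi>" "independent B" "card B = DIM('a)"
    using directional unfolding directional_distribution_def by blast
  have fin: "finite B" using B(2) by (rule independent_imp_finite)
  have span: "span B = UNIV"
    using card_ge_dim_independent[of B UNIV] B by (auto simp: dim_UNIV)
  define g where "g v = (\<Sum>b\<in>B. \<bar>b \<bullet> v\<bar>)" for v
  have "continuous_on (sphere 0 1) g" unfolding g_def by (intro continuous_intros)
  moreover have "sphere (0::'a) 1 \<noteq> {}" by simp
  ultimately obtain v0 where v0: "v0 \<in> sphere 0 1" "\<And>v. v \<in> sphere 0 1 \<Longrightarrow> g v0 \<le> g v"
    using continuous_attains_inf[OF compact_sphere] by metis
  have "0 < g v0"
  proof (rule ccontr)
    assume "\<not> 0 < g v0"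
    moreover have "0 \<le> g v0" by (simp add: g_def sum_nonneg)
    ultimately have "g v0 = 0" by simp
    then have "b \<bullet> v0 = 0" if "b \<in> B" for b
      using that fin unfolding g_def by (simp add: sum_nonneg_eq_0_iff)
    then have "orthogonal v0 b" if "b \<in> B" for b using that by (simp add: orthogonal_def inner_commute)
    then have "orthogonal v0 v0" using orthogonal_to_span[of v0 B v0] span by blast
    then show False using v0(1) by (simp add: orthogonal_def)
  qed
  \<comment> \<open>The average share of one basis vector, halved to make the inequality
    strict.\<close>
  define \<kappa> where "\<kappa> = g v0 / (2 * DIM('a))"
  have \<kappa>: "0 < \<kappa>" using \<open>0 < g v0\<close> by (simp add: \<kappa>_def)
  let ?B = "B \<union> uminus ` B"
  have dir: "\<exists>b\<in>?B. \<kappa> * norm v < b \<bullet> v" if "v \<noteq> 0" for v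
  proof -
    have "\<exists>b\<in>B. \<kappa> * norm v < \<bar>b \<bullet> v\<bar>"
    proof (rule ccontr)
      assume "\<not> ?thesis"
      then have "\<And>b. b \<in> B \<Longrightarrow> \<bar>b \<bullet> v\<bar> \<le> \<kappa> * norm v" by force
      then have "g v \<le> real (card B) * (\<kappa> * norm v)" unfolding g_def by (rule sum_bounded_above)
      also have "\<dots> = g v0 / 2 * norm v" by (simp add: \<kappa>_def B(3))
      also have "\<dots> < g v0 * norm v" using \<open>0 < g v0\<close> that by simp
      finally have "g v < g v0 * norm v" .
      moreover have "g v0 \<le> g (v /\<^sub>R norm v)" using that by (intro v0(2)) simp
      moreover have "g (v /\<^sub>R norm v) = g v / norm v"
        unfolding g_def sum_divide_distrib by (simp add: abs_mult divide_inverse mult.commute)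
      ultimately show False using that by (simp add: pos_le_divide_eq)
    qed
    then obtain b where b: "b \<in> B" "\<kappa> * norm v < \<bar>b \<bullet> v\<bar>" by blast
    show ?thesis
    proof (cases "0 \<le> b \<bullet> v")
      case True
      then show ?thesis using b by (intro bexI[of _ b]) auto
    next
      case False
      then show ?thesis using b by (intro bexI[of _ "- b"]) auto
    qed
  qed
  have pos: "0 < measure \<phi> (ball b (\<kappa> / 2) \<inter> sphere 0 1)" if "b \<in> ?B" for b
  proof -
    have 1: "0 < measure \<phi> (ball b (\<kappa> / 2) \<inter> sphere 0 1)" if "b \<in> B" for b
    proof -
      have "b \<in> measure_support \<phi>" using B(1) that by blast
      moreover have "open (ball b (\<kappa> / 2))" "b \<in> ball b (\<kappa> / 2)" using \<kappa> by auto
      ultimately have "0 < emeasure \<phi> (ball b (\<kappa> / 2) \<inter> space \<phi>)" unfolding measure_support_def by blast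
      then show ?thesis by (simp add: space_\<phi> emeasure_eq_measure)
    qed
    from that show ?thesis
    proof
      assume "b \<in> uminus ` B"
      then obtain b' where "b' \<in> B" "b = - b'" by blast
      then show ?thesis using 1[of b'] by (simp only: measure_ball_uminus)
    qed (rule 1)
  qed
  have finB: "finite ?B" using fin by simp
  have "B \<noteq> {}" using B(3) by (metis DIM_positive card.empty less_irrefl)
  then have ne: "?B \<noteq> {}" by blast
  define m where "m = Min ((\<lambda>b. measure \<phi> (ball b (\<kappa> / 2) \<inter> sphere 0 1)) ` ?B)"
  have "0 < m" unfolding m_def using finB ne pos by (subst Min_gr_iff) auto
  moreover have "m \<le> measure \<phi> (ball b (\<kappa> / 2) \<inter> sphere 0 1)" if "b \<in> ?B" for b
    unfolding m_def using finB that by (intro Min_le) auto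
  ultimately show ?thesis using finB \<kappa> dir by blast
qed

end

text \<open>Taking \<open>q\<close> from \<open>D\<close>, which will be countable, makes the
  relation measurable, and \<open>ball 0 R\<close> keeps it inside the window in which the law of
  the boundary is used.\<close>

definition far_linked :: "'a::euclidean_space set \<Rightarrow> real \<Rightarrow> 'a \<Rightarrow> real \<Rightarrow> real \<Rightarrow> 'a \<Rightarrow> 'a set set \<Rightarrow> bool" where
  "far_linked D R b \<kappa> \<rho> x T \<longleftrightarrow>
     (\<exists>q\<in>D. q \<in> ball 0 R \<and> \<rho> < norm (q - x) \<and> \<kappa> * norm (q - x) < b \<bullet> (q - x) \<and> linked T x q)"

text \<open>An upper bound for the \<open>e\<close>-th power of the distance from \<open>x\<close> to any point of its cell.\<close>

definition reach :: "'a::euclidean_space set \<Rightarrow> real \<Rightarrow> 'a set \<Rightarrow> real \<Rightarrow> real \<Rightarrow> real \<Rightarrow> 'a \<Rightarrow> 'a set set \<Rightarrow> ennreal" where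
  "reach D R B \<kappa> l e x T =
     (\<Sum>k::nat. \<Sum>b\<in>B. ennreal ((real (Suc k) / l) powr e) * of_bool (far_linked D R b \<kappa> (real k / l) x T))"

lemma pred_far_linked [measurable (raw)]:
  fixes f :: "'b \<Rightarrow> 'a::euclidean_space"
  assumes D: "countable D" and f [measurable]: "f \<in> borel_measurable M" and h [measurable]: "h \<in> measurable M tessellation_space"
  shows "Measurable.pred M (\<lambda>\<omega>. far_linked D R b \<kappa> \<rho> (f \<omega>) (h \<omega>))"
  unfolding far_linked_def pred_def
  by (rule sets.sets_Collect_countable_Ex'[OF _ D]) measurable

lemma measurable_reach:
  fixes f :: "'b \<Rightarrow> 'a::euclidean_space"
  assumes D: "countable D" and [measurable]: "f \<in> borel_measurable M" "h \<in> measurable M tessellation_space"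
  shows "(\<lambda>\<omega>. reach D R B \<kappa> l e (f \<omega>) (h \<omega>)) \<in> borel_measurable M"
proof -
  have [measurable]: "Measurable.pred M (\<lambda>\<omega>. far_linked D R b \<kappa> \<rho> (f \<omega>) (h \<omega>))" for b \<rho>
    by (rule pred_far_linked[OF D]) measurable
  show ?thesis unfolding reach_def by measurable
qed

text \<open>One term is already large enough: \<open>k\<close> the shell of \<open>y\<close> around
  \<open>x\<close>, and \<open>b\<close> a direction whose cone contains \<open>y - x\<close>. Since
  being linked to \<open>x\<close> and the conditions on \<open>y\<close> are open, \<open>y\<close>
  can be replaced by a point of \<open>D\<close>.\<close>

lemma dist_le_reach:
  assumes T: "tessellation T" and D: "dense_set D" and B: "finite B" "\<And>v. v \<noteq> 0 \<Longrightarrow> \<exists>b\<in>B. \<kappa> * norm v < b \<bullet> v"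
    and l: "0 < l" and e: "0 < e" and xy: "linked T x y" "y \<in> ball 0 R"
  shows "ennreal (norm (y - x) powr e) \<le> reach D R B \<kappa> l e x T"
proof (cases "y = x")
  case False
  then have pos: "0 < l * norm (y - x)" using l by simp
  \<comment> \<open>Ceiling minus 1 rather than the floor, because the inner radius of the shell
    must be strictly exceeded.\<close>
  define k where "k = nat (\<lceil>l * norm (y - x)\<rceil> - 1)"
  have "0 < \<lceil>l * norm (y - x)\<rceil>" using pos by simp
  then have k: "real k < l * norm (y - x)" "l * norm (y - x) \<le> real (Suc k)"
    unfolding k_def by linarith+
  obtain b where b: "b \<in> B" "\<kappa> * norm (y - x) < b \<bullet> (y - x)" using B(2)[of "y - x"] False by auto
  obtain d where d: "0 < d" "\<And>y'. dist y y' < d \<Longrightarrow> linked T x y'" using linked_openD[OF T xy(1)] by blast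
  let ?U = "ball y d \<inter> ball 0 R \<inter> {q. real k / l < norm (q - x)} \<inter> {q. \<kappa> * norm (q - x) < b \<bullet> (q - x)}"
  have "open ?U" by (intro open_Int open_ball open_Collect_less continuous_intros)
  moreover have "y \<in> ?U" using d(1) xy(2) b(2) k(1) l by (simp add: pos_divide_less_eq mult.commute)
  ultimately obtain q where q: "q \<in> D" "q \<in> ?U" using D unfolding dense_set_def by blast
  then have far: "far_linked D R b \<kappa> (real k / l) x T"
    unfolding far_linked_def using d(2)[of q] by (intro bexI[of _ q]) auto
  let ?t = "\<lambda>k b. ennreal ((real (Suc k) / l) powr e) * of_bool (far_linked D R b \<kappa> (real k / l) x T)"
  have "norm (y - x) \<le> real (Suc k) / l" using k(2) l by (simp add: pos_le_divide_eq mult.commute)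
  then have "ennreal (norm (y - x) powr e) \<le> ennreal ((real (Suc k) / l) powr e)"
    using e by (intro ennreal_leI powr_mono2) auto
  also have "\<dots> = ?t k b" using far by simp
  also have "\<dots> \<le> (\<Sum>b\<in>B. ?t k b)" using b(1) B(1) by (intro member_le_sum) auto
  also have "\<dots> \<le> (\<Sum>k. \<Sum>b\<in>B. ?t k b)"
    using sum_le_suminf[of "\<lambda>k. \<Sum>b\<in>B. ?t k b" "{k}"] by simp
  finally show ?thesis unfolding reach_def .
qed (simp add: e)

text \<open>In units of \<open>1 / l\<close> the cone estimate decays like
  \<open>exp (- (m * \<kappa> / 2) * k)\<close> whatever \<open>l\<close> is, so taking out
  \<open>l powr (- e)\<close> leaves a series free of \<open>l\<close>. The bound
  \<open>e \<le> 2\<close> allows the power of \<open>Suc k\<close> to be replaced by its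
  square.\<close>

lemma (in direction_law) stit_reach_le:
  assumes Pr: "prob_space Pr" and stit: "stit_tessellation \<phi> l Pr T" and l: "0 < l" and R: "0 < R"
    and x: "x \<in> ball 0 R" and D: "countable (D :: 'a set)" and B: "finite B" "0 < \<kappa>"
    and m: "0 < m" "\<And>b. b \<in> B \<Longrightarrow> m \<le> measure \<phi> (ball b (\<kappa> / 2) \<inter> sphere 0 1)" and e: "0 < e" "e \<le> 2"
  shows "(\<integral>\<^sup>+\<omega>. reach D R B \<kappa> l e x (T \<omega>) \<partial>Pr) \<le>
    ennreal (l powr (- e)) * (\<Sum>k. ennreal (real (card B) * (real (Suc k))\<^sup>2 * exp (- (m * \<kappa> / 2) * real k)))"
proof -
  interpret Pr: prob_space Pr by fact
  note T [measurable] = stit_tessellation_measurable[OF stit]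
  have far_m [measurable]: "Measurable.pred Pr (\<lambda>\<omega>. far_linked D R b \<kappa> \<rho> x (T \<omega>))" for b \<rho>
    by (rule pred_far_linked[OF D]) measurable
  have far: "(\<integral>\<^sup>+\<omega>. of_bool (far_linked D R b \<kappa> (real k / l) x (T \<omega>)) \<partial>Pr) \<le> ennreal (exp (- (m * \<kappa> / 2) * real k))"
    if b: "b \<in> B" for b k
  \<comment> \<open>The cone estimate needs a positive cut-off; for \<open>k = 0\<close> the trivial
    bound 1 is used.\<close>
  proof (cases "k = 0")
    case True
    have "(\<integral>\<^sup>+\<omega>. of_bool (far_linked D R b \<kappa> (real k / l) x (T \<omega>)) \<partial>Pr) \<le> (\<integral>\<^sup>+\<omega>. 1 \<partial>Pr)"
      by (intro nn_integral_mono) simp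
    then show ?thesis using True by (simp add: Pr.emeasure_space_1)
  next
    case False
    let ?Q = "{q \<in> D. q \<in> ball 0 R \<and> real k / l < norm (q - x) \<and> \<kappa> * norm (q - x) < b \<bullet> (q - x)}"
    have "(\<integral>\<^sup>+\<omega>. of_bool (far_linked D R b \<kappa> (real k / l) x (T \<omega>)) \<partial>Pr) =
      (\<integral>\<^sup>+\<omega>. of_bool (\<exists>q\<in>?Q. closed_segment x q \<inter> boundary_union (T \<omega>) = {}) \<partial>Pr)"
      unfolding far_linked_def linked_def by (intro nn_integral_cong arg_cong[where f=of_bool]) blast
    also have "\<dots> \<le> ennreal (exp (- l * (measure \<phi> (ball b (\<kappa> / 2) \<inter> sphere 0 1) * \<kappa> * (real k / l) / 2)))"
      using D l R B False x by (intro stit_cone_le[OF stit]) (auto simp: far_cone_def)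
    also have "\<dots> \<le> ennreal (exp (- (m * \<kappa> / 2) * real k))"
    proof (intro ennreal_leI, subst exp_le_cancel_iff)
      have "- l * (measure \<phi> (ball b (\<kappa> / 2) \<inter> sphere 0 1) * \<kappa> * (real k / l) / 2) =
         - (measure \<phi> (ball b (\<kappa> / 2) \<inter> sphere 0 1) * (\<kappa> * real k / 2))"
        using l by (simp add: field_simps)
      also have "\<dots> \<le> - (m * (\<kappa> * real k / 2))"
        using B(2) by (intro le_imp_neg_le mult_right_mono m(2)[OF b]) simp
      finally show "- l * (measure \<phi> (ball b (\<kappa> / 2) \<inter> sphere 0 1) * \<kappa> * (real k / l) / 2) \<le> - (m * \<kappa> / 2) * real k"
        by simp
    qed
    finally show ?thesis .
  qed
  have "(\<integral>\<^sup>+\<omega>. reach D R B \<kappa> l e x (T \<omega>) \<partial>Pr) =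
    (\<Sum>k. \<Sum>b\<in>B. ennreal ((real (Suc k) / l) powr e) * (\<integral>\<^sup>+\<omega>. of_bool (far_linked D R b \<kappa> (real k / l) x (T \<omega>)) \<partial>Pr))"
    unfolding reach_def by (subst nn_integral_suminf) (auto simp: nn_integral_sum nn_integral_cmult)
  also have "\<dots> \<le> (\<Sum>k. ennreal (l powr (- e)) * ennreal (real (card B) * (real (Suc k))\<^sup>2 * exp (- (m * \<kappa> / 2) * real k)))"
  proof (intro suminf_le)
    fix k
    have "(real (Suc k) / l) powr e = real (Suc k) powr e * l powr (- e)"
      using l by (subst powr_divide) (auto simp: powr_minus_divide)
    also have "\<dots> \<le> (real (Suc k))\<^sup>2 * l powr (- e)"
    proof (rule mult_right_mono)
      have "real (Suc k) powr e \<le> real (Suc k) powr 2" using e by (intro powr_mono) auto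
      then show "real (Suc k) powr e \<le> (real (Suc k))\<^sup>2" by (simp add: powr_numeral)
    qed simp
    finally have p: "(real (Suc k) / l) powr e \<le> (real (Suc k))\<^sup>2 * l powr (- e)" .
    have "(\<Sum>b\<in>B. ennreal ((real (Suc k) / l) powr e) * (\<integral>\<^sup>+\<omega>. of_bool (far_linked D R b \<kappa> (real k / l) x (T \<omega>)) \<partial>Pr)) \<le>
      (\<Sum>b\<in>B. ennreal ((real (Suc k))\<^sup>2 * l powr (- e)) * ennreal (exp (- (m * \<kappa> / 2) * real k)))"
      by (intro sum_mono mult_mono far ennreal_leI p) auto
    also have "\<dots> = ennreal (\<Sum>b\<in>B. (real (Suc k))\<^sup>2 * l powr (- e) * exp (- (m * \<kappa> / 2) * real k))"
      by (subst sum_ennreal[symmetric]) (auto simp only: ennreal_mult' zero_le_power2 powr_ge_zero exp_ge_zero mult_nonneg_nonneg intro!: sum.cong)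
    also have "\<dots> = ennreal (l powr (- e)) * ennreal (real (card B) * (real (Suc k))\<^sup>2 * exp (- (m * \<kappa> / 2) * real k))"
      by (subst ennreal_mult'[symmetric]) (auto simp: mult_ac)
    finally show "(\<Sum>b\<in>B. ennreal ((real (Suc k) / l) powr e) * (\<integral>\<^sup>+\<omega>. of_bool (far_linked D R b \<kappa> (real k / l) x (T \<omega>)) \<partial>Pr)) \<le>
      ennreal (l powr (- e)) * ennreal (real (card B) * (real (Suc k))\<^sup>2 * exp (- (m * \<kappa> / 2) * real k))" .
  qed auto
  also have "\<dots> = ennreal (l powr (- e)) * (\<Sum>k. ennreal (real (card B) * (real (Suc k))\<^sup>2 * exp (- (m * \<kappa> / 2) * real k)))"
    by (rule ennreal_suminf_cmult)
  finally show ?thesis .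
qed

section \<open>Local averages over a fixed partition\<close>

text \<open>Here \<open>A\<close> stands for lying in the same cell of a frozen partition. Index 0
  is the point of evaluation and is not counted.\<close>

definition hits :: "('a \<Rightarrow> 'a \<Rightarrow> bool) \<Rightarrow> nat \<Rightarrow> (nat \<Rightarrow> 'a \<times> real) \<Rightarrow> real" where
  "hits A n D = (\<Sum>j=1..n. of_bool (A (fst (D 0)) (fst (D j))))"

definition weight :: "('a \<Rightarrow> 'a \<Rightarrow> bool) \<Rightarrow> nat \<Rightarrow> nat \<Rightarrow> (nat \<Rightarrow> 'a \<times> real) \<Rightarrow> real" where
  "weight A n i D = of_bool (A (fst (D 0)) (fst (D i))) / hits A n D"

definition local_mean :: "('a \<Rightarrow> 'a \<Rightarrow> bool) \<Rightarrow> nat \<Rightarrow> (nat \<Rightarrow> 'a \<times> real) \<Rightarrow> real" where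
  "local_mean A n D = (\<Sum>i=1..n. weight A n i D * snd (D i))"

lemma hits_eq_card: "hits A n D = real (card {j \<in> {1..n}. A (fst (D 0)) (fst (D j))})"
  by (simp add: hits_def of_bool_def sum.If_cases Int_def)

lemma hits_ge_1: "i \<in> {1..n} \<Longrightarrow> A (fst (D 0)) (fst (D i)) \<Longrightarrow> 1 \<le> hits A n D"
proof -
  assume i: "i \<in> {1..n}" "A (fst (D 0)) (fst (D i))"
  have "(of_bool (A (fst (D 0)) (fst (D i))) :: real) \<le> hits A n D"
    unfolding hits_def using i(1) by (intro member_le_sum) auto
  then show ?thesis using i(2) by simp
qed

lemma hits_nonneg: "0 \<le> hits A n D"
  by (simp add: hits_def sum_nonneg)

lemma hits_cases: "hits A n D = 0 \<or> 1 \<le> hits A n D"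
proof (cases "\<exists>i\<in>{1..n}. A (fst (D 0)) (fst (D i))")
  case True
  then show ?thesis using hits_ge_1 by blast
next
  case False
  then show ?thesis by (simp add: hits_def)
qed

lemma weight_bounds: "0 \<le> weight A n i D" "i \<in> {1..n} \<Longrightarrow> weight A n i D \<le> 1"
proof -
  show "0 \<le> weight A n i D" using hits_nonneg[of A n D] by (simp add: weight_def)
  assume i: "i \<in> {1..n}"
  show "weight A n i D \<le> 1"
    using hits_ge_1[OF i, of A D] by (cases "A (fst (D 0)) (fst (D i))") (auto simp: weight_def)
qed

lemma sum_weight: "(\<Sum>i=1..n. weight A n i D) = of_bool (hits A n D \<noteq> 0)"
  unfolding weight_def sum_divide_distrib[symmetric] hits_def[symmetric] by simp

text \<open>With N for the number of hits, the sum is 1/N, which is at most 2/(N + 1) if N is at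
  least 1, and it is 0 if N is 0. The count N + 1 can include the point of evaluation, which puts it
  on the same footing as the sample.\<close>

lemma sum_weight_square: "(\<Sum>i=1..n. (weight A n i D)\<^sup>2) \<le> 2 * (1 / (hits A n D + 1))"
proof -
  have "(weight A n i D)\<^sup>2 = of_bool (A (fst (D 0)) (fst (D i))) / (hits A n D)\<^sup>2" for i
    by (simp add: weight_def power_divide)
  then have "(\<Sum>i=1..n. (weight A n i D)\<^sup>2) = hits A n D / (hits A n D)\<^sup>2"
    by (simp only: sum_divide_distrib[symmetric] hits_def[symmetric])
  also have "\<dots> \<le> 2 * (1 / (hits A n D + 1))"
    using hits_cases[of A n D]
  proof
    assume "1 \<le> hits A n D"
    then show ?thesis by (simp add: power2_eq_square field_simps)
  qed simp
  finally show ?thesis .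
qed

text \<open>Conditional mean and variance of the noise appear as integrals against test functions of
  the design point. Tests bounded by 1 are enough, since they will be products of two
  weights.\<close>

locale regression_law = prob_space \<nu> for \<nu> :: "('a::euclidean_space \<times> real) measure" +
  fixes f :: "'a \<Rightarrow> real" and \<sigma> L :: real
  assumes sets_\<nu> [measurable_cong]: "sets \<nu> = sets borel"
    and f_measurable [measurable]: "f \<in> borel_measurable borel"
    and f_bounded: "\<bar>f x\<bar> \<le> L"
    and noise_integrable: "integrable \<nu> (\<lambda>p. (snd p - f (fst p))\<^sup>2)"
    and noise_mean: "g \<in> borel_measurable borel \<Longrightarrow> (\<And>x. \<bar>g x\<bar> \<le> 1) \<Longrightarrow> (\<integral>p. g (fst p) * (snd p - f (fst p)) \<partial>\<nu>) = 0"
    and noise_variance: "g \<in> borel_measurable borel \<Longrightarrow> (\<And>x. \<bar>g x\<bar> \<le> 1) \<Longrightarrow>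
      (\<integral>p. g (fst p) * (snd p - f (fst p))\<^sup>2 \<partial>\<nu>) = \<sigma>\<^sup>2 * (\<integral>p. g (fst p) \<partial>\<nu>)"
begin

abbreviation sample :: "nat \<Rightarrow> (nat \<Rightarrow> 'a \<times> real) measure" where
  "sample n \<equiv> PiM {0..n} (\<lambda>_. \<nu>)"

definition noise :: "'a \<times> real \<Rightarrow> real" where
  "noise p = snd p - f (fst p)"

lemma measurable_noise [measurable]: "noise \<in> borel_measurable borel"
  unfolding noise_def borel_prod[symmetric] by measurable

sublocale P: product_sigma_finite "\<lambda>_::nat. \<nu>" ..

lemma prob_space_sample: "prob_space (sample n)"
  by (intro prob_space_PiM prob_space_axioms)

lemma integrable_noise_component: "i \<in> {0..n} \<Longrightarrow> integrable (sample n) (\<lambda>D. (noise (D i))\<^sup>2)"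
proof -
  assume i: "i \<in> {0..n}"
  have "integrable (distr (sample n) \<nu> (\<lambda>D. D i)) (\<lambda>p. (noise p)\<^sup>2)"
    using noise_integrable
    by (subst distr_PiM_component[of "{0..n}" "\<lambda>_. \<nu>" i, OF prob_space_axioms i]) (simp add: noise_def)
  then show ?thesis using i by (subst (asm) integrable_distr_eq) auto
qed

lemma integrable_weighted_noise:
  assumes ij: "i \<in> {0..n}" "j \<in> {0..n}" and v: "v \<in> borel_measurable (sample n)" "\<And>D. \<bar>v D\<bar> \<le> 1"
  shows "integrable (sample n) (\<lambda>D. v D * (noise (D i) * noise (D j)))"
proof (rule Bochner_Integration.integrable_bound)
  show "integrable (sample n) (\<lambda>D. (noise (D i))\<^sup>2 + (noise (D j))\<^sup>2)"
    by (intro Bochner_Integration.integrable_add integrable_noise_component ij)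
  show "(\<lambda>D. v D * (noise (D i) * noise (D j))) \<in> borel_measurable (sample n)"
    using v(1) ij by measurable
  show "AE D in sample n. norm (v D * (noise (D i) * noise (D j))) \<le> norm ((noise (D i))\<^sup>2 + (noise (D j))\<^sup>2)"
  proof (rule AE_I2)
    fix D
    have "\<bar>a * b\<bar> \<le> a\<^sup>2 + b\<^sup>2" for a b :: real
    proof -
      have "2 * (\<bar>a\<bar> * \<bar>b\<bar>) \<le> \<bar>a\<bar>\<^sup>2 + \<bar>b\<bar>\<^sup>2" using sum_squares_bound[of "\<bar>a\<bar>" "\<bar>b\<bar>"] by simp
      moreover have "0 \<le> \<bar>a\<bar> * \<bar>b\<bar>" by simp
      ultimately show ?thesis unfolding abs_mult power2_abs by linarith
    qed
    then have "\<bar>v D\<bar> * \<bar>noise (D i) * noise (D j)\<bar> \<le> 1 * ((noise (D i))\<^sup>2 + (noise (D j))\<^sup>2)"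
      using v(2)[of D] by (intro mult_mono) auto
    then show "norm (v D * (noise (D i) * noise (D j))) \<le> norm ((noise (D i))\<^sup>2 + (noise (D j))\<^sup>2)"
      by (simp add: abs_mult)
  qed
qed

lemma sample_integral_insert:
  fixes h :: "(nat \<Rightarrow> 'a \<times> real) \<Rightarrow> real"
  assumes i: "i \<in> {0..n}" and h: "integrable (sample n) h"
  shows "integral\<^sup>L (sample n) h = (\<integral>x. (\<integral>p. h (x(i := p)) \<partial>\<nu>) \<partial>PiM ({0..n} - {i}) (\<lambda>_. \<nu>))"
proof -
  have "insert i ({0..n} - {i}) = {0..n}" using i by auto
  then show ?thesis
    using P.product_integral_insert[of "{0..n} - {i}" i h] h by simp
qed

text \<open>If \<open>v\<close> depends on design points only, the response at \<open>i\<close> can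
  be set to 0; the section is then a function of the design point and an admissible test
  function.\<close>

lemma measurable_update_section:
  assumes i: "i \<in> {0..n}" and v: "v \<in> borel_measurable (sample n)" and x: "x \<in> space (PiM ({0..n} - {i}) (\<lambda>_. \<nu>))"
  shows "(\<lambda>a. v (x(i := (a, 0)))) \<in> borel_measurable borel"
proof -
  have eq: "insert i ({0..n} - {i}) = {0..n}" using i by auto
  have "(\<lambda>p. x(i := p)) \<in> measurable \<nu> (PiM (insert i ({0..n} - {i})) (\<lambda>_. \<nu>))"
    using x by (intro measurable_fun_upd[where J="{0..n} - {i}"]) auto
  then have "(\<lambda>p. x(i := p)) \<in> measurable \<nu> (sample n)" unfolding eq .
  then have "(\<lambda>a. x(i := (a, 0))) \<in> measurable borel (sample n)"
    by (rule measurable_compose[rotated]) measurable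
  then show ?thesis by (rule measurable_compose[OF _ v])
qed

text \<open>Coordinate \<open>i\<close> is integrated first: the noise at \<open>j\<close> is then a
  constant and \<open>v\<close> a test function of the design point at \<open>i\<close>, against
  which the noise has mean 0.\<close>

lemma cross_noise:
  assumes ij: "i \<in> {0..n}" "j \<in> {0..n}" "i \<noteq> j" and v: "v \<in> borel_measurable (sample n)" "\<And>D. \<bar>v D\<bar> \<le> 1"
    and dep: "\<And>D D'. (\<And>k. fst (D k) = fst (D' k)) \<Longrightarrow> v D = v D'"
  shows "(\<integral>D. v D * (noise (D i) * noise (D j)) \<partial>sample n) = 0"
  unfolding sample_integral_insert[OF ij(1) integrable_weighted_noise[OF ij(1,2) v]]
proof -
  have "(\<integral>p. v (x(i := p)) * (noise ((x(i := p)) i) * noise ((x(i := p)) j)) \<partial>\<nu>) = 0"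
    if x: "x \<in> space (PiM ({0..n} - {i}) (\<lambda>_. \<nu>))" for x
  proof -
    have "(\<integral>p. v (x(i := p)) * (noise ((x(i := p)) i) * noise ((x(i := p)) j)) \<partial>\<nu>) =
       (\<integral>p. noise (x j) * (v (x(i := (fst p, 0))) * noise p) \<partial>\<nu>)"
    proof (rule Bochner_Integration.integral_cong[OF HOL.refl])
      fix p
      have "v (x(i := p)) = v (x(i := (fst p, 0)))" by (rule dep) simp
      then show "v (x(i := p)) * (noise ((x(i := p)) i) * noise ((x(i := p)) j)) = noise (x j) * (v (x(i := (fst p, 0))) * noise p)"
        using ij(3) by simp
    qed
    also have "\<dots> = noise (x j) * (\<integral>p. v (x(i := (fst p, 0))) * noise p \<partial>\<nu>)" by simp
    also have "(\<integral>p. v (x(i := (fst p, 0))) * noise p \<partial>\<nu>) = 0"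
      unfolding noise_def using noise_mean[OF measurable_update_section[OF ij(1) v(1) x]] v(2) by simp
    finally show ?thesis by (simp only: mult_zero_right)
  qed
  then have "(\<integral>x. (\<integral>p. v (x(i := p)) * (noise ((x(i := p)) i) * noise ((x(i := p)) j)) \<partial>\<nu>) \<partial>PiM ({0..n} - {i}) (\<lambda>_. \<nu>)) =
    (\<integral>x. 0 \<partial>PiM ({0..n} - {i}) (\<lambda>_. \<nu>))"
    by (intro Bochner_Integration.integral_cong HOL.refl)
  then show "(\<integral>x. (\<integral>p. v (x(i := p)) * (noise ((x(i := p)) i) * noise ((x(i := p)) j)) \<partial>\<nu>) \<partial>PiM ({0..n} - {i}) (\<lambda>_. \<nu>)) = 0"
    by simp
qed

lemma square_noise:
  assumes i: "i \<in> {0..n}" and v: "v \<in> borel_measurable (sample n)" "\<And>D. \<bar>v D\<bar> \<le> 1"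
    and dep: "\<And>D D'. (\<And>k. fst (D k) = fst (D' k)) \<Longrightarrow> v D = v D'"
  shows "(\<integral>D. v D * (noise (D i) * noise (D i)) \<partial>sample n) = \<sigma>\<^sup>2 * (\<integral>D. v D \<partial>sample n)"
proof -
  have prob: "prob_space (sample n)" by (rule prob_space_sample)
  have iv: "integrable (sample n) v"
    by (rule finite_measure.integrable_const_bound[OF prob_space.finite_measure[OF prob], where B=1])
      (simp_all add: v)
  have "(\<integral>D. v D * (noise (D i) * noise (D i)) \<partial>sample n) =
     (\<integral>x. (\<integral>p. v (x(i := p)) * (noise ((x(i := p)) i) * noise ((x(i := p)) i)) \<partial>\<nu>) \<partial>PiM ({0..n} - {i}) (\<lambda>_. \<nu>))"
    by (rule sample_integral_insert[OF i integrable_weighted_noise[OF i i v]])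
  also have "\<dots> = (\<integral>x. \<sigma>\<^sup>2 * (\<integral>p. v (x(i := p)) \<partial>\<nu>) \<partial>PiM ({0..n} - {i}) (\<lambda>_. \<nu>))"
  proof (rule Bochner_Integration.integral_cong[OF HOL.refl])
    fix x assume x: "x \<in> space (PiM ({0..n} - {i}) (\<lambda>_. \<nu>))"
    have d: "v (x(i := p)) = v (x(i := (fst p, 0)))" for p by (rule dep) simp
    have "(\<integral>p. v (x(i := p)) * (noise ((x(i := p)) i) * noise ((x(i := p)) i)) \<partial>\<nu>) =
       (\<integral>p. v (x(i := (fst p, 0))) * (noise p)\<^sup>2 \<partial>\<nu>)"
    proof (rule Bochner_Integration.integral_cong[OF HOL.refl])
      fix p
      show "v (x(i := p)) * (noise ((x(i := p)) i) * noise ((x(i := p)) i)) = v (x(i := (fst p, 0))) * (noise p)\<^sup>2"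
        unfolding d[of p] fun_upd_same power2_eq_square ..
    qed
    also have "\<dots> = \<sigma>\<^sup>2 * (\<integral>p. v (x(i := (fst p, 0))) \<partial>\<nu>)"
      unfolding noise_def using v(2) by (intro noise_variance measurable_update_section[OF i v(1) x])
    also have "(\<integral>p. v (x(i := (fst p, 0))) \<partial>\<nu>) = (\<integral>p. v (x(i := p)) \<partial>\<nu>)"
      by (rule Bochner_Integration.integral_cong[OF HOL.refl]) (rule d[symmetric])
    finally show "(\<integral>p. v (x(i := p)) * (noise ((x(i := p)) i) * noise ((x(i := p)) i)) \<partial>\<nu>) = \<sigma>\<^sup>2 * (\<integral>p. v (x(i := p)) \<partial>\<nu>)" .
  qed
  also have "\<dots> = \<sigma>\<^sup>2 * (\<integral>x. (\<integral>p. v (x(i := p)) \<partial>\<nu>) \<partial>PiM ({0..n} - {i}) (\<lambda>_. \<nu>))" by simp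
  also have "\<dots> = \<sigma>\<^sup>2 * (\<integral>D. v D \<partial>sample n)"
    by (simp only: sample_integral_insert[OF i iv])
  finally show ?thesis .
qed

text \<open>After expanding the square, the off-diagonal terms vanish by \<open>cross_noise\<close>
  and the diagonal ones are given by \<open>square_noise\<close>.\<close>

lemma weighted_noise_sum:
  assumes w: "\<And>i. i \<in> {1..n} \<Longrightarrow> w i \<in> borel_measurable (sample n)" "\<And>i D. \<bar>w i D\<bar> \<le> 1"
    and dep: "\<And>i D D'. (\<And>k. fst (D k) = fst (D' k)) \<Longrightarrow> w i D = w i D'"
  shows "(\<integral>\<^sup>+D. ennreal ((\<Sum>i=1..n. w i D * noise (D i))\<^sup>2) \<partial>sample n) =
     ennreal (\<sigma>\<^sup>2) * (\<integral>\<^sup>+D. ennreal (\<Sum>i=1..n. (w i D)\<^sup>2) \<partial>sample n)"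
proof -
  have prob: "prob_space (sample n)" by (rule prob_space_sample)
  have w1: "\<bar>w i D * w j D\<bar> \<le> 1" for i j D
    using mult_mono[OF w(2)[of i D] w(2)[of j D]] by (simp add: abs_mult)
  have wm: "(\<lambda>D. w i D * w j D) \<in> borel_measurable (sample n)" if "i \<in> {1..n}" "j \<in> {1..n}" for i j
    using w(1)[OF that(1)] w(1)[OF that(2)] by measurable
  have sq: "(\<Sum>i=1..n. w i D * noise (D i))\<^sup>2 = (\<Sum>i=1..n. \<Sum>j=1..n. w i D * w j D * (noise (D i) * noise (D j)))" for D
    unfolding power2_eq_square sum_product by (intro sum.cong HOL.refl) (simp add: mult_ac)
  have int: "integrable (sample n) (\<lambda>D. w i D * w j D * (noise (D i) * noise (D j)))" if "i \<in> {1..n}" "j \<in> {1..n}" for i j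
    using that by (intro integrable_weighted_noise wm w1) auto
  have int2: "integrable (sample n) (\<lambda>D. w i D * w i D)" if "i \<in> {1..n}" for i
    by (rule finite_measure.integrable_const_bound[OF prob_space.finite_measure[OF prob], where B=1])
      (rule AE_I2, simp only: real_norm_def w1, rule wm[OF that that])
  have "(\<integral>\<^sup>+D. ennreal ((\<Sum>i=1..n. w i D * noise (D i))\<^sup>2) \<partial>sample n) =
      ennreal (\<integral>D. (\<Sum>i=1..n. \<Sum>j=1..n. w i D * w j D * (noise (D i) * noise (D j))) \<partial>sample n)"
    unfolding sq
  proof (rule nn_integral_eq_integral)
    show "integrable (sample n) (\<lambda>D. \<Sum>i=1..n. \<Sum>j=1..n. w i D * w j D * (noise (D i) * noise (D j)))"
      by (intro Bochner_Integration.integrable_sum int)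
    show "AE D in sample n. 0 \<le> (\<Sum>i=1..n. \<Sum>j=1..n. w i D * w j D * (noise (D i) * noise (D j)))"
      by (rule AE_I2) (simp only: sq[symmetric] zero_le_power2)
  qed
  also have "(\<integral>D. (\<Sum>i=1..n. \<Sum>j=1..n. w i D * w j D * (noise (D i) * noise (D j))) \<partial>sample n) =
      (\<Sum>i=1..n. \<Sum>j=1..n. \<integral>D. w i D * w j D * (noise (D i) * noise (D j)) \<partial>sample n)"
    by (subst Bochner_Integration.integral_sum, intro Bochner_Integration.integrable_sum int, assumption, assumption,
        intro sum.cong HOL.refl Bochner_Integration.integral_sum int)
  also have "\<dots> = (\<Sum>i=1..n. \<Sum>j=1..n. if j = i then \<sigma>\<^sup>2 * (\<integral>D. w i D * w i D \<partial>sample n) else 0)"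
  proof (intro sum.cong HOL.refl)
    fix i j assume ij: "i \<in> {1..n}" "j \<in> {1..n}"
    have dep': "w i D * w j D = w i D' * w j D'" if "\<And>k. fst (D k) = fst (D' k)" for D D' :: "nat \<Rightarrow> 'a \<times> real"
      unfolding dep[of D D' i, OF that] dep[of D D' j, OF that] ..
    show "(\<integral>D. w i D * w j D * (noise (D i) * noise (D j)) \<partial>sample n) =
        (if j = i then \<sigma>\<^sup>2 * (\<integral>D. w i D * w i D \<partial>sample n) else 0)"
    proof (cases "j = i")
      case True
      have i: "i \<in> {0..n}" using ij(1) by simp
      have "(\<integral>D. w i D * w i D * (noise (D i) * noise (D i)) \<partial>sample n) = \<sigma>\<^sup>2 * (\<integral>D. w i D * w i D \<partial>sample n)"
        by (rule square_noise[OF i wm[OF ij(1) ij(1)] w1]) (rule dep'[unfolded True])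
      then show ?thesis using True by simp
    next
      case False
      have i: "i \<in> {0..n}" "j \<in> {0..n}" using ij by simp_all
      have "(\<integral>D. w i D * w j D * (noise (D i) * noise (D j)) \<partial>sample n) = 0"
        by (rule cross_noise[OF i False[symmetric] wm[OF ij] w1]) (rule dep')
      then show ?thesis using False by simp
    qed
  qed
  also have "\<dots> = \<sigma>\<^sup>2 * (\<integral>D. (\<Sum>i=1..n. (w i D)\<^sup>2) \<partial>sample n)"
    using int2 by (simp add: sum_distrib_left power2_eq_square Bochner_Integration.integral_sum)
  also have "ennreal \<dots> = ennreal (\<sigma>\<^sup>2) * ennreal (\<integral>D. (\<Sum>i=1..n. (w i D)\<^sup>2) \<partial>sample n)"
    by (intro ennreal_mult' ) simp
  also have "ennreal (\<integral>D. (\<Sum>i=1..n. (w i D)\<^sup>2) \<partial>sample n) = (\<integral>\<^sup>+D. ennreal (\<Sum>i=1..n. (w i D)\<^sup>2) \<partial>sample n)"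
    using int2 by (intro nn_integral_eq_integral[symmetric])
      (auto intro!: Bochner_Integration.integrable_sum sum_nonneg simp: power2_eq_square)
  finally show ?thesis .
qed

text \<open>Exchangeability turns the expected reciprocal cell size at one point into the number of occupied cells.\<close>

lemma expected_inverse_cell_size:
  assumes A: "Measurable.pred (borel \<Otimes>\<^sub>M borel) (\<lambda>p. A (fst p) (snd p))"
    and bound: "AE D in sample n. ennreal (\<Sum>i=0..n. 1 / real (card {j \<in> {0..n}. A (fst (D i)) (fst (D j))})) \<le> c"
  shows "ennreal (real (Suc n)) * (\<integral>\<^sup>+D. ennreal (1 / real (card {j \<in> {0..n}. A (fst (D 0)) (fst (D j))})) \<partial>sample n) \<le> c"
proof -
  let ?h = "\<lambda>i D. ennreal (1 / real (card {j \<in> {0..n}. A (fst (D i)) (fst (D j))}))"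
  have fst_m: "fst \<in> measurable \<nu> borel"
    by (simp add: measurable_cong_sets[OF sets_\<nu> refl] borel_prod[symmetric])
  have card_sum: "real (card {j \<in> {0..n}. A (fst (D i)) (fst (D j))}) = (\<Sum>j=0..n. of_bool (A (fst (D i)) (fst (D j))))"
    for i and D :: "nat \<Rightarrow> 'a \<times> real"
    by (simp add: of_bool_def sum.If_cases Int_def)
  have A': "Measurable.pred (sample n) (\<lambda>D. A (fst (D i)) (fst (D j)))" if "i \<in> {0..n}" "j \<in> {0..n}" for i j
  proof -
    have "(\<lambda>D. (fst (D i), fst (D j))) \<in> measurable (sample n) (borel \<Otimes>\<^sub>M borel)"
      using that by (intro measurable_Pair measurable_compose[OF _ fst_m] measurable_component_singleton)
    from measurable_compose[OF this A] show ?thesis by simp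
  qed
  have m: "?h i \<in> borel_measurable (sample n)" if "i \<in> {0..n}" for i
    unfolding card_sum using A'[OF that] by measurable
  have swap: "(\<integral>\<^sup>+D. ?h i D \<partial>sample n) = (\<integral>\<^sup>+D. ?h 0 D \<partial>sample n)" if i: "i \<in> {0..n}" for i
  proof -
    \<comment> \<open>Swapping the evaluation point with sample point \<open>i\<close> preserves the
      law of the i.i.d. family and carries the class of 0 to the class of \<open>i\<close>.\<close>
    let ?\<pi> = "Transposition.transpose 0 i"
    let ?t = "\<lambda>D. \<lambda>k\<in>{0..n}. D (?\<pi> k) :: 'a \<times> real"
    have \<pi>: "?\<pi> k \<in> {0..n}" if "k \<in> {0..n}" for k using i that by (simp add: Transposition.transpose_def)
    have bij: "bij_betw ?\<pi> {j \<in> {0..n}. A (fst (D i)) (fst (D (?\<pi> j)))} {j \<in> {0..n}. A (fst (D i)) (fst (D j))}" for D :: "nat \<Rightarrow> 'a \<times> real"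
    proof (rule bij_betw_byWitness[where f'="?\<pi>"])
      show "?\<pi> ` {j \<in> {0..n}. A (fst (D i)) (fst (D (?\<pi> j)))} \<subseteq> {j \<in> {0..n}. A (fst (D i)) (fst (D j))}"
        using \<pi> by blast
      show "?\<pi> ` {j \<in> {0..n}. A (fst (D i)) (fst (D j))} \<subseteq> {j \<in> {0..n}. A (fst (D i)) (fst (D (?\<pi> j)))}"
      proof (rule image_subsetI)
        fix j assume "j \<in> {j \<in> {0..n}. A (fst (D i)) (fst (D j))}"
        then show "?\<pi> j \<in> {j \<in> {0..n}. A (fst (D i)) (fst (D (?\<pi> j)))}" using \<pi>[of j] by simp
      qed
    qed simp_all
    have distr: "distr (sample n) (sample n) ?t = sample n"
      by (rule distr_PiM_reindex[of "{0..n}" "\<lambda>_. \<nu>" ?\<pi> "{0..n}", OF prob_space_axioms])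
        (use \<pi> in \<open>auto intro: inj_on_subset[OF inj_transpose]\<close>)
    have t_m: "?t \<in> measurable (sample n) (sample n)"
      using \<pi> by (intro measurable_restrict measurable_component_singleton)
    have "(\<integral>\<^sup>+D. ?h 0 D \<partial>sample n) = (\<integral>\<^sup>+D. ?h 0 D \<partial>distr (sample n) (sample n) ?t)" by (simp only: distr)
    also have "\<dots> = (\<integral>\<^sup>+D. ?h 0 (?t D) \<partial>sample n)"
      by (rule nn_integral_distr[OF t_m]) (simp only: measurable_distr_eq1, rule m, simp)
    also have "\<dots> = (\<integral>\<^sup>+D. ?h i D \<partial>sample n)"
    proof (rule nn_integral_cong)
      fix D :: "nat \<Rightarrow> 'a \<times> real"
      have "{j \<in> {0..n}. A (fst (?t D 0)) (fst (?t D j))} = {j \<in> {0..n}. A (fst (D i)) (fst (D (?\<pi> j)))}"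
        by auto
      then show "?h 0 (?t D) = ?h i D" using bij_betw_same_card[OF bij[of D]] by simp
    qed
    finally show ?thesis by simp
  qed
  have "ennreal (real (Suc n)) * (\<integral>\<^sup>+D. ?h 0 D \<partial>sample n) = (\<Sum>i=0..n. \<integral>\<^sup>+D. ?h i D \<partial>sample n)"
  proof -
    have "(\<Sum>i=0..n. \<integral>\<^sup>+D. ?h i D \<partial>sample n) = (\<Sum>i=0..n. \<integral>\<^sup>+D. ?h 0 D \<partial>sample n)"
      by (rule sum.cong[OF HOL.refl swap])
    also have "\<dots> = of_nat (card {0..n}) * (\<integral>\<^sup>+D. ?h 0 D \<partial>sample n)" by (rule sum_constant)
    finally show ?thesis by (simp only: ennreal_of_nat_eq_real_of_nat card_atLeastAtMost diff_zero)
  qed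
  also have "\<dots> = (\<integral>\<^sup>+D. (\<Sum>i=0..n. ?h i D) \<partial>sample n)"
    by (rule nn_integral_sum[symmetric, OF m])
  also have "\<dots> \<le> (\<integral>\<^sup>+D. c \<partial>sample n)"
  proof (rule nn_integral_mono_AE, rule AE_mp[OF bound], rule AE_I2, rule impI)
    fix D :: "nat \<Rightarrow> 'a \<times> real"
    have "(\<Sum>i=0..n. ?h i D) = ennreal (\<Sum>i=0..n. 1 / real (card {j \<in> {0..n}. A (fst (D i)) (fst (D j))}))"
      by (rule sum_ennreal) simp
    moreover assume "ennreal (\<Sum>i=0..n. 1 / real (card {j \<in> {0..n}. A (fst (D i)) (fst (D j))})) \<le> c"
    ultimately show "(\<Sum>i=0..n. ?h i D) \<le> c" by (simp only:)
  qed
  also have "\<dots> = c" using prob_space.emeasure_space_1[OF prob_space_sample] by simp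
  finally show ?thesis .
qed

text \<open>With no sample point in the cell the estimate is 0, and the bound \<open>L\<close> on
  \<open>f\<close> gives the first term, whose last factor is then 1. Otherwise the weights sum to
  1, the bias is a convex combination of differences of \<open>f\<close> within the cell, and (b +
  e)^2 <= 2 b^2 + 2 e^2 separates it from the noise.\<close>

lemma local_mean_error:
  assumes x: "\<And>i. i \<in> {1..n} \<Longrightarrow> A (fst (D 0)) (fst (D i)) \<Longrightarrow> ennreal ((f (fst (D i)) - f (fst (D 0)))\<^sup>2) \<le> r"
  shows "ennreal ((local_mean A n D - f (fst (D 0)))\<^sup>2) \<le>
     ennreal (L\<^sup>2 * (1 / (hits A n D + 1))) + 2 * r + 2 * ennreal ((\<Sum>i=1..n. weight A n i D * noise (D i))\<^sup>2)"
proof (cases "hits A n D = 0")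
  case True
  have "weight A n i D = 0" for i using True by (simp add: weight_def)
  then have "local_mean A n D = 0" by (simp add: local_mean_def)
  moreover have "(f (fst (D 0)))\<^sup>2 \<le> L\<^sup>2" using f_bounded by (rule abs_le_square_iff[THEN iffD1, OF order_trans]) simp
  ultimately have "ennreal ((local_mean A n D - f (fst (D 0)))\<^sup>2) \<le> ennreal (L\<^sup>2 * (1 / (hits A n D + 1)))"
    using True by (simp add: ennreal_leI)
  then show ?thesis by (simp add: add.assoc add_increasing2)
next
  case False
  let ?w = "\<lambda>i. weight A n i D" and ?x = "f (fst (D 0))"
  let ?b = "\<Sum>i=1..n. ?w i * (f (fst (D i)) - ?x)" and ?e = "\<Sum>i=1..n. ?w i * noise (D i)"
  have sw: "(\<Sum>i=1..n. ?w i) = 1" unfolding sum_weight using False by simp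
  then have "?x = (\<Sum>i=1..n. ?w i) * ?x" by (simp only: mult_1)
  then have "local_mean A n D - ?x = (\<Sum>i=1..n. ?w i * snd (D i)) - (\<Sum>i=1..n. ?w i * ?x)"
    by (simp only: local_mean_def sum_distrib_right)
  also have "\<dots> = ?b + ?e"
    unfolding sum_subtractf[symmetric] sum.distrib[symmetric]
    by (intro sum.cong HOL.refl) (simp add: noise_def algebra_simps)
  finally have split: "local_mean A n D - ?x = ?b + ?e" .
  have "ennreal (?b\<^sup>2) \<le> r"
  proof (cases r)
    case (real s)
    have "\<bar>?w i * (f (fst (D i)) - ?x)\<bar> \<le> ?w i * sqrt s" if "i \<in> {1..n}" for i
    proof (cases "A (fst (D 0)) (fst (D i))")
      case True
      then have "(f (fst (D i)) - ?x)\<^sup>2 \<le> s" using x[OF that True] real by simp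
      then have "\<bar>f (fst (D i)) - ?x\<bar> \<le> sqrt s" by (simp add: real_le_rsqrt)
      then show ?thesis using weight_bounds(1)[of A n i D] by (simp add: abs_mult mult_left_mono)
    qed (simp add: weight_def)
    then have "\<bar>?b\<bar> \<le> (\<Sum>i=1..n. ?w i * sqrt s)" by (intro order_trans[OF sum_abs sum_mono])
    also have "\<dots> = sqrt s" by (simp only: sum_distrib_right[symmetric] sw mult_1)
    finally have "?b\<^sup>2 \<le> (sqrt s)\<^sup>2" using real by (intro abs_le_square_iff[THEN iffD1]) simp
    then show ?thesis using real by (simp add: ennreal_leI)
  qed simp
  moreover have "(?b + ?e)\<^sup>2 \<le> 2 * ?b\<^sup>2 + 2 * ?e\<^sup>2"
    using sum_squares_bound[of ?b ?e] by (simp add: power2_sum)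
  ultimately have "ennreal ((?b + ?e)\<^sup>2) \<le> 2 * r + 2 * ennreal (?e\<^sup>2)"
  proof -
    assume 1: "ennreal (?b\<^sup>2) \<le> r" and 2: "(?b + ?e)\<^sup>2 \<le> 2 * ?b\<^sup>2 + 2 * ?e\<^sup>2"
    have "ennreal ((?b + ?e)\<^sup>2) \<le> ennreal (2 * ?b\<^sup>2 + 2 * ?e\<^sup>2)" by (rule ennreal_leI[OF 2])
    also have "\<dots> = 2 * ennreal (?b\<^sup>2) + 2 * ennreal (?e\<^sup>2)" by (simp add: ennreal_plus ennreal_mult')
    also have "\<dots> \<le> 2 * r + 2 * ennreal (?e\<^sup>2)" by (intro add_right_mono mult_left_mono 1) simp
    finally show ?thesis .
  qed
  then show ?thesis unfolding split by (simp add: add.assoc add_increasing)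
qed

text \<open>In the constant, \<open>L\<close> squared comes from empty cells; in 4 times the
  variance, one factor 2 comes from splitting the square and the other from 1/N <= 2/(N +
  1).\<close>

lemma local_mean_risk:
  assumes A: "Measurable.pred (borel \<Otimes>\<^sub>M borel) (\<lambda>p. A (fst p) (snd p))"
    and B: "B \<in> borel_measurable borel"
    and refl: "AE D in sample n. A (fst (D 0)) (fst (D 0))"
    and holder: "AE D in sample n. \<forall>i\<in>{1..n}. A (fst (D 0)) (fst (D i)) \<longrightarrow> ennreal ((f (fst (D i)) - f (fst (D 0)))\<^sup>2) \<le> B (fst (D 0))"
    and bound: "AE D in sample n. ennreal (\<Sum>i=0..n. 1 / real (card {j \<in> {0..n}. A (fst (D i)) (fst (D j))})) \<le> c"
  shows "(\<integral>\<^sup>+D. ennreal ((local_mean A n D - f (fst (D 0)))\<^sup>2) \<partial>sample n) \<le>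
     2 * (\<integral>\<^sup>+p. B (fst p) \<partial>\<nu>) + ennreal ((L\<^sup>2 + 4 * \<sigma>\<^sup>2) / real (Suc n)) * c"
proof -
  have fst_m: "fst \<in> measurable \<nu> borel"
    by (simp add: measurable_cong_sets[OF sets_\<nu> HOL.refl] borel_prod[symmetric])
  have A': "Measurable.pred (sample n) (\<lambda>D. A (fst (D i)) (fst (D j)))" if "i \<in> {0..n}" "j \<in> {0..n}" for i j
  proof -
    have "(\<lambda>D. (fst (D i), fst (D j))) \<in> measurable (sample n) (borel \<Otimes>\<^sub>M borel)"
      using that by (intro measurable_Pair measurable_compose[OF _ fst_m] measurable_component_singleton)
    from measurable_compose[OF this A] show ?thesis by simp
  qed
  have ob: "(\<lambda>D. of_bool (A (fst (D i)) (fst (D j))) :: real) \<in> borel_measurable (sample n)" if "i \<in> {0..n}" "j \<in> {0..n}" for i j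
    using A'[OF that] unfolding of_bool_def by measurable
  have hits_m: "(\<lambda>D. hits A n D) \<in> borel_measurable (sample n)"
    unfolding hits_def by (intro borel_measurable_sum ob) auto
  have weight_m: "weight A n i \<in> borel_measurable (sample n)" if "i \<in> {1..n}" for i
    unfolding weight_def[abs_def] using that by (intro borel_measurable_divide ob hits_m) auto
  have noise_m: "(\<lambda>D. noise (D i)) \<in> borel_measurable (sample n)" if "i \<in> {1..n}" for i
    using that by (intro measurable_compose[OF measurable_component_singleton]) (auto simp: measurable_cong_sets[OF sets_\<nu> HOL.refl])
  have B_m: "(\<lambda>D. B (fst (D 0))) \<in> borel_measurable (sample n)"
    by (intro measurable_compose[OF _ B] measurable_compose[OF _ fst_m] measurable_component_singleton) simp
  have noise_sum_m: "(\<lambda>D. \<Sum>i=1..n. weight A n i D * noise (D i)) \<in> borel_measurable (sample n)"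
    by (intro borel_measurable_sum borel_measurable_times weight_m noise_m)
  have inv_m: "(\<lambda>D. ennreal (1 / (hits A n D + 1))) \<in> borel_measurable (sample n)"
    using hits_m by measurable
  let ?c = "\<integral>\<^sup>+D. ennreal (1 / (hits A n D + 1)) \<partial>sample n"
  have c: "ennreal (real (Suc n)) * ?c \<le> c"
  proof -
    \<comment> \<open>Reflexivity puts index 0 into its own class, so that the class among 0, ..., n
      has \<open>hits A n D + 1\<close> members.\<close>
    have "?c = (\<integral>\<^sup>+D. ennreal (1 / real (card {j \<in> {0..n}. A (fst (D 0)) (fst (D j))})) \<partial>sample n)"
    proof (rule nn_integral_cong_AE, rule AE_mp[OF refl], rule AE_I2, rule impI)
      fix D :: "nat \<Rightarrow> 'a \<times> real" assume "A (fst (D 0)) (fst (D 0))"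
      then have "{j \<in> {0..n}. A (fst (D 0)) (fst (D j))} = insert 0 {j \<in> {1..n}. A (fst (D 0)) (fst (D j))}"
        by (auto simp: Suc_le_eq)
      then have "real (card {j \<in> {0..n}. A (fst (D 0)) (fst (D j))}) = hits A n D + 1"
        unfolding hits_eq_card by (simp only:) (subst card_insert_disjoint, auto)
      then show "ennreal (1 / (hits A n D + 1)) = ennreal (1 / real (card {j \<in> {0..n}. A (fst (D 0)) (fst (D j))}))" by simp
    qed
    then show ?thesis using expected_inverse_cell_size[OF A bound] by simp
  qed
  have c': "?c \<le> ennreal (1 / real (Suc n)) * c"
  proof -
    have "?c = ennreal (1 / real (Suc n)) * (ennreal (real (Suc n)) * ?c)"
      by (simp add: mult.assoc[symmetric] ennreal_mult'[symmetric] del: of_nat_Suc)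
    also have "\<dots> \<le> ennreal (1 / real (Suc n)) * c" by (intro mult_left_mono c) simp
    finally show ?thesis .
  qed
  have "(\<integral>\<^sup>+D. ennreal ((\<Sum>i=1..n. weight A n i D * noise (D i))\<^sup>2) \<partial>sample n) =
     (\<integral>\<^sup>+D. ennreal ((\<Sum>i=1..n. (if i \<in> {1..n} then weight A n i D else 0) * noise (D i))\<^sup>2) \<partial>sample n)"
    by simp
  also have "\<dots> = ennreal (\<sigma>\<^sup>2) * (\<integral>\<^sup>+D. ennreal (\<Sum>i=1..n. (if i \<in> {1..n} then weight A n i D else 0)\<^sup>2) \<partial>sample n)"
  proof (rule weighted_noise_sum)
    fix i D
    show "\<bar>if i \<in> {1..n} then weight A n i D else 0\<bar> \<le> 1"
      using weight_bounds(1)[of A n i D] weight_bounds(2)[where A=A and n=n and i=i and D=D] by (auto simp only: abs_of_nonneg abs_zero zero_le_one split: if_split)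
  next
    fix i assume "i \<in> {1..n}"
    then show "(\<lambda>D. if i \<in> {1..n} then weight A n i D else 0) \<in> borel_measurable (sample n)"
      using weight_m[of i] by (simp only: if_True)
  next
    fix i and D D' :: "nat \<Rightarrow> 'a \<times> real" assume "\<And>k. fst (D k) = fst (D' k)"
    then show "(if i \<in> {1..n} then weight A n i D else 0) = (if i \<in> {1..n} then weight A n i D' else 0)"
      by (simp only: weight_def hits_def)
  qed
  also have "\<dots> \<le> ennreal (\<sigma>\<^sup>2) * (\<integral>\<^sup>+D. 2 * ennreal (1 / (hits A n D + 1)) \<partial>sample n)"
  proof (intro mult_left_mono nn_integral_mono)
    fix D
    have "ennreal (\<Sum>i=1..n. (if i \<in> {1..n} then weight A n i D else 0)\<^sup>2) \<le> ennreal (2 * (1 / (hits A n D + 1)))"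
      using sum_weight_square[of A n D] by (intro ennreal_leI) simp
    also have "\<dots> = 2 * ennreal (1 / (hits A n D + 1))" by (subst ennreal_mult') auto
    finally show "ennreal (\<Sum>i=1..n. (if i \<in> {1..n} then weight A n i D else 0)\<^sup>2) \<le> 2 * ennreal (1 / (hits A n D + 1))" .
  qed simp
  also have "\<dots> = ennreal (\<sigma>\<^sup>2) * (2 * ?c)" by (simp only: nn_integral_cmult[OF inv_m])
  finally have noise: "(\<integral>\<^sup>+D. ennreal ((\<Sum>i=1..n. weight A n i D * noise (D i))\<^sup>2) \<partial>sample n) \<le> ennreal (\<sigma>\<^sup>2) * (2 * ?c)" .
  have B_int: "(\<integral>\<^sup>+D. B (fst (D 0)) \<partial>sample n) = (\<integral>\<^sup>+p. B (fst p) \<partial>\<nu>)"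
  proof -
    have "(\<integral>\<^sup>+p. B (fst p) \<partial>distr (sample n) \<nu> (\<lambda>D. D 0)) = (\<integral>\<^sup>+D. B (fst (D 0)) \<partial>sample n)"
      by (rule nn_integral_distr) (auto intro: measurable_compose[OF fst_m B])
    then show ?thesis by (subst (asm) distr_PiM_component[of "{0..n}" "\<lambda>_. \<nu>" 0]) (auto intro: prob_space_axioms)
  qed
  have "(\<integral>\<^sup>+D. ennreal ((local_mean A n D - f (fst (D 0)))\<^sup>2) \<partial>sample n) \<le>
    (\<integral>\<^sup>+D. ennreal (L\<^sup>2 * (1 / (hits A n D + 1))) + 2 * B (fst (D 0)) + 2 * ennreal ((\<Sum>i=1..n. weight A n i D * noise (D i))\<^sup>2) \<partial>sample n)"
    by (rule nn_integral_mono_AE, rule AE_mp[OF holder], rule AE_I2, rule impI, rule local_mean_error) blast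
  also have "\<dots> = (\<integral>\<^sup>+D. ennreal (L\<^sup>2 * (1 / (hits A n D + 1))) \<partial>sample n) + 2 * (\<integral>\<^sup>+D. B (fst (D 0)) \<partial>sample n) +
       2 * (\<integral>\<^sup>+D. ennreal ((\<Sum>i=1..n. weight A n i D * noise (D i))\<^sup>2) \<partial>sample n)"
    using B_m noise_sum_m hits_m by (simp add: nn_integral_add nn_integral_cmult)
  also have "(\<integral>\<^sup>+D. ennreal (L\<^sup>2 * (1 / (hits A n D + 1))) \<partial>sample n) = ennreal (L\<^sup>2) * ?c"
    unfolding nn_integral_cmult[OF inv_m, symmetric] by (intro nn_integral_cong ennreal_mult') simp
  also have "ennreal (L\<^sup>2) * ?c + 2 * (\<integral>\<^sup>+D. B (fst (D 0)) \<partial>sample n) +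
       2 * (\<integral>\<^sup>+D. ennreal ((\<Sum>i=1..n. weight A n i D * noise (D i))\<^sup>2) \<partial>sample n) \<le>
     ennreal (L\<^sup>2) * ?c + 2 * (\<integral>\<^sup>+p. B (fst p) \<partial>\<nu>) + 2 * (ennreal (\<sigma>\<^sup>2) * (2 * ?c))"
    unfolding B_int by (intro add_left_mono mult_left_mono noise) simp
  also have "\<dots> = 2 * (\<integral>\<^sup>+p. B (fst p) \<partial>\<nu>) + ennreal (L\<^sup>2 + 4 * \<sigma>\<^sup>2) * ?c"
  proof -
    have "2 * (ennreal (\<sigma>\<^sup>2) * (2 * ?c)) = (2 * 2) * ennreal (\<sigma>\<^sup>2) * ?c" by (simp only: mult_ac)
    also have "(2 * 2) * ennreal (\<sigma>\<^sup>2) = ennreal (4 * \<sigma>\<^sup>2)" by (simp add: ennreal_mult')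
    finally have 1: "2 * (ennreal (\<sigma>\<^sup>2) * (2 * ?c)) = ennreal (4 * \<sigma>\<^sup>2) * ?c" .
    have 2: "ennreal (L\<^sup>2 + 4 * \<sigma>\<^sup>2) = ennreal (L\<^sup>2) + ennreal (4 * \<sigma>\<^sup>2)" by (rule ennreal_plus) simp_all
    show ?thesis unfolding 1 2 by (simp only: distrib_right add_ac)
  qed
  also have "\<dots> \<le> 2 * (\<integral>\<^sup>+p. B (fst p) \<partial>\<nu>) + ennreal (L\<^sup>2 + 4 * \<sigma>\<^sup>2) * (ennreal (1 / real (Suc n)) * c)"
    by (intro add_left_mono mult_left_mono c') simp
  also have "ennreal (L\<^sup>2 + 4 * \<sigma>\<^sup>2) * (ennreal (1 / real (Suc n)) * c) = ennreal ((L\<^sup>2 + 4 * \<sigma>\<^sup>2) / real (Suc n)) * c"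
  proof -
    have "ennreal ((L\<^sup>2 + 4 * \<sigma>\<^sup>2) / real (Suc n)) = ennreal (L\<^sup>2 + 4 * \<sigma>\<^sup>2) * ennreal (1 / real (Suc n))"
      by (subst ennreal_mult'[symmetric]) simp_all
    then show ?thesis by (simp only: mult.assoc)
  qed
  finally show ?thesis .
qed

end

text \<open>A grid of mesh 1/m in an orthonormal basis of \<open>S\<close>: rounding the coordinates
  down moves a point by at most \<open>dim S / m\<close>, and the additional 1 makes the inequality
  strict for open balls. Each coordinate takes 2 N + 1 values, at most
  \<open>(2 * \<bar>\<rho>\<bar> + 5) * m\<close>; the absolute value covers a negative \<rho>,
  possible for empty \<open>W\<close>.\<close>

lemma cover_subspace:
  fixes S W :: "'a::euclidean_space set"
  assumes S: "subspace S" and W: "\<And>x. x \<in> W \<Longrightarrow> norm x \<le> \<rho>" and m: "1 \<le> (m::nat)"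
  shows "\<exists>Z. finite Z \<and> real (card Z) \<le> ((2 * \<bar>\<rho>\<bar> + 5) * real m) ^ dim S \<and>
     (\<forall>x\<in>S \<inter> W. \<exists>z\<in>Z. x \<in> ball z ((real (dim S) + 1) / real m))"
proof -
  obtain B where B: "B \<subseteq> S" "pairwise orthogonal B" "\<And>x. x \<in> B \<Longrightarrow> norm x = 1" "independent B" "card B = dim S" "span B = S"
    using orthonormal_basis_subspace[OF S] by blast
  have fin: "finite B" using B(4) by (rule independent_imp_finite)
  define N where "N = \<lceil>\<bar>\<rho>\<bar> * real m\<rceil> + 1"
  have N: "real_of_int N \<le> \<bar>\<rho>\<bar> * real m + 2" "0 \<le> N"
  proof -
    have "0 \<le> \<bar>\<rho>\<bar> * real m" by simp
    then show "real_of_int N \<le> \<bar>\<rho>\<bar> * real m + 2" "0 \<le> N" unfolding N_def by linarith+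
  qed
  define z where "z k = (\<Sum>b\<in>B. (real_of_int (k b) / real m) *\<^sub>R b)" for k :: "'a \<Rightarrow> int"
  let ?K = "B \<rightarrow>\<^sub>E {- N..N}"
  have finK: "finite ?K" using fin by (intro finite_PiE) auto
  have "card (z ` ?K) \<le> card ?K" by (rule card_image_le[OF finK])
  also have "card ?K = nat (2 * N + 1) ^ card B"
    using fin N(2) by (simp add: card_PiE algebra_simps)
  finally have c: "real (card (z ` ?K)) \<le> real (nat (2 * N + 1)) ^ dim S"
    unfolding B(5) by (metis of_nat_le_iff of_nat_power)
  have "real (nat (2 * N + 1)) \<le> (2 * \<bar>\<rho>\<bar> + 5) * real m"
  proof -
    have "real (nat (2 * N + 1)) = 2 * real_of_int N + 1" using N(2) by simp
    also have "\<dots> \<le> 2 * \<bar>\<rho>\<bar> * real m + 5" using N(1) by simp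
    also have "\<dots> \<le> 2 * \<bar>\<rho>\<bar> * real m + 5 * real m" using m by simp
    finally show ?thesis by (simp add: distrib_right)
  qed
  then have "real (nat (2 * N + 1)) ^ dim S \<le> ((2 * \<bar>\<rho>\<bar> + 5) * real m) ^ dim S"
    by (intro power_mono) auto
  with c have card: "real (card (z ` ?K)) \<le> ((2 * \<bar>\<rho>\<bar> + 5) * real m) ^ dim S" by linarith
  have cover: "\<exists>y\<in>z ` ?K. x \<in> ball y ((real (dim S) + 1) / real m)" if x: "x \<in> S \<inter> W" for x
  proof -
    define k where "k = (\<lambda>b\<in>B. \<lfloor>real m * (x \<bullet> b)\<rfloor>)"
    have "k b \<in> {- N..N}" if b: "b \<in> B" for b
    proof -
      have "\<bar>x \<bullet> b\<bar> \<le> norm x * norm b" by (rule Cauchy_Schwarz_ineq2)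
      also have "\<dots> \<le> \<bar>\<rho>\<bar>" using W[of x] x B(3)[OF b] by simp
      finally have "real m * \<bar>x \<bullet> b\<bar> \<le> real m * \<bar>\<rho>\<bar>" by (intro mult_left_mono) auto
      then have "\<bar>real m * (x \<bullet> b)\<bar> \<le> \<bar>\<rho>\<bar> * real m" by (simp add: abs_mult mult.commute)
      then show ?thesis using b unfolding k_def N_def by simp linarith
    qed
    then have k: "k \<in> ?K" by (auto simp: k_def)
    have "x = (\<Sum>b\<in>B. (x \<bullet> b) *\<^sub>R b)"
    proof -
      have "x \<in> span B" using x B(6) by blast
      then obtain u where u: "x = (\<Sum>b\<in>B. u b *\<^sub>R b)" using span_finite[OF fin] by auto
      have "x \<bullet> b = u b" if b: "b \<in> B" for b
      proof -
        have "x \<bullet> b = (\<Sum>b'\<in>B. u b' * (b' \<bullet> b))" unfolding u by (simp add: inner_sum_left)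
        also have "\<dots> = (\<Sum>b'\<in>B. if b' = b then u b else 0)"
        proof (rule sum.cong[OF refl])
          fix b' assume b': "b' \<in> B"
          show "u b' * (b' \<bullet> b) = (if b' = b then u b else 0)"
          proof (cases "b' = b")
            case True
            then show ?thesis using B(3)[OF b] by (simp add: dot_square_norm)
          next
            case False
            then have "b' \<bullet> b = 0" using B(2) b b' unfolding pairwise_def orthogonal_def by blast
            then show ?thesis using False by simp
          qed
        qed
        also have "\<dots> = u b" using fin b by simp
        finally show ?thesis .
      qed
      then have "(\<Sum>b\<in>B. (x \<bullet> b) *\<^sub>R b) = (\<Sum>b\<in>B. u b *\<^sub>R b)" by (intro sum.cong) auto
      then show ?thesis using u by simp
    qed
    then have "x - z k = (\<Sum>b\<in>B. (x \<bullet> b - real_of_int (k b) / real m) *\<^sub>R b)"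
      unfolding z_def by (simp add: sum_subtractf scaleR_diff_left)
    also have "norm \<dots> \<le> (\<Sum>b\<in>B. norm ((x \<bullet> b - real_of_int (k b) / real m) *\<^sub>R b))" by (rule norm_sum)
    also have "\<dots> \<le> (\<Sum>b\<in>B. 1 / real m)"
    proof (rule sum_mono)
      fix b assume b: "b \<in> B"
      have "\<bar>real m * (x \<bullet> b) - real_of_int (k b)\<bar> \<le> 1" using b unfolding k_def by simp linarith
      moreover have "x \<bullet> b - real_of_int (k b) / real m = (real m * (x \<bullet> b) - real_of_int (k b)) / real m"
        using m by (simp add: diff_divide_distrib)
      ultimately show "norm ((x \<bullet> b - real_of_int (k b) / real m) *\<^sub>R b) \<le> 1 / real m"
        using B(3)[OF b] m by (simp add: divide_right_mono)
    qed
    also have "\<dots> < (real (dim S) + 1) / real m" using m by (simp add: B(5) divide_strict_right_mono)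
    finally have "x \<in> ball (z k) ((real (dim S) + 1) / real m)" by (simp add: dist_norm norm_minus_commute)
    then show ?thesis using k by blast
  qed
  show ?thesis using card cover finK by blast
qed

text \<open>By second countability the complement of the support is a countable union of open null
  sets.\<close>

lemma AE_in_measure_support:
  fixes \<mu> :: "'a::second_countable_topology measure"
  assumes "sets \<mu> = sets borel"
  shows "AE x in \<mu>. x \<in> measure_support \<mu>"
proof -
  have sp: "space \<mu> = UNIV" using sets_eq_imp_space_eq[OF assms] by simp
  let ?F = "{U. open U \<and> emeasure \<mu> U = 0}"
  obtain G where G: "G \<subseteq> ?F" "countable G" "\<Union>G = \<Union>?F"
    using Lindelof[of ?F] by blast
  have compl: "- measure_support \<mu> = \<Union>?F"
    unfolding measure_support_def sp by (auto simp: not_gr_zero)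
  have "U \<in> null_sets \<mu>" if "U \<in> G" for U
    using that G(1) by (auto simp: null_sets_def assms)
  then have "\<Union>G \<in> null_sets \<mu>"
    using null_sets_UN'[OF G(2), of "\<lambda>x. x" \<mu>] by simp
  then show ?thesis
    by (rule AE_I') (use compl G(3) sp in auto)
qed

lemma measurable_sep_count_boundary:
  assumes "countable A"
  shows "(\<lambda>T. sep_count A (boundary_union T)) \<in> borel_measurable tessellation_space"
  by (rule measurable_compose[OF measurable_boundary_union measurable_sep_count[OF assms]])

lemma measurable_local_mean:
  fixes Dat :: "'m \<Rightarrow> nat \<Rightarrow> 'a::euclidean_space \<times> real"
  assumes D: "\<And>i. i \<in> {0..n} \<Longrightarrow> (\<lambda>\<omega>. Dat \<omega> i) \<in> borel_measurable M" and T: "T \<in> measurable M tessellation_space"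
  shows "(\<lambda>\<omega>. local_mean (linked (T \<omega>)) n (Dat \<omega>)) \<in> borel_measurable M"
proof -
  have x: "(\<lambda>\<omega>. fst (Dat \<omega> i)) \<in> borel_measurable M" and y: "(\<lambda>\<omega>. snd (Dat \<omega> i)) \<in> borel_measurable M" if "i \<in> {0..n}" for i
  proof -
    have "fst \<in> borel_measurable (borel :: ('a \<times> real) measure)" "snd \<in> borel_measurable (borel :: ('a \<times> real) measure)"
      by (simp_all add: borel_prod[symmetric])
    from measurable_compose[OF D[OF that] this(1)] measurable_compose[OF D[OF that] this(2)]
    show "(\<lambda>\<omega>. fst (Dat \<omega> i)) \<in> borel_measurable M" "(\<lambda>\<omega>. snd (Dat \<omega> i)) \<in> borel_measurable M" .
  qed
  have l: "(\<lambda>\<omega>. of_bool (linked (T \<omega>) (fst (Dat \<omega> 0)) (fst (Dat \<omega> i))) :: real) \<in> borel_measurable M" if "i \<in> {1..n}" for i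
  proof -
    have i: "0 \<in> {0..n}" "i \<in> {0..n}" using that by simp_all
    note [measurable] = measurable_linked[OF x[OF i(1)] x[OF i(2)] T]
    show ?thesis unfolding of_bool_def by measurable
  qed
  show ?thesis
    unfolding local_mean_def weight_def hits_def
    by (intro borel_measurable_sum borel_measurable_times borel_measurable_divide l y) auto
qed

text \<open>For a frozen tessellation \<open>local_mean_risk\<close> applies. Integrating over the
  law of the tessellation and exchanging the order in the bias term leaves, at each fixed point, an
  expectation over the tessellation alone. The set \<open>G\<close> carries the design, and
  \<open>point\<close> gathers deterministic facts about samples off the boundary.\<close>

lemma (in regression_law) random_tessellation_risk:
  assumes \<T>: "prob_space \<T>" "sets \<T> = sets tessellation_space"
    and B: "(\<lambda>z. B (fst z) (snd z)) \<in> borel_measurable (borel \<Otimes>\<^sub>M tessellation_space)"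
    and c: "c \<in> borel_measurable tessellation_space"
    and boundary: "AE T in \<T>. AE p in \<nu>. fst p \<notin> boundary_union T"
    and point: "\<And>(D :: nat \<Rightarrow> 'a \<times> real) T. (\<And>i. i \<in> {0..n} \<Longrightarrow> fst (D i) \<in> G \<and> fst (D i) \<notin> boundary_union T) \<Longrightarrow> tessellation T \<Longrightarrow>
       (\<forall>i\<in>{1..n}. linked T (fst (D 0)) (fst (D i)) \<longrightarrow> ennreal ((f (fst (D i)) - f (fst (D 0)))\<^sup>2) \<le> B (fst (D 0)) T) \<and>
       ennreal (\<Sum>i=0..n. 1 / real (card {j \<in> {0..n}. linked T (fst (D i)) (fst (D j))})) \<le> c T"
    and G: "AE p in \<nu>. fst p \<in> G"
  shows "(\<integral>\<^sup>+z. ennreal ((local_mean (linked (snd z)) n (fst z) - f (fst (fst z 0)))\<^sup>2) \<partial>(sample n \<Otimes>\<^sub>M \<T>)) \<le>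
     2 * (\<integral>\<^sup>+p. \<integral>\<^sup>+T. B (fst p) T \<partial>\<T> \<partial>\<nu>) + ennreal ((L\<^sup>2 + 4 * \<sigma>\<^sup>2) / real (Suc n)) * (\<integral>\<^sup>+T. c T \<partial>\<T>)"
proof -
  interpret T: prob_space \<T> by fact
  interpret S: prob_space "sample n" by (rule prob_space_sample)
  interpret ST: pair_prob_space "sample n" \<T> ..
  interpret \<nu>T: pair_prob_space \<nu> \<T> ..
  have sp: "space \<T> = {T. tessellation T}" using sets_eq_imp_space_eq[OF \<T>(2)] by (simp add: space_tessellation_space)
  have id: "(\<lambda>T. T) \<in> measurable \<T> tessellation_space" using \<T>(2) by (rule measurable_ident_sets)
  have fst_m: "fst \<in> measurable \<nu> borel"
    by (simp add: measurable_cong_sets[OF sets_\<nu> HOL.refl] borel_prod[symmetric])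
  have comp: "(\<lambda>z. fst z i) \<in> borel_measurable (sample n \<Otimes>\<^sub>M \<T>)" if "i \<in> {0..n}" for i
    using measurable_compose[OF measurable_fst measurable_component_singleton[OF that, of "\<lambda>_. \<nu>"], of \<T>]
    by (simp only: measurable_cong_sets[OF HOL.refl sets_\<nu>])
  have T_m: "snd \<in> measurable (sample n \<Otimes>\<^sub>M \<T>) tessellation_space"
    by (rule measurable_compose[OF measurable_snd id])
  have lm: "(\<lambda>z. local_mean (linked (snd z)) n (fst z)) \<in> borel_measurable (sample n \<Otimes>\<^sub>M \<T>)"
    by (rule measurable_local_mean[OF comp T_m])
  have f_m: "(\<lambda>z. f (fst (fst z 0))) \<in> borel_measurable (sample n \<Otimes>\<^sub>M \<T>)"
  proof -
    have "fst \<in> borel_measurable (borel :: ('a \<times> real) measure)" by (simp add: borel_prod[symmetric])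
    from measurable_compose[OF measurable_compose[OF comp[of 0] this] f_measurable] show ?thesis by simp
  qed
  have B_m: "(\<lambda>z. B (fst (fst z)) (snd z)) \<in> borel_measurable (\<nu> \<Otimes>\<^sub>M \<T>)"
  proof -
    have "(\<lambda>z. (fst (fst z), snd z)) \<in> measurable (\<nu> \<Otimes>\<^sub>M \<T>) (borel \<Otimes>\<^sub>M tessellation_space)"
      by (intro measurable_Pair measurable_compose[OF measurable_fst fst_m] measurable_compose[OF measurable_snd id])
    from measurable_compose[OF this B] show ?thesis by simp
  qed
  have c_m: "c \<in> borel_measurable \<T>" using c by (simp only: measurable_cong_sets[OF \<T>(2) HOL.refl])
  have "(\<integral>\<^sup>+z. ennreal ((local_mean (linked (snd z)) n (fst z) - f (fst (fst z 0)))\<^sup>2) \<partial>(sample n \<Otimes>\<^sub>M \<T>)) =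
    (\<integral>\<^sup>+T. \<integral>\<^sup>+D. ennreal ((local_mean (linked T) n D - f (fst (D 0)))\<^sup>2) \<partial>sample n \<partial>\<T>)"
    using lm f_m by (subst ST.nn_integral_snd[symmetric]) simp_all
  also have "\<dots> \<le> (\<integral>\<^sup>+T. 2 * (\<integral>\<^sup>+p. B (fst p) T \<partial>\<nu>) + ennreal ((L\<^sup>2 + 4 * \<sigma>\<^sup>2) / real (Suc n)) * c T \<partial>\<T>)"
  proof (rule nn_integral_mono_AE, rule AE_mp[OF boundary], rule AE_I2, rule impI)
    fix T assume T: "T \<in> space \<T>" and bd: "AE p in \<nu>. fst p \<notin> boundary_union T"
    have tess: "tessellation T" using T sp by simp
    have good1: "AE D in sample n. fst (D i) \<in> G \<and> fst (D i) \<notin> boundary_union T" if "i \<in> {0..n}" for i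
      using AE_PiM_component[of "{0..n}" "\<lambda>_. \<nu>" i "\<lambda>p. fst p \<in> G \<and> fst p \<notin> boundary_union T", OF prob_space_axioms that] G bd by simp
    have "AE D in sample n. \<forall>i\<in>{0..n}. fst (D i) \<in> G \<and> fst (D i) \<notin> boundary_union T"
      by (rule AE_finite_allI[OF finite_atLeastAtMost good1])
    then have good: "AE D in sample n. \<forall>i\<in>{0..n}. fst (D i) \<in> G \<and> fst (D i) \<notin> boundary_union T" .
    show "(\<integral>\<^sup>+D. ennreal ((local_mean (linked T) n D - f (fst (D 0)))\<^sup>2) \<partial>sample n) \<le>
      2 * (\<integral>\<^sup>+p. B (fst p) T \<partial>\<nu>) + ennreal ((L\<^sup>2 + 4 * \<sigma>\<^sup>2) / real (Suc n)) * c T"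
    proof (rule local_mean_risk)
      show "Measurable.pred (borel \<Otimes>\<^sub>M borel) (\<lambda>p. linked T (fst p) (snd p))"
        by (rule measurable_linked) (use tess in \<open>simp_all add: space_tessellation_space\<close>)
      have "(\<lambda>x. (x, T)) \<in> measurable borel (borel \<Otimes>\<^sub>M tessellation_space)"
        using tess by (intro measurable_Pair2') (simp add: space_tessellation_space)
      from measurable_compose[OF this B] show "(\<lambda>x. B x T) \<in> borel_measurable borel" by simp
      show "AE D in sample n. linked T (fst (D 0)) (fst (D 0))"
        using good by eventually_elim (simp add: linked_refl_iff)
      show "AE D in sample n. \<forall>i\<in>{1..n}. linked T (fst (D 0)) (fst (D i)) \<longrightarrow>
          ennreal ((f (fst (D i)) - f (fst (D 0)))\<^sup>2) \<le> B (fst (D 0)) T"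
      proof (rule AE_mp[OF good], rule AE_I2, rule impI)
        fix D :: "nat \<Rightarrow> 'a \<times> real" assume g: "\<forall>i\<in>{0..n}. fst (D i) \<in> G \<and> fst (D i) \<notin> boundary_union T"
        show "\<forall>i\<in>{1..n}. linked T (fst (D 0)) (fst (D i)) \<longrightarrow>
          ennreal ((f (fst (D i)) - f (fst (D 0)))\<^sup>2) \<le> B (fst (D 0)) T" by (rule point[THEN conjunct1]) (rule bspec[OF g], assumption, rule tess)
      qed
      show "AE D in sample n. ennreal (\<Sum>i=0..n. 1 / real (card {j \<in> {0..n}. linked T (fst (D i)) (fst (D j))})) \<le> c T"
      proof (rule AE_mp[OF good], rule AE_I2, rule impI)
        fix D :: "nat \<Rightarrow> 'a \<times> real" assume g: "\<forall>i\<in>{0..n}. fst (D i) \<in> G \<and> fst (D i) \<notin> boundary_union T"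
        show "ennreal (\<Sum>i=0..n. 1 / real (card {j \<in> {0..n}. linked T (fst (D i)) (fst (D j))})) \<le> c T" by (rule point[THEN conjunct2]) (rule bspec[OF g], assumption, rule tess)
      qed
    qed
  qed
  also have "\<dots> = 2 * (\<integral>\<^sup>+T. \<integral>\<^sup>+p. B (fst p) T \<partial>\<nu> \<partial>\<T>) + ennreal ((L\<^sup>2 + 4 * \<sigma>\<^sup>2) / real (Suc n)) * (\<integral>\<^sup>+T. c T \<partial>\<T>)"
  proof -
    have Bi: "(\<lambda>T. \<integral>\<^sup>+p. B (fst p) T \<partial>\<nu>) \<in> borel_measurable \<T>"
      using borel_measurable_nn_integral_fst[OF measurable_pair_swap[OF B_m]] by simp
    show ?thesis
      using Bi c_m by (subst nn_integral_add) (auto simp only: nn_integral_cmult intro!: borel_measurable_times_ennreal borel_measurable_const)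
  qed
  also have "(\<integral>\<^sup>+T. \<integral>\<^sup>+p. B (fst p) T \<partial>\<nu> \<partial>\<T>) = (\<integral>\<^sup>+p. \<integral>\<^sup>+T. B (fst p) T \<partial>\<T> \<partial>\<nu>)"
    using \<nu>T.Fubini[OF B_m] by simp
  finally show ?thesis .
qed

section \<open>The risk of the forest\<close>

text \<open>Independence of data and tree, stated as \<open>joint\<close>, turns the risk into an
  integral over a product measure. The bias is controlled by \<open>reach\<close> with exponent
  \<open>2 * \<beta>\<close>, the number of occupied cells by one \<open>sep_count\<close> for each
  ball of the cover.\<close>

lemma (in direction_law) stit_tree_risk:
  fixes Pr :: "'w measure" and \<nu> :: "('a \<times> real) measure"
  assumes Pr: "prob_space Pr" and stit: "stit_tessellation \<phi> l Pr T" and l: "0 < l"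
    and reg: "regression_law \<nu> f \<sigma> L"
    and Dat: "Dat \<in> measurable Pr (PiM {0..n} (\<lambda>_. borel))"
    and law: "distr Pr (PiM {0..n} (\<lambda>_. borel)) Dat = PiM {0..n} (\<lambda>_. \<nu>)"
    and joint: "distr Pr (PiM {0..n} (\<lambda>_. borel) \<Otimes>\<^sub>M tessellation_space) (\<lambda>\<omega>. (Dat \<omega>, T \<omega>)) =
       distr Pr (PiM {0..n} (\<lambda>_. borel)) Dat \<Otimes>\<^sub>M distr Pr tessellation_space T"
    and D: "dense_set (D :: 'a set)" and R: "0 < R" and G: "AE p in \<nu>. fst p \<in> G" "G \<subseteq> ball 0 R"
    and holder: "\<And>x y. x \<in> G \<Longrightarrow> y \<in> G \<Longrightarrow> \<bar>f x - f y\<bar> \<le> L * dist x y powr \<beta>"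
    and \<beta>: "0 < \<beta>" "\<beta> \<le> 1" and L: "0 < L"
    and Z: "finite Z" "\<And>x. x \<in> G \<Longrightarrow> \<exists>z\<in>Z. x \<in> ball z r" and r: "0 \<le> r"
    and B: "finite B" "0 < \<kappa>" "\<And>v. v \<noteq> 0 \<Longrightarrow> \<exists>b\<in>B. \<kappa> * norm v < b \<bullet> v"
    and m: "0 < m" "\<And>b. b \<in> B \<Longrightarrow> m \<le> measure \<phi> (ball b (\<kappa> / 2) \<inter> sphere 0 1)"
  shows "(\<integral>\<^sup>+\<omega>. ennreal ((local_mean (linked (T \<omega>)) n (Dat \<omega>) - f (fst (Dat \<omega> 0)))\<^sup>2) \<partial>Pr) \<le>
      ennreal (2 * L\<^sup>2 * l powr (- (2 * \<beta>))) * (\<Sum>k. ennreal (real (card B) * (real (Suc k))\<^sup>2 * exp (- (m * \<kappa> / 2) * real k))) +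
      ennreal ((L\<^sup>2 + 4 * \<sigma>\<^sup>2) / real (Suc n) * (real (card Z) * exp (2 * r * l)))" (is "?risk \<le> ?bound")
    and "AE \<omega> in Pr. \<forall>i\<in>{0..n}. fst (Dat \<omega> i) \<notin> boundary_union (T \<omega>)"
proof -
  interpret Pr: prob_space Pr by fact
  interpret reg: regression_law \<nu> f \<sigma> L by fact
  let ?P = "PiM {0..n} (\<lambda>_. borel) :: (nat \<Rightarrow> 'a \<times> real) measure"
  let ?T = "distr Pr tessellation_space T"
  note T = stit_tessellation_measurable[OF stit]
  interpret T: prob_space ?T by (rule Pr.prob_space_distr[OF T])
  interpret S: prob_space "reg.sample n" by (rule reg.prob_space_sample)
  interpret ST: pair_prob_space "reg.sample n" ?T ..
  interpret \<nu>T: pair_prob_space \<nu> ?T ..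
  have Dc: "countable D" using D by (simp add: dense_set_def)
  have fst_b: "fst \<in> borel_measurable (borel :: ('a \<times> real) measure)" by (simp add: borel_prod[symmetric])
  have fst_m: "fst \<in> borel_measurable \<nu>"
    using fst_b by (simp only: measurable_cong_sets[OF reg.sets_\<nu> refl])
  have sets_P: "sets (reg.sample n) = sets ?P"
    by (intro sets_PiM_cong reg.sets_\<nu> refl)
  have null: "AE \<T> in ?T. x \<notin> boundary_union \<T>" for x
  proof -
    have "{\<T> \<in> space tessellation_space. linked \<T> x x} \<in> sets tessellation_space"
      by (rule measurable_linked[unfolded pred_def]) simp_all
    then show ?thesis
      using stit_boundary_null[OF Pr stit _ D, of x] l
      by (subst AE_distr_iff[OF T]) (simp_all add: linked_refl_iff)
  qed
  \<comment> \<open>That each fixed point avoids almost every boundary becomes, by Fubini, the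
    statement that almost every tessellation has a boundary that is null for the design.\<close>
  have "AE p in \<nu>. AE \<T> in ?T. fst p \<notin> boundary_union \<T>" using null by simp
  moreover have "{z \<in> space (\<nu> \<Otimes>\<^sub>M ?T). linked (snd z) (fst (fst z)) (fst (fst z))} \<in> sets (\<nu> \<Otimes>\<^sub>M ?T)"
    by (rule measurable_linked[unfolded pred_def])
      (auto intro!: measurable_compose[OF measurable_fst fst_m] measurable_compose[OF measurable_snd] simp: measurable_ident_sets)
  ultimately have boundary: "AE \<T> in ?T. AE p in \<nu>. fst p \<notin> boundary_union \<T>"
    by (subst \<nu>T.AE_commute[symmetric]) (simp_all add: linked_refl_iff)
  define Bf where "Bf x \<T> = ennreal (L\<^sup>2) * reach D R B \<kappa> l (2 * \<beta>) x \<T>" for x \<T>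
  define c where "c \<T> = (\<Sum>z\<in>Z. sep_count (D \<inter> (ball z r \<inter> ball 0 R)) (boundary_union \<T>))" for \<T>
  have Bf_m: "(\<lambda>z. Bf (fst z) (snd z)) \<in> borel_measurable (borel \<Otimes>\<^sub>M tessellation_space)"
    unfolding Bf_def by (intro borel_measurable_times_ennreal borel_measurable_const measurable_reach Dc measurable_fst measurable_snd)
  have c_m: "c \<in> borel_measurable tessellation_space"
    unfolding c_def[abs_def] using Dc by (intro borel_measurable_sum measurable_sep_count_boundary) auto
  have point: "(\<forall>i\<in>{1..n}. linked \<T> (fst (d 0)) (fst (d i)) \<longrightarrow> ennreal ((f (fst (d i)) - f (fst (d 0)))\<^sup>2) \<le> Bf (fst (d 0)) \<T>) \<and>
      ennreal (\<Sum>i=0..n. 1 / real (card {j \<in> {0..n}. linked \<T> (fst (d i)) (fst (d j))})) \<le> c \<T>"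
    if d: "\<And>i. i \<in> {0..n} \<Longrightarrow> fst (d i) \<in> G \<and> fst (d i) \<notin> boundary_union \<T>" and tess: "tessellation \<T>"
    for d :: "nat \<Rightarrow> 'a \<times> real" and \<T>
  proof (intro conjI ballI impI)
    fix i assume i: "i \<in> {1..n}" and lk: "linked \<T> (fst (d 0)) (fst (d i))"
    let ?x = "fst (d 0)" and ?y = "fst (d i)"
    have xy: "?x \<in> G" "?y \<in> G" using d[of 0] d[of i] i by auto
    have "(f ?y - f ?x)\<^sup>2 \<le> (L * dist ?y ?x powr \<beta>)\<^sup>2"
      using holder[OF xy(2,1)] by (intro abs_le_square_iff[THEN iffD1]) auto
    also have "\<dots> = L\<^sup>2 * norm (?y - ?x) powr (2 * \<beta>)"
      by (simp add: power_mult_distrib dist_norm power2_eq_square powr_add[symmetric])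
    finally have "ennreal ((f ?y - f ?x)\<^sup>2) \<le> ennreal (L\<^sup>2) * ennreal (norm (?y - ?x) powr (2 * \<beta>))"
      by (simp add: ennreal_mult'[symmetric] ennreal_leI)
    also have "\<dots> \<le> Bf ?x \<T>"
      unfolding Bf_def using xy(2) G(2) \<beta> by (intro mult_left_mono dist_le_reach[OF tess D B(1,3) l _ lk]) auto
    finally show "ennreal ((f ?y - f ?x)\<^sup>2) \<le> Bf ?x \<T>" .
  next
    show "ennreal (\<Sum>i=0..n. 1 / real (card {j \<in> {0..n}. linked \<T> (fst (d i)) (fst (d j))})) \<le> c \<T>"
      unfolding c_def
    proof (rule sum_inverse_cells_le[OF tess D _ Z(1)])
      fix i assume "i \<in> {0..n}"
      from d[OF this] show "fst (d i) \<notin> boundary_union \<T>" "\<exists>z\<in>Z. fst (d i) \<in> ball z r" "fst (d i) \<in> ball 0 R"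
        using Z(2) G(2) by auto
    qed simp
  qed
  have main: "(\<integral>\<^sup>+z. ennreal ((local_mean (linked (snd z)) n (fst z) - f (fst (fst z 0)))\<^sup>2) \<partial>(reg.sample n \<Otimes>\<^sub>M ?T)) \<le>
     2 * (\<integral>\<^sup>+p. \<integral>\<^sup>+\<T>. Bf (fst p) \<T> \<partial>?T \<partial>\<nu>) + ennreal ((L\<^sup>2 + 4 * \<sigma>\<^sup>2) / real (Suc n)) * (\<integral>\<^sup>+\<T>. c \<T> \<partial>?T)"
    by (rule reg.random_tessellation_risk[OF T.prob_space_axioms _ Bf_m c_m boundary point G(1)]) simp
  have pair_m: "(\<lambda>\<omega>. (Dat \<omega>, T \<omega>)) \<in> measurable Pr (?P \<Otimes>\<^sub>M tessellation_space)"
    using Dat T by (rule measurable_Pair)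
  have G_m: "(\<lambda>z. ennreal ((local_mean (linked (snd z)) n (fst z) - f (fst (fst z 0)))\<^sup>2)) \<in> borel_measurable (?P \<Otimes>\<^sub>M tessellation_space)"
  proof -
    have comp: "(\<lambda>z. fst z i) \<in> borel_measurable (?P \<Otimes>\<^sub>M tessellation_space)" if "i \<in> {0..n}" for i
      by (rule measurable_compose[OF measurable_fst measurable_component_singleton[OF that]])
    have 1: "(\<lambda>z. local_mean (linked (snd z)) n (fst z)) \<in> borel_measurable (?P \<Otimes>\<^sub>M tessellation_space)"
      by (rule measurable_local_mean[OF comp measurable_snd])
    have "(\<lambda>z. f (fst (fst z 0))) \<in> borel_measurable (?P \<Otimes>\<^sub>M tessellation_space)"
      by (rule measurable_compose[OF measurable_compose[OF comp fst_b] reg.f_measurable]) simp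
    with 1 show ?thesis by measurable
  qed
  have "?risk = (\<integral>\<^sup>+z. ennreal ((local_mean (linked (snd z)) n (fst z) - f (fst (fst z 0)))\<^sup>2)
      \<partial>distr Pr (?P \<Otimes>\<^sub>M tessellation_space) (\<lambda>\<omega>. (Dat \<omega>, T \<omega>)))"
    by (subst nn_integral_distr[OF pair_m]) (use G_m in \<open>simp_all only: measurable_distr_eq1 fst_conv snd_conv\<close>)
  also have "\<dots> = (\<integral>\<^sup>+z. ennreal ((local_mean (linked (snd z)) n (fst z) - f (fst (fst z 0)))\<^sup>2) \<partial>(reg.sample n \<Otimes>\<^sub>M ?T))"
    by (simp only: joint law)
  also note main
  finally have risk: "?risk \<le> 2 * (\<integral>\<^sup>+p. \<integral>\<^sup>+\<T>. Bf (fst p) \<T> \<partial>?T \<partial>\<nu>) + ennreal ((L\<^sup>2 + 4 * \<sigma>\<^sup>2) / real (Suc n)) * (\<integral>\<^sup>+\<T>. c \<T> \<partial>?T)" .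
  have "(\<integral>\<^sup>+p. \<integral>\<^sup>+\<T>. Bf (fst p) \<T> \<partial>?T \<partial>\<nu>) \<le> (\<integral>\<^sup>+p. ennreal (L\<^sup>2 * l powr (- (2 * \<beta>))) * (\<Sum>k. ennreal (real (card B) * (real (Suc k))\<^sup>2 * exp (- (m * \<kappa> / 2) * real k))) \<partial>\<nu>)"
  proof (rule nn_integral_mono_AE, rule AE_mp[OF G(1)], rule AE_I2, rule impI)
    fix p assume "fst p \<in> G"
    then have x: "fst p \<in> ball 0 R" using G(2) by blast
    have reach_m: "(\<lambda>\<T>. reach D R B \<kappa> l (2 * \<beta>) (fst p) \<T>) \<in> borel_measurable tessellation_space"
      using measurable_reach[OF Dc, where f="\<lambda>_. fst p" and h="\<lambda>\<T>. \<T>" and M=tessellation_space] by simp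
    have "(\<integral>\<^sup>+\<T>. Bf (fst p) \<T> \<partial>?T) = ennreal (L\<^sup>2) * (\<integral>\<^sup>+\<omega>. reach D R B \<kappa> l (2 * \<beta>) (fst p) (T \<omega>) \<partial>Pr)"
      unfolding Bf_def using reach_m T
      by (subst nn_integral_distr) (auto intro!: nn_integral_cmult measurable_compose[OF T reach_m])
    also have "\<dots> \<le> ennreal (L\<^sup>2) * (ennreal (l powr (- (2 * \<beta>))) * (\<Sum>k. ennreal (real (card B) * (real (Suc k))\<^sup>2 * exp (- (m * \<kappa> / 2) * real k))))"
      by (intro mult_left_mono stit_reach_le[OF Pr stit l R x Dc B(1,2) m]) (use \<beta> in auto)
    finally show "(\<integral>\<^sup>+\<T>. Bf (fst p) \<T> \<partial>?T) \<le> ennreal (L\<^sup>2 * l powr (- (2 * \<beta>))) * (\<Sum>k. ennreal (real (card B) * (real (Suc k))\<^sup>2 * exp (- (m * \<kappa> / 2) * real k)))"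
      by (simp only: ennreal_mult'[OF zero_le_power2] mult.assoc)
  qed
  also have "\<dots> = ennreal (L\<^sup>2 * l powr (- (2 * \<beta>))) * (\<Sum>k. ennreal (real (card B) * (real (Suc k))\<^sup>2 * exp (- (m * \<kappa> / 2) * real k)))"
    by (simp add: reg.emeasure_space_1)
  finally have bias: "(\<integral>\<^sup>+p. \<integral>\<^sup>+\<T>. Bf (fst p) \<T> \<partial>?T \<partial>\<nu>) \<le>
    ennreal (L\<^sup>2 * l powr (- (2 * \<beta>))) * (\<Sum>k. ennreal (real (card B) * (real (Suc k))\<^sup>2 * exp (- (m * \<kappa> / 2) * real k)))" .
  have cells: "(\<integral>\<^sup>+\<T>. c \<T> \<partial>?T) \<le> ennreal (real (card Z) * exp (2 * r * l))"
  proof -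
    have "(\<integral>\<^sup>+\<T>. c \<T> \<partial>?T) = (\<integral>\<^sup>+\<omega>. c (T \<omega>) \<partial>Pr)"
      using c_m by (intro nn_integral_distr[OF T]) (simp only: measurable_distr_eq1)
    also have "\<dots> = (\<Sum>z\<in>Z. \<integral>\<^sup>+\<omega>. sep_count (D \<inter> (ball z r \<inter> ball 0 R)) (boundary_union (T \<omega>)) \<partial>Pr)"
      unfolding c_def using Dc by (intro nn_integral_sum measurable_compose[OF T measurable_sep_count_boundary]) auto
    also have "\<dots> \<le> (\<Sum>z\<in>Z. ennreal (exp (2 * r * l)))"
    proof (rule sum_mono)
      fix z
      show "(\<integral>\<^sup>+\<omega>. sep_count (D \<inter> (ball z r \<inter> ball 0 R)) (boundary_union (T \<omega>)) \<partial>Pr) \<le> ennreal (exp (2 * r * l))"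
        by (rule stit_sep_count_le[OF stit _ r R, where z=z]) (use Dc l in auto)
    qed
    also have "\<dots> = ennreal (real (card Z) * exp (2 * r * l))"
      by (simp add: ennreal_mult' ennreal_of_nat_eq_real_of_nat)
    finally show ?thesis .
  qed
  have fin: "?risk \<le> 2 * (ennreal (L\<^sup>2 * l powr (- (2 * \<beta>))) * (\<Sum>k. ennreal (real (card B) * (real (Suc k))\<^sup>2 * exp (- (m * \<kappa> / 2) * real k)))) +
    ennreal ((L\<^sup>2 + 4 * \<sigma>\<^sup>2) / real (Suc n)) * ennreal (real (card Z) * exp (2 * r * l))"
    by (rule order_trans[OF risk]) (intro add_mono mult_left_mono bias cells zero_le)
  have e1: "ennreal (2 * L\<^sup>2 * l powr (- (2 * \<beta>))) = 2 * ennreal (L\<^sup>2 * l powr (- (2 * \<beta>)))"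
    by (simp add: ennreal_mult' mult.assoc)
  have e2: "ennreal ((L\<^sup>2 + 4 * \<sigma>\<^sup>2) / real (Suc n) * (real (card Z) * exp (2 * r * l))) =
    ennreal ((L\<^sup>2 + 4 * \<sigma>\<^sup>2) / real (Suc n)) * ennreal (real (card Z) * exp (2 * r * l))"
    by (rule ennreal_mult') simp
  show "?risk \<le> ?bound" unfolding e1 e2 mult.assoc[where a="2 :: ennreal"] by (rule fin)
  show "AE \<omega> in Pr. \<forall>i\<in>{0..n}. fst (Dat \<omega> i) \<notin> boundary_union (T \<omega>)"
  proof (rule AE_finite_allI)
    fix i assume i: "i \<in> {0..n}"
    have "{z \<in> space (reg.sample n \<Otimes>\<^sub>M ?T). linked (snd z) (fst (fst z i)) (fst (fst z i))} \<in> sets (reg.sample n \<Otimes>\<^sub>M ?T)"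
    proof (rule measurable_linked[unfolded pred_def])
      show "(\<lambda>z. fst (fst z i)) \<in> borel_measurable (reg.sample n \<Otimes>\<^sub>M ?T)"
        by (rule measurable_compose[OF measurable_compose[OF measurable_fst measurable_component_singleton[OF i]] fst_m])
      then show "(\<lambda>z. fst (fst z i)) \<in> borel_measurable (reg.sample n \<Otimes>\<^sub>M ?T)" .
      show "snd \<in> measurable (reg.sample n \<Otimes>\<^sub>M ?T) tessellation_space"
        by (rule measurable_compose[OF measurable_snd]) (simp add: measurable_ident_sets)
    qed
    then have "AE z in reg.sample n \<Otimes>\<^sub>M ?T. fst (fst z i) \<notin> boundary_union (snd z)"
      using null by (intro ST.AE_pair_measure) (simp_all add: linked_refl_iff)
    then have "AE z in distr Pr (?P \<Otimes>\<^sub>M tessellation_space) (\<lambda>\<omega>. (Dat \<omega>, T \<omega>)). fst (fst z i) \<notin> boundary_union (snd z)"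
      by (simp only: joint law)
    from AE_distrD[OF pair_m this] show "AE \<omega> in Pr. fst (Dat \<omega> i) \<notin> boundary_union (T \<omega>)" by simp
  qed simp
qed

section \<open>Reduction of the model assumptions to the laws used above, and the rate\<close>

lemma holder_class_continuous_on:
  assumes f: "f \<in> holder_class W \<beta> L" and \<beta>: "0 < \<beta>" and L: "0 < L"
  shows "continuous_on W f"
  unfolding continuous_on_iff
proof (intro ballI allI impI)
  fix x and e :: real assume x: "x \<in> W" and e: "0 < e"
  define d where "d = (e / L) powr (1 / \<beta>)"
  have "0 < d" using e L by (simp add: d_def)
  moreover have "dist (f y) (f x) < e" if y: "y \<in> W" "dist y x < d" for y
  proof -
    have "dist (f y) (f x) \<le> L * dist y x powr \<beta>"
      using f x y(1) by (simp add: holder_class_def dist_real_def)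
    also have "\<dots> < L * d powr \<beta>" using y(2) \<beta> L by (intro mult_strict_left_mono powr_less_mono2) auto
    also have "\<dots> = e" using e L \<beta> by (simp add: d_def powr_powr)
    finally show ?thesis .
  qed
  ultimately show "\<exists>d>0. \<forall>x'\<in>W. dist x' x < d \<longrightarrow> dist (f x') (f x) < e" by blast
qed

text \<open>Factors that are functions of \<open>X0\<close> pass through conditioning on
  \<open>X0\<close>, so almost sure conditional moments become integrals against test functions. The
  given noise agrees with \<open>Y0 - f (X0)\<close> on the whole space, which supplies its
  measurability.\<close>

lemma regression_lawI:
  fixes X0 :: "'w \<Rightarrow> 'a::euclidean_space" and Y0 :: "'w \<Rightarrow> real"
  assumes Pr: "prob_space Pr" and X: "X0 \<in> borel_measurable Pr" and Y: "Y0 \<in> borel_measurable Pr"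
    and f: "f \<in> borel_measurable borel" "\<And>x. \<bar>f x\<bar> \<le> L" and Y2: "integrable Pr (\<lambda>\<omega>. (Y0 \<omega>)\<^sup>2)"
    and eq: "\<And>\<omega>. \<omega> \<in> space Pr \<Longrightarrow> Y0 \<omega> = f (X0 \<omega>) + \<epsilon> \<omega>"
    and mean: "AE \<omega> in Pr. cond_expectation Pr X0 \<epsilon> \<omega> = 0"
    and var: "AE \<omega> in Pr. cond_variance Pr X0 \<epsilon> \<omega> = \<sigma>\<^sup>2"
  shows "regression_law (distr Pr borel (\<lambda>\<omega>. (X0 \<omega>, Y0 \<omega>))) f \<sigma> L"
proof -
  interpret Pr: prob_space Pr by fact
  let ?\<nu> = "distr Pr borel (\<lambda>\<omega>. (X0 \<omega>, Y0 \<omega>))"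
  let ?F = "vimage_algebra (space Pr) X0 borel"
  define e where "e \<omega> = Y0 \<omega> - f (X0 \<omega>)" for \<omega>
  have XY: "(\<lambda>\<omega>. (X0 \<omega>, Y0 \<omega>)) \<in> borel_measurable Pr"
    unfolding borel_prod[symmetric] using X Y by (rule measurable_Pair)
  have sub: "subalgebra Pr ?F"
    unfolding subalgebra_def using X measurable_space[OF X]
    by (auto simp: sets_vimage_algebra2 measurable_def)
  interpret F: finite_measure_subalgebra Pr ?F by unfold_locales (rule sub)
  have fX: "(\<lambda>\<omega>. f (X0 \<omega>)) \<in> borel_measurable Pr" by (rule measurable_compose[OF X f(1)])
  have e_m: "e \<in> borel_measurable Pr" unfolding e_def[abs_def] using Y fX by measurable
  have \<epsilon>_e: "\<epsilon> \<omega> = e \<omega>" if "\<omega> \<in> space Pr" for \<omega> using eq[OF that] by (simp add: e_def)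
  have \<epsilon>_m: "\<epsilon> \<in> borel_measurable Pr" using e_m \<epsilon>_e by (simp cong: measurable_cong)
  have e2: "integrable Pr (\<lambda>\<omega>. (e \<omega>)\<^sup>2)"
  proof (rule Bochner_Integration.integrable_bound)
    show "integrable Pr (\<lambda>\<omega>. 2 * (Y0 \<omega>)\<^sup>2 + 2 * L\<^sup>2)" using Y2 by simp
    show "(\<lambda>\<omega>. (e \<omega>)\<^sup>2) \<in> borel_measurable Pr" using e_m by measurable
    show "AE \<omega> in Pr. norm ((e \<omega>)\<^sup>2) \<le> norm (2 * (Y0 \<omega>)\<^sup>2 + 2 * L\<^sup>2)"
    proof (rule AE_I2)
      fix \<omega>
      have "(f (X0 \<omega>))\<^sup>2 \<le> L\<^sup>2" using f(2)[of "X0 \<omega>"] by (intro abs_le_square_iff[THEN iffD1]) simp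
      moreover have "(e \<omega>)\<^sup>2 \<le> 2 * (Y0 \<omega>)\<^sup>2 + 2 * (f (X0 \<omega>))\<^sup>2"
        using sum_squares_bound[of "Y0 \<omega>" "- f (X0 \<omega>)"] by (simp add: e_def power2_diff)
      ultimately show "norm ((e \<omega>)\<^sup>2) \<le> norm (2 * (Y0 \<omega>)\<^sup>2 + 2 * L\<^sup>2)" by simp
    qed
  qed
  have e1: "integrable Pr e"
    by (rule Pr.square_integrable_imp_integrable[OF e_m e2])
  have ce0: "AE \<omega> in Pr. real_cond_exp Pr ?F \<epsilon> \<omega> = 0" using mean by (simp add: cond_expectation_def)
  have ce: "AE \<omega> in Pr. real_cond_exp Pr ?F e \<omega> = 0"
    using F.real_cond_exp_cong[of \<epsilon> e, OF _ \<epsilon>_m e_m] ce0 \<epsilon>_e by (auto elim: AE_mp)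
  let ?h = "\<lambda>\<omega>. (\<epsilon> \<omega> - real_cond_exp Pr ?F \<epsilon> \<omega>)\<^sup>2"
  have h_m: "?h \<in> borel_measurable Pr" using \<epsilon>_m by measurable
  \<comment> \<open>The conditional mean subtracted in the variance is almost surely 0, so the
    variance condition becomes one on the conditional second moment.\<close>
  have h_e: "AE \<omega> in Pr. ?h \<omega> = (e \<omega>)\<^sup>2"
    using ce0 by (rule AE_mp) (rule AE_I2, simp add: \<epsilon>_e)
  have cv: "AE \<omega> in Pr. real_cond_exp Pr ?F (\<lambda>\<omega>. (e \<omega>)\<^sup>2) \<omega> = \<sigma>\<^sup>2"
  proof -
    have 1: "AE \<omega> in Pr. real_cond_exp Pr ?F ?h \<omega> = real_cond_exp Pr ?F (\<lambda>\<omega>. (e \<omega>)\<^sup>2) \<omega>"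
      by (rule F.real_cond_exp_cong[OF h_e h_m]) (use e_m in measurable)
    have 2: "AE \<omega> in Pr. real_cond_exp Pr ?F ?h \<omega> = \<sigma>\<^sup>2"
      using var by (simp only: cond_variance_def cond_expectation_def)
    from 1 2 show ?thesis by eventually_elim simp
  qed
  have gF: "(\<lambda>\<omega>. g (X0 \<omega>)) \<in> borel_measurable ?F" if "g \<in> borel_measurable borel" for g :: "'a \<Rightarrow> real"
    by (rule measurable_compose[OF measurable_vimage_algebra1 that]) simp
  have weighted: "(\<integral>\<omega>. g (X0 \<omega>) * k \<omega> \<partial>Pr) = (\<integral>\<omega>. g (X0 \<omega>) * s \<partial>Pr)"
    if g: "g \<in> borel_measurable borel" "\<And>x. \<bar>g x\<bar> \<le> 1" and k: "integrable Pr k"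
      and s: "AE \<omega> in Pr. real_cond_exp Pr ?F k \<omega> = s" for g :: "'a \<Rightarrow> real" and k :: "'w \<Rightarrow> real" and s :: real
  proof -
    have gX: "(\<lambda>\<omega>. g (X0 \<omega>)) \<in> borel_measurable Pr" by (rule measurable_compose[OF X g(1)])
    have k_m: "k \<in> borel_measurable Pr" using k by (rule borel_measurable_integrable)
    have int: "integrable Pr (\<lambda>\<omega>. g (X0 \<omega>) * k \<omega>)"
    proof (rule Bochner_Integration.integrable_bound[OF k])
      show "(\<lambda>\<omega>. g (X0 \<omega>) * k \<omega>) \<in> borel_measurable Pr" using gX k_m by measurable
      show "AE \<omega> in Pr. norm (g (X0 \<omega>) * k \<omega>) \<le> norm (k \<omega>)"
        using g(2) by (intro AE_I2) (simp add: abs_mult mult_left_le_one_le)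
    qed
    have "(\<integral>\<omega>. g (X0 \<omega>) * k \<omega> \<partial>Pr) = (\<integral>\<omega>. g (X0 \<omega>) * real_cond_exp Pr ?F k \<omega> \<partial>Pr)"
      by (rule F.real_cond_exp_intg(2)[OF int gF[OF g(1)] k_m, symmetric])
    also have "\<dots> = (\<integral>\<omega>. g (X0 \<omega>) * s \<partial>Pr)"
    proof (rule integral_cong_AE)
      show "(\<lambda>\<omega>. g (X0 \<omega>) * real_cond_exp Pr ?F k \<omega>) \<in> borel_measurable Pr" "(\<lambda>\<omega>. g (X0 \<omega>) * s) \<in> borel_measurable Pr"
        using gX by measurable
      show "AE \<omega> in Pr. g (X0 \<omega>) * real_cond_exp Pr ?F k \<omega> = g (X0 \<omega>) * s"
        using s by eventually_elim simp
    qed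
    finally show ?thesis .
  qed
  have fst_b: "fst \<in> borel_measurable (borel :: ('a \<times> real) measure)" and snd_b: "snd \<in> borel_measurable (borel :: ('a \<times> real) measure)"
    by (simp_all add: borel_prod[symmetric])
  have n_m: "(\<lambda>p. snd p - f (fst p)) \<in> borel_measurable borel"
    using measurable_compose[OF fst_b f(1)] snd_b by measurable
  show ?thesis
  proof (intro regression_law.intro regression_law_axioms.intro)
    show "prob_space ?\<nu>" by (rule Pr.prob_space_distr[OF XY])
    show "integrable ?\<nu> (\<lambda>p. (snd p - f (fst p))\<^sup>2)"
      using e2 n_m by (subst integrable_distr_eq[OF XY]) (auto simp: e_def)
    fix g :: "'a \<Rightarrow> real" assume g: "g \<in> borel_measurable borel" "\<And>x. \<bar>g x\<bar> \<le> 1"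
    have g_m: "(\<lambda>p :: 'a \<times> real. g (fst p)) \<in> borel_measurable borel" by (rule measurable_compose[OF fst_b g(1)])
    have "(\<integral>p. g (fst p) * (snd p - f (fst p)) \<partial>?\<nu>) = (\<integral>\<omega>. g (X0 \<omega>) * e \<omega> \<partial>Pr)"
      using g_m n_m by (subst integral_distr[OF XY]) (auto simp: e_def)
    also have "\<dots> = 0" using weighted[OF g e1 ce] by simp
    finally show "(\<integral>p. g (fst p) * (snd p - f (fst p)) \<partial>?\<nu>) = 0" .
    have "(\<integral>p. g (fst p) * (snd p - f (fst p))\<^sup>2 \<partial>?\<nu>) = (\<integral>\<omega>. g (X0 \<omega>) * (e \<omega>)\<^sup>2 \<partial>Pr)"
      using g_m n_m by (subst integral_distr[OF XY]) (auto simp: e_def)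
    also have "\<dots> = (\<integral>\<omega>. g (X0 \<omega>) * \<sigma>\<^sup>2 \<partial>Pr)" by (rule weighted[OF g e2 cv])
    also have "\<dots> = \<sigma>\<^sup>2 * (\<integral>\<omega>. g (X0 \<omega>) \<partial>Pr)" by simp
    also have "(\<integral>\<omega>. g (X0 \<omega>) \<partial>Pr) = (\<integral>p. g (fst p) \<partial>?\<nu>)"
      using g_m by (subst integral_distr[OF XY]) auto
    finally show "(\<integral>p. g (fst p) * (snd p - f (fst p))\<^sup>2 \<partial>?\<nu>) = \<sigma>\<^sup>2 * (\<integral>p. g (fst p) \<partial>?\<nu>)" .
  qed (use f in auto)
qed

text \<open>Events of a single tree are cylinder events of the whole forest, so independence from
  the forest passes to each tree; equality on rectangles then determines the product law.\<close>

lemma independent_elements_component_law: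
  assumes Pr: "prob_space Pr" and ind: "independent_elements Pr A F (PiM I (\<lambda>_. N)) (\<lambda>\<omega>. \<lambda>m\<in>I. P m \<omega>)"
    and m: "m \<in> I"
  shows "distr Pr (A \<Otimes>\<^sub>M N) (\<lambda>\<omega>. (F \<omega>, P m \<omega>)) = distr Pr A F \<Otimes>\<^sub>M distr Pr N (P m)"
proof -
  interpret Pr: prob_space Pr by fact
  have F: "F \<in> measurable Pr A" and G: "(\<lambda>\<omega>. \<lambda>m\<in>I. P m \<omega>) \<in> measurable Pr (PiM I (\<lambda>_. N))"
    and set: "Pr.indep_set (sets (vimage_algebra (space Pr) F A)) (sets (vimage_algebra (space Pr) (\<lambda>\<omega>. \<lambda>m\<in>I. P m \<omega>) (PiM I (\<lambda>_. N))))"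
    using ind by (auto simp: independent_elements_def)
  have P: "P m \<in> measurable Pr N"
    using measurable_compose[OF G measurable_component_singleton[OF m]] m by simp
  interpret A: prob_space "distr Pr A F" by (rule Pr.prob_space_distr[OF F])
  interpret N: prob_space "distr Pr N (P m)" by (rule Pr.prob_space_distr[OF P])
  have FP: "(\<lambda>\<omega>. (F \<omega>, P m \<omega>)) \<in> measurable Pr (A \<Otimes>\<^sub>M N)" using F P by (rule measurable_Pair)
  have "distr Pr A F \<Otimes>\<^sub>M distr Pr N (P m) = distr Pr (A \<Otimes>\<^sub>M N) (\<lambda>\<omega>. (F \<omega>, P m \<omega>))"
  proof (rule pair_measure_eqI)
    show "sets (distr Pr A F \<Otimes>\<^sub>M distr Pr N (P m)) = sets (distr Pr (A \<Otimes>\<^sub>M N) (\<lambda>\<omega>. (F \<omega>, P m \<omega>)))"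
      unfolding sets_distr[of Pr "A \<Otimes>\<^sub>M N"] by (intro sets_pair_measure_cong sets_distr)
    fix a b assume "a \<in> sets (distr Pr A F)" "b \<in> sets (distr Pr N (P m))"
    then have a: "a \<in> sets A" and b: "b \<in> sets N" by simp_all
    let ?a = "F -` a \<inter> space Pr" and ?b = "P m -` b \<inter> space Pr"
    have "?a \<in> sets (vimage_algebra (space Pr) F A)" using a by (rule in_vimage_algebra)
    moreover have "?b \<in> sets (vimage_algebra (space Pr) (\<lambda>\<omega>. \<lambda>m\<in>I. P m \<omega>) (PiM I (\<lambda>_. N)))"
    proof -
      let ?c = "(\<lambda>x. x m) -` b \<inter> space (PiM I (\<lambda>_. N))"
      have "?c \<in> sets (PiM I (\<lambda>_. N))" using b measurable_component_singleton[OF m] by (rule measurable_sets[rotated])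
      then have "(\<lambda>\<omega>. \<lambda>m\<in>I. P m \<omega>) -` ?c \<inter> space Pr \<in> sets (vimage_algebra (space Pr) (\<lambda>\<omega>. \<lambda>m\<in>I. P m \<omega>) (PiM I (\<lambda>_. N)))"
        by (rule in_vimage_algebra)
      also have "(\<lambda>\<omega>. \<lambda>m\<in>I. P m \<omega>) -` ?c \<inter> space Pr = ?b"
        using measurable_space[OF G] m by auto
      finally show ?thesis .
    qed
    ultimately have "Pr.prob (?a \<inter> ?b) = Pr.prob ?a * Pr.prob ?b" by (rule Pr.indep_setD[OF set])
    moreover have "(\<lambda>\<omega>. (F \<omega>, P m \<omega>)) -` (a \<times> b) \<inter> space Pr = ?a \<inter> ?b" by auto
    ultimately show "emeasure (distr Pr A F) a * emeasure (distr Pr N (P m)) b =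
        emeasure (distr Pr (A \<Otimes>\<^sub>M N) (\<lambda>\<omega>. (F \<omega>, P m \<omega>))) (a \<times> b)"
      using a b by (simp add: emeasure_distr[OF F] emeasure_distr[OF P] emeasure_distr[OF FP] Pr.emeasure_eq_measure ennreal_mult')
  qed (rule A.sigma_finite_measure_axioms N.sigma_finite_measure_axioms)+
  then show ?thesis by simp
qed

text \<open>For points of \<open>W\<close> off the boundary both formulas average over the same
  indices. If there is none, division by 0 makes \<open>local_mean\<close> equal to the default
  value 0.\<close>

lemma tree_estimator_eq_local_mean:
  assumes T: "tessellation T"
    and X: "\<And>i. i \<in> {0..n} \<Longrightarrow> X i \<in> W" "\<And>i. i \<in> {0..n} \<Longrightarrow> X i \<notin> boundary_union T"
  shows "tree_estimator n (\<lambda>i. (X i, Y i)) (restrict_tessellation T W) (X 0) =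
     local_mean (linked T) n (\<lambda>i\<in>{0..n}. (X i, Y i))"
proof -
  let ?D = "\<lambda>i\<in>{0..n}. (X i, Y i)" and ?c = "cell_of (restrict_tessellation T W) (X 0)"
  have cell: "X i \<in> ?c \<longleftrightarrow> linked T (X 0) (X i)" if "i \<in> {1..n}" for i
    using that by (intro cell_of_restrict_tessellation[OF T] X) auto
  have "{i \<in> {1..n}. X i \<in> ?c} = {i \<in> {1..n}. linked T (fst (?D 0)) (fst (?D i))}"
    using cell by (intro Collect_cong conj_cong refl) simp
  then have hits: "hits (linked T) n ?D = real (card {i \<in> {1..n}. X i \<in> ?c})"
    by (simp only: hits_eq_card)
  have "local_mean (linked T) n ?D = (\<Sum>i=1..n. indicator ?c (X i) * Y i) / hits (linked T) n ?D"
    unfolding local_mean_def weight_def sum_divide_distrib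
    by (intro sum.cong refl) (simp add: cell indicator_def of_bool_def)
  then show ?thesis
    unfolding tree_estimator_def hits by (simp add: Let_def)
qed

text \<open>Convexity of the square, as Cauchy-Schwarz against the constant 1.\<close>

lemma mean_square_error_le:
  fixes a :: "nat \<Rightarrow> real"
  assumes "1 \<le> M"
  shows "((\<Sum>m=1..M. a m) / real M - b)\<^sup>2 \<le> (\<Sum>m=1..M. (a m - b)\<^sup>2) / real M"
proof -
  have M: "0 < real M" using assms by simp
  have "(\<Sum>m=1..M. a m) / real M - b = (\<Sum>m=1..M. (a m - b) * 1) / real M"
    using M by (simp add: sum_subtractf diff_divide_distrib)
  also have "(\<dots>)\<^sup>2 = (\<Sum>m=1..M. (a m - b) * 1)\<^sup>2 / (real M)\<^sup>2" by (simp add: power_divide)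
  also have "\<dots> \<le> ((\<Sum>m=1..M. (a m - b)\<^sup>2) * (\<Sum>m=1..M. 1\<^sup>2)) / (real M)\<^sup>2"
    by (intro divide_right_mono Cauchy_Schwarz_ineq_sum) simp
  also have "\<dots> = (\<Sum>m=1..M. (a m - b)\<^sup>2) / real M"
    using M by (simp add: power2_eq_square)
  finally show ?thesis .
qed

text \<open>By convexity each tree may be bounded separately. The functions \<open>g\<close>, almost
  everywhere equal to the tree estimators, provide the measurability required to interchange sum and
  integral.\<close>

lemma forest_risk_le:
  assumes M: "1 \<le> M"
    and meas: "\<And>m. m \<in> {1..M} \<Longrightarrow> (\<lambda>\<omega>. ennreal ((g m \<omega> - h \<omega>)\<^sup>2)) \<in> borel_measurable Pr"
    and eq: "\<And>m. m \<in> {1..M} \<Longrightarrow> AE \<omega> in Pr. tree_estimator n (\<lambda>i. (X i \<omega>, Y i \<omega>)) (restrict_tessellation (T m \<omega>) W) (X 0 \<omega>) = g m \<omega>"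
    and f: "\<And>\<omega>. \<omega> \<in> space Pr \<Longrightarrow> f (X 0 \<omega>) = h \<omega>"
    and bound: "\<And>m. m \<in> {1..M} \<Longrightarrow> (\<integral>\<^sup>+\<omega>. ennreal ((g m \<omega> - h \<omega>)\<^sup>2) \<partial>Pr) \<le> c"
  shows "forest_risk Pr W f X Y n M T \<le> c"
proof -
  have all: "AE \<omega> in Pr. \<forall>m\<in>{1..M}. tree_estimator n (\<lambda>i. (X i \<omega>, Y i \<omega>)) (restrict_tessellation (T m \<omega>) W) (X 0 \<omega>) = g m \<omega>"
    by (rule AE_finite_allI[OF finite_atLeastAtMost eq])
  have "forest_risk Pr W f X Y n M T \<le> (\<integral>\<^sup>+\<omega>. ennreal (1 / real M) * (\<Sum>m=1..M. ennreal ((g m \<omega> - h \<omega>)\<^sup>2)) \<partial>Pr)"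
    unfolding forest_risk_def
  proof (rule nn_integral_mono_AE, rule AE_mp[OF all], rule AE_I2, rule impI)
    fix \<omega> assume \<omega>: "\<omega> \<in> space Pr"
      and est: "\<forall>m\<in>{1..M}. tree_estimator n (\<lambda>i. (X i \<omega>, Y i \<omega>)) (restrict_tessellation (T m \<omega>) W) (X 0 \<omega>) = g m \<omega>"
    have "forest_estimator n M (\<lambda>i. (X i \<omega>, Y i \<omega>)) (\<lambda>m. restrict_tessellation (T m \<omega>) W) (X 0 \<omega>) = (\<Sum>m=1..M. g m \<omega>) / real M"
      unfolding forest_estimator_def using est by (intro arg_cong2[where f="(/)"] sum.cong refl) blast
    then have "(forest_estimator n M (\<lambda>i. (X i \<omega>, Y i \<omega>)) (\<lambda>m. restrict_tessellation (T m \<omega>) W) (X 0 \<omega>) - f (X 0 \<omega>))\<^sup>2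
        \<le> (\<Sum>m=1..M. (g m \<omega> - h \<omega>)\<^sup>2) / real M"
      using mean_square_error_le[OF M, of "\<lambda>m. g m \<omega>" "h \<omega>"] by (simp only: f[OF \<omega>])
    then have "ennreal ((forest_estimator n M (\<lambda>i. (X i \<omega>, Y i \<omega>)) (\<lambda>m. restrict_tessellation (T m \<omega>) W) (X 0 \<omega>) - f (X 0 \<omega>))\<^sup>2)
        \<le> ennreal (1 / real M * (\<Sum>m=1..M. (g m \<omega> - h \<omega>)\<^sup>2))"
      by (intro ennreal_leI) simp
    also have "\<dots> = ennreal (1 / real M) * (\<Sum>m=1..M. ennreal ((g m \<omega> - h \<omega>)\<^sup>2))"
      by (simp only: ennreal_mult' sum_ennreal zero_le_power2 divide_nonneg_nonneg zero_le_one of_nat_0_le_iff)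
    finally show "ennreal ((forest_estimator n M (\<lambda>i. (X i \<omega>, Y i \<omega>)) (\<lambda>m. restrict_tessellation (T m \<omega>) W) (X 0 \<omega>) - f (X 0 \<omega>))\<^sup>2)
        \<le> ennreal (1 / real M) * (\<Sum>m=1..M. ennreal ((g m \<omega> - h \<omega>)\<^sup>2))" .
  qed
  also have "\<dots> = ennreal (1 / real M) * (\<Sum>m=1..M. \<integral>\<^sup>+\<omega>. ennreal ((g m \<omega> - h \<omega>)\<^sup>2) \<partial>Pr)"
    by (subst nn_integral_cmult) (intro borel_measurable_sum meas, assumption, subst nn_integral_sum, rule meas, assumption, rule refl)
  also have "\<dots> \<le> ennreal (1 / real M) * (\<Sum>m=1..M. c)"
    by (intro mult_left_mono sum_mono bound) auto
  also have "\<dots> = ennreal (1 / real M) * ennreal (real M) * c"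
    by (simp add: ennreal_of_nat_eq_real_of_nat mult.assoc)
  also have "\<dots> = c" using M by (simp add: ennreal_mult'[symmetric])
  finally show ?thesis .
qed

text \<open>Eventually \<open>lam\<close> is within a factor 2 of the prescribed sequence
  \<open>g\<close> and at least 1, so its ceiling is at most \<open>4 * g\<close>. With e = d + 2
  \<beta> the exponents of n agree because d/e - 1 = - 2 \<beta>/e: this choice of \<open>g\<close>
  balances the bias against the number of cells per sample point.\<close>

lemma risk_rate:
  fixes lam :: "nat \<Rightarrow> real"
  assumes \<beta>: "0 < \<beta>" and L: "0 < L" and C: "0 \<le> C1" "0 \<le> C2"
    and lam: "lam \<sim>[sequentially] (\<lambda>n. L powr (2 / (real d + 2 * \<beta>)) * real n powr (1 / (real d + 2 * \<beta>)))"
  shows "(\<lambda>n. C1 * lam n powr (- (2 * \<beta>)) + C2 * (real (nat \<lceil>lam n\<rceil>) ^ d / real (Suc n))) \<in>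
     O(\<lambda>n. L powr (2 * real d / (real d + 2 * \<beta>)) * real n powr (- (2 * \<beta>) / (real d + 2 * \<beta>)))"
proof -
  define e where "e = real d + 2 * \<beta>"
  define g where "g n = L powr (2 / e) * real n powr (1 / e)" for n :: nat
  have e: "0 < e" using \<beta> by (simp add: e_def add_nonneg_pos)
  have lim: "(\<lambda>n. lam n / g n) \<longlonglongrightarrow> 1"
  proof (rule asymp_equivD_strong)
    show "lam \<sim>[sequentially] g" using lam by (simp only: g_def[abs_def] e_def)
    show "\<forall>\<^sub>F n in sequentially. lam n \<noteq> 0 \<or> g n \<noteq> 0"
      using eventually_gt_at_top[of 0] by eventually_elim (use L in \<open>simp add: g_def\<close>)
  qed
  have g_top: "filterlim g at_top sequentially"
  proof -
    have "filterlim (\<lambda>n. real n powr (1 / e)) at_top sequentially" using e by real_asymp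
    then show ?thesis unfolding g_def[abs_def] using L
      by (intro filterlim_tendsto_pos_mult_at_top[OF tendsto_const]) auto
  qed
  have ev: "\<forall>\<^sub>F n in sequentially. 1 / 2 < lam n / g n \<and> lam n / g n < 2 \<and> 2 \<le> g n \<and> 0 < n"
    using order_tendstoD(1)[OF lim, of "1 / 2"] order_tendstoD(2)[OF lim, of 2]
      filterlim_at_top[THEN iffD1, OF g_top, rule_format, of 2] eventually_gt_at_top[of "0::nat"]
    by (simp add: eventually_conj_iff)
  let ?T = "\<lambda>n. L powr (2 * real d / e) * real n powr (- (2 * \<beta>) / e)"
  \<comment> \<open>The first summand collects the powers of \<open>L\<close> left by the bias. If
    \<open>C1\<close> carries the factor L^2 they cancel it, because 2 = (4 \<beta> + 2
    d)/e.\<close>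
  define K where "K = C1 * 2 powr (2 * \<beta>) * (L powr (- (4 * \<beta>) / e) / L powr (2 * real d / e)) + C2 * 4 ^ d"
  have "(\<lambda>n. C1 * lam n powr (- (2 * \<beta>)) + C2 * (real (nat \<lceil>lam n\<rceil>) ^ d / real (Suc n))) \<in> O(?T)"
  proof (rule bigoI[where c=K], rule eventually_mono[OF ev])
    fix n :: nat assume n: "1 / 2 < lam n / g n \<and> lam n / g n < 2 \<and> 2 \<le> g n \<and> 0 < n"
    then have g0: "0 < g n" and lg: "g n / 2 \<le> lam n" "lam n \<le> 2 * g n" and l1: "1 \<le> lam n"
      by (auto simp: field_simps)
    have "lam n powr (- (2 * \<beta>)) \<le> (g n / 2) powr (- (2 * \<beta>))"
      using g0 lg(1) \<beta> by (intro powr_mono2') auto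
    also have "\<dots> = 2 powr (2 * \<beta>) * g n powr (- (2 * \<beta>))"
      using g0 by (simp add: powr_divide powr_minus field_simps)
    also have "g n powr (- (2 * \<beta>)) = L powr (- (4 * \<beta>) / e) * real n powr (- (2 * \<beta>) / e)"
      using L n by (simp add: g_def powr_mult powr_powr)
    also have "\<dots> = L powr (- (4 * \<beta>) / e) / L powr (2 * real d / e) * ?T n"
      using L by simp
    finally have 1: "C1 * lam n powr (- (2 * \<beta>)) \<le> C1 * (2 powr (2 * \<beta>) * (L powr (- (4 * \<beta>) / e) / L powr (2 * real d / e) * ?T n))"
      using C(1) by (rule mult_left_mono)
    have "real (nat \<lceil>lam n\<rceil>) \<le> 4 * g n" using l1 lg(2) by linarith
    then have "real (nat \<lceil>lam n\<rceil>) ^ d / real (Suc n) \<le> (4 * g n) ^ d / real n"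
      using n g0 by (intro frac_le power_mono) auto
    also have "\<dots> = 4 ^ d * (g n powr real d / real n)"
      using g0 by (simp add: power_mult_distrib powr_realpow)
    also have "g n powr real d = L powr (2 * real d / e) * real n powr (real d / e)"
      using L n by (simp add: g_def powr_mult powr_powr)
    also have "real n powr (real d / e) = real n powr (- (2 * \<beta>) / e) * real n"
    proof -
      have "real d / e = - (2 * \<beta>) / e + 1" using e by (simp add: e_def field_simps)
      then have "real n powr (real d / e) = real n powr (- (2 * \<beta>) / e) * real n powr 1" by (simp only: powr_add)
      then show ?thesis using n by simp
    qed
    also have "4 ^ d * (L powr (2 * real d / e) * (real n powr (- (2 * \<beta>) / e) * real n) / real n) = 4 ^ d * ?T n"
      using n by simp
    finally have 2: "C2 * (real (nat \<lceil>lam n\<rceil>) ^ d / real (Suc n)) \<le> C2 * (4 ^ d * ?T n)"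
      using C(2) by (rule mult_left_mono)
    have "0 \<le> C1 * lam n powr (- (2 * \<beta>)) + C2 * (real (nat \<lceil>lam n\<rceil>) ^ d / real (Suc n))"
      using C by simp
    moreover have "C1 * lam n powr (- (2 * \<beta>)) + C2 * (real (nat \<lceil>lam n\<rceil>) ^ d / real (Suc n)) \<le> K * ?T n"
      using add_mono[OF 1 2] by (simp only: K_def distrib_right mult.assoc)
    ultimately show "norm (C1 * lam n powr (- (2 * \<beta>)) + C2 * (real (nat \<lceil>lam n\<rceil>) ^ d / real (Suc n))) \<le> K * norm (?T n)"
      by simp
  qed
  then show ?thesis by (simp only: e_def)
qed

text \<open>Half of the exponential rate absorbs the polynomial factor.\<close>

lemma summable_square_exp:
  assumes "0 < (c::real)"
  shows "summable (\<lambda>k. A * (real (Suc k))\<^sup>2 * exp (- c * real k))"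
proof (rule summable_comparison_test_bigo)
  have "(\<lambda>k. exp (- (c / 2)) ^ k) = (\<lambda>k. exp (- (c / 2) * real k))"
    by (simp add: exp_of_nat_mult[symmetric] mult.commute)
  moreover have "summable (\<lambda>k. exp (- (c / 2)) ^ k)" using assms by (intro summable_geometric) simp
  ultimately show "summable (\<lambda>k. norm (exp (- (c / 2) * real k)))" by simp
  show "(\<lambda>k. A * (real (Suc k))\<^sup>2 * exp (- c * real k)) \<in> O(\<lambda>k. exp (- (c / 2) * real k))"
    using assms by real_asymp
qed

theorem corollary12:
  fixes Pr :: "'w measure"
    and \<phi> :: "'a::euclidean_space measure"
    and Z W S :: "'a set"
    and f :: "'a \<Rightarrow> real"
    and X :: "nat \<Rightarrow> 'w \<Rightarrow> 'a"
    and Y :: "nat \<Rightarrow> 'w \<Rightarrow> real"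
    and \<epsilon> :: "'w \<Rightarrow> real"
    and P :: "nat \<Rightarrow> nat \<Rightarrow> 'w \<Rightarrow> 'a set set"
    and M :: "nat \<Rightarrow> nat"
    and lam :: "nat \<Rightarrow> real"
    and \<beta> L \<sigma> :: real
    and d :: nat
  assumes "prob_space Pr"
    and "directional_distribution \<phi>"
    and "normalized_associated_zonoid \<phi> Z"
    and "W \<noteq> {}" "compact W" "convex W" "aff_dim W = int DIM('a)"
    \<comment> \<open>index 0 is the generic pair \<open>(X, Y)\<close>, indices \<open>1, \<dots>, n\<close> are the sample\<close>
    and "prob_space.indep_vars Pr (\<lambda>_. borel) (\<lambda>i \<omega>. (X i \<omega>, Y i \<omega>)) UNIV"
    and "\<And>i. distr Pr borel (\<lambda>\<omega>. (X i \<omega>, Y i \<omega>)) = distr Pr borel (\<lambda>\<omega>. (X 0 \<omega>, Y 0 \<omega>))"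
    and "\<And>i \<omega>. \<omega> \<in> space Pr \<Longrightarrow> X i \<omega> \<in> W"
    and "integrable Pr (\<lambda>\<omega>. (Y 0 \<omega>)\<^sup>2)"
    and "\<And>\<omega>. \<omega> \<in> space Pr \<Longrightarrow> Y 0 \<omega> = f (X 0 \<omega>) + \<epsilon> \<omega>"
    and "AE \<omega> in Pr. cond_expectation Pr (X 0) (Y 0) \<omega> = f (X 0 \<omega>)"
    and "AE \<omega> in Pr. cond_expectation Pr (X 0) \<epsilon> \<omega> = 0"
    and "AE \<omega> in Pr. cond_variance Pr (X 0) \<epsilon> \<omega> = \<sigma>\<^sup>2"
    and "subspace S" "dim S = d" "measure_support (distr Pr borel (X 0)) \<subseteq> S"
    and "0 < \<beta>" "\<beta> \<le> 1" "0 < L" "f \<in> holder_class W \<beta> L"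
    and "\<And>n. n \<ge> 1 \<Longrightarrow> lam n > 0"
    and "lam \<sim>[sequentially] (\<lambda>n. L powr (2 / (real d + 2 * \<beta>)) * real n powr (1 / (real d + 2 * \<beta>)))"
    and "\<And>n. n \<ge> 1 \<Longrightarrow> M n \<ge> 1"
    and "\<And>n m. n \<ge> 1 \<Longrightarrow> m \<in> {1..M n} \<Longrightarrow> stit_tessellation \<phi> (lam n) Pr (P n m)"
    and "\<And>n. n \<ge> 1 \<Longrightarrow> prob_space.indep_vars Pr (\<lambda>_. tessellation_space) (P n) {1..M n}"
    and "\<And>n. n \<ge> 1 \<Longrightarrow> independent_elements Pr
           (PiM {0..n} (\<lambda>_. borel)) (\<lambda>\<omega>. \<lambda>i\<in>{0..n}. (X i \<omega>, Y i \<omega>))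
           (PiM {1..M n} (\<lambda>_. tessellation_space)) (\<lambda>\<omega>. \<lambda>m\<in>{1..M n}. P n m \<omega>)"
  shows "(\<forall>\<^sub>F n in sequentially. forest_risk Pr W f X Y n (M n) (P n) < \<infinity>) \<and>
         (\<lambda>n. enn2real (forest_risk Pr W f X Y n (M n) (P n))) \<in>
           O(\<lambda>n. L powr (2 * real d / (real d + 2 * \<beta>)) *
                  real n powr (- (2 * \<beta>) / (real d + 2 * \<beta>))) \<and>
         (\<lambda>n. L powr (2 * real d / (real d + 2 * \<beta>)) *
                  real n powr (- (2 * \<beta>) / (real d + 2 * \<beta>))) \<in> \<Theta>(minimax_rate 0 \<beta> d)"
proof -
  note hyp = assms
  interpret Pr: prob_space Pr by (rule hyp(1))
  interpret direction_law \<phi> by unfold_locales (rule hyp(2))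
  note W_compact = hyp(5) and XY_indep = hyp(8) and XY_law = hyp(9) and X_W = hyp(10)
  have XY_m: "(\<lambda>\<omega>. (X i \<omega>, Y i \<omega>)) \<in> borel_measurable Pr" for i
    using XY_indep by (auto simp: Pr.indep_vars_def)
  have fst_b: "fst \<in> borel_measurable (borel :: ('a \<times> real) measure)" and snd_b: "snd \<in> borel_measurable (borel :: ('a \<times> real) measure)"
    by (simp_all add: borel_prod[symmetric])
  have X_m: "X i \<in> borel_measurable Pr" and Y_m: "Y i \<in> borel_measurable Pr" for i
    using measurable_compose[OF XY_m fst_b, of i] measurable_compose[OF XY_m snd_b, of i] by simp_all
  define \<nu> where "\<nu> = distr Pr borel (\<lambda>\<omega>. (X 0 \<omega>, Y 0 \<omega>))"
  \<comment> \<open>The assumptions on \<open>f\<close> concern \<open>W\<close> only. Its extension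
    by 0 is Borel, since \<open>f\<close> is continuous on the closed set \<open>W\<close>, and is
    bounded by \<open>L\<close> everywhere, as \<open>regression_law\<close> demands.\<close>
  define f0 where "f0 x = indicator W x *\<^sub>R f x" for x
  have f0: "f0 x = f x" if "x \<in> W" for x using that by (simp add: f0_def)
  have f0_m: "f0 \<in> borel_measurable borel"
    unfolding f0_def[abs_def]
    by (intro borel_measurable_continuous_on_indicator holder_class_continuous_on[OF hyp(22,19,21)]
        borel_closed compact_imp_closed W_compact)
  have f0_bound: "\<bar>f0 x\<bar> \<le> L" for x
    using hyp(22,21) by (auto simp: f0_def holder_class_def indicator_def)
  have f0_holder: "\<bar>f0 x - f0 y\<bar> \<le> L * dist x y powr \<beta>" if "x \<in> W" "y \<in> W" for x y
    using hyp(22) that by (simp add: f0 holder_class_def)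
  have reg: "regression_law \<nu> f0 \<sigma> L"
    unfolding \<nu>_def
  proof (rule regression_lawI[OF hyp(1) X_m Y_m f0_m f0_bound hyp(11)])
    fix \<omega> assume "\<omega> \<in> space Pr"
    then show "Y 0 \<omega> = f0 (X 0 \<omega>) + \<epsilon> \<omega>" using hyp(12) X_W by (simp add: f0)
  qed (rule hyp(14), rule hyp(15))
  obtain \<rho> where \<rho>: "\<And>x. x \<in> W \<Longrightarrow> norm x \<le> \<rho>"
    using compact_imp_bounded[OF W_compact] unfolding bounded_iff by blast
  define R where "R = \<bar>\<rho>\<bar> + 1"
  have R: "0 < R" by (simp add: R_def)
  have W_ball: "S \<inter> W \<subseteq> ball 0 R" using \<rho> by (fastforce simp: R_def)
  have G: "AE p in \<nu>. fst p \<in> S \<inter> W"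
  proof -
    have "AE x in distr Pr borel (X 0). x \<in> S"
      using AE_in_measure_support[of "distr Pr borel (X 0)"] hyp(18) by (auto elim: AE_mp)
    then have "AE \<omega> in Pr. X 0 \<omega> \<in> S" by (rule AE_distrD[OF X_m])
    then have "AE \<omega> in Pr. X 0 \<omega> \<in> S \<inter> W" by (rule AE_mp) (rule AE_I2, simp add: X_W)
    moreover have "{p \<in> space borel. fst p \<in> S \<inter> W} \<in> sets (borel :: ('a \<times> real) measure)"
    proof -
      have "closed (S \<inter> W)" by (intro closed_Int closed_subspace hyp(16) compact_imp_closed W_compact)
      then have "fst -` (S \<inter> W) \<inter> space borel \<in> sets (borel :: ('a \<times> real) measure)"
        by (intro measurable_sets[OF fst_b] borel_closed)
      then show ?thesis by (simp add: vimage_def)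
    qed
    ultimately show ?thesis unfolding \<nu>_def by (subst AE_distr_iff[OF XY_m]) simp_all
  qed
  obtain D :: "'a set" where D: "dense_set D"
    using countable_dense_setE unfolding dense_set_def by metis
  obtain B \<kappa> m where B: "finite B" "0 < \<kappa>" "\<And>v::'a. v \<noteq> 0 \<Longrightarrow> \<exists>b\<in>B. \<kappa> * norm v < b \<bullet> v"
    and m: "0 < m" "\<And>b. b \<in> B \<Longrightarrow> m \<le> measure \<phi> (ball b (\<kappa> / 2) \<inter> sphere 0 1)"
    using spanning_directions by blast
  define s where "s k = real (card B) * (real (Suc k))\<^sup>2 * exp (- (m * \<kappa> / 2) * real k)" for k
  have s: "summable s" "\<And>k. 0 \<le> s k"
    unfolding s_def[abs_def] using m(1) B(2) by (intro summable_square_exp) simp_all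
  define C1 where "C1 = 2 * L\<^sup>2 * suminf s"
  \<comment> \<open>The power of \<open>2 * \<bar>\<rho>\<bar> + 5\<close> comes from the number of
    covering balls; \<open>exp (2 * (real d + 1))\<close> bounds the mean number of cells that one
    of them meets.\<close>
  define C2 where "C2 = (L\<^sup>2 + 4 * \<sigma>\<^sup>2) * ((2 * \<bar>\<rho>\<bar> + 5) ^ d * exp (2 * (real d + 1)))"
  have C: "0 \<le> C1" "0 \<le> C2" using s by (auto simp: C1_def C2_def suminf_nonneg)
  define rate where "rate n = C1 * lam n powr (- (2 * \<beta>)) + C2 * (real (nat \<lceil>lam n\<rceil>) ^ d / real (Suc n))" for n
  have risk: "forest_risk Pr W f X Y n (M n) (P n) \<le> ennreal (rate n)" if n: "1 \<le> n" for n
  proof -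
    let ?PB = "PiM {0..n} (\<lambda>_. borel) :: (nat \<Rightarrow> 'a \<times> real) measure"
    define Dat where "Dat \<omega> = (\<lambda>i\<in>{0..n}. (X i \<omega>, Y i \<omega>))" for \<omega>
    have Dat: "Dat \<in> measurable Pr ?PB" unfolding Dat_def[abs_def] by (intro measurable_restrict XY_m)
    have law: "distr Pr ?PB Dat = PiM {0..n} (\<lambda>_. \<nu>)"
    proof -
      have "Pr.indep_vars (\<lambda>_. borel) (\<lambda>i \<omega>. (X i \<omega>, Y i \<omega>)) {0..n}"
        by (rule Pr.indep_vars_subset[OF XY_indep]) simp
      then have "distr Pr ?PB Dat = PiM {0..n} (\<lambda>i. distr Pr borel (\<lambda>\<omega>. (X i \<omega>, Y i \<omega>)))"
        unfolding Dat_def[abs_def] by (subst (asm) Pr.indep_vars_iff_distr_eq_PiM) (simp_all add: XY_m)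
      also have "\<dots> = PiM {0..n} (\<lambda>_. \<nu>)" unfolding \<nu>_def by (intro PiM_cong refl XY_law)
      finally show ?thesis .
    qed
    have joint: "distr Pr (?PB \<Otimes>\<^sub>M tessellation_space) (\<lambda>\<omega>. (Dat \<omega>, P n k \<omega>)) =
        distr Pr ?PB Dat \<Otimes>\<^sub>M distr Pr tessellation_space (P n k)" if "k \<in> {1..M n}" for k
      unfolding Dat_def[abs_def] by (rule independent_elements_component_law[OF hyp(1) hyp(28)[OF n] that])
    have lam0: "0 < lam n" by (rule hyp(23)[OF n])
    \<comment> \<open>The mesh \<open>1 / N\<close> is an integer version of
      \<open>1 / lam n\<close>. Rounding up keeps the covering radius times \<open>lam n\<close> at
      most \<open>d + 1\<close>, so the mean number of cells per ball is bounded independently of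
      \<open>n\<close>.\<close>
    define N where "N = nat \<lceil>lam n\<rceil>"
    have N: "1 \<le> N" "lam n \<le> real N" using lam0 unfolding N_def by linarith+
    have "\<exists>Z. finite Z \<and> real (card Z) \<le> ((2 * \<bar>\<rho>\<bar> + 5) * real N) ^ d \<and>
        (\<forall>x\<in>S \<inter> W. \<exists>z\<in>Z. x \<in> ball z ((real d + 1) / real N))"
      by (rule cover_subspace[OF hyp(16) \<rho> N(1), unfolded hyp(17)])
    then obtain Z' where Z': "finite Z'" "real (card Z') \<le> ((2 * \<bar>\<rho>\<bar> + 5) * real N) ^ d"
      "\<And>x. x \<in> S \<inter> W \<Longrightarrow> \<exists>z\<in>Z'. x \<in> ball z ((real d + 1) / real N)"
      by (elim exE conjE) blast
    define r where "r = (real d + 1) / real N"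
    have r: "0 \<le> r" by (simp add: r_def)
    have rl: "2 * r * lam n \<le> 2 * (real d + 1)"
    proof -
      have "2 * r * lam n \<le> 2 * r * real N" using r N by (intro mult_left_mono) auto
      also have "\<dots> = 2 * (real d + 1)" using N by (simp add: r_def)
      finally show ?thesis .
    qed
    have bound: "(\<integral>\<^sup>+\<omega>. ennreal ((local_mean (linked (P n k \<omega>)) n (Dat \<omega>) - f0 (fst (Dat \<omega> 0)))\<^sup>2) \<partial>Pr) \<le> ennreal (rate n)"
      and null: "AE \<omega> in Pr. \<forall>i\<in>{0..n}. fst (Dat \<omega> i) \<notin> boundary_union (P n k \<omega>)" if k: "k \<in> {1..M n}" for k
    proof -
      note tree = stit_tree_risk[OF hyp(1) hyp(26)[OF n k] lam0 reg Dat law joint[OF k] D R G W_ball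
        f0_holder hyp(19,20,21) Z'(1) Z'(3)[folded r_def] r B m]
      show "AE \<omega> in Pr. \<forall>i\<in>{0..n}. fst (Dat \<omega> i) \<notin> boundary_union (P n k \<omega>)"
        by (rule tree(2)) auto
      have "(\<integral>\<^sup>+\<omega>. ennreal ((local_mean (linked (P n k \<omega>)) n (Dat \<omega>) - f0 (fst (Dat \<omega> 0)))\<^sup>2) \<partial>Pr) \<le>
        ennreal (2 * L\<^sup>2 * lam n powr (- (2 * \<beta>))) * (\<Sum>k. ennreal (s k)) +
        ennreal ((L\<^sup>2 + 4 * \<sigma>\<^sup>2) / real (Suc n) * (real (card Z') * exp (2 * r * lam n)))"
        unfolding s_def by (rule tree(1)) auto
      also have "(\<Sum>k. ennreal (s k)) = ennreal (suminf s)" by (rule suminf_ennreal2[OF s(2,1)])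
      also have "ennreal (2 * L\<^sup>2 * lam n powr (- (2 * \<beta>))) * ennreal (suminf s) = ennreal (C1 * lam n powr (- (2 * \<beta>)))"
        using s by (subst ennreal_mult'[symmetric]) (simp_all add: C1_def mult_ac)
      also have "ennreal (C1 * lam n powr (- (2 * \<beta>))) + ennreal ((L\<^sup>2 + 4 * \<sigma>\<^sup>2) / real (Suc n) * (real (card Z') * exp (2 * r * lam n))) =
        ennreal (C1 * lam n powr (- (2 * \<beta>)) + (L\<^sup>2 + 4 * \<sigma>\<^sup>2) / real (Suc n) * (real (card Z') * exp (2 * r * lam n)))"
        using C by (intro ennreal_plus[symmetric]) simp_all
      also have "\<dots> \<le> ennreal (rate n)"
        unfolding rate_def
      proof (intro ennreal_leI add_left_mono)
        have "(L\<^sup>2 + 4 * \<sigma>\<^sup>2) / real (Suc n) * (real (card Z') * exp (2 * r * lam n)) \<le>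
          (L\<^sup>2 + 4 * \<sigma>\<^sup>2) / real (Suc n) * (((2 * \<bar>\<rho>\<bar> + 5) * real N) ^ d * exp (2 * (real d + 1)))"
          using rl by (intro mult_left_mono mult_mono Z'(2)) simp_all
        also have "\<dots> = C2 * (real (nat \<lceil>lam n\<rceil>) ^ d / real (Suc n))"
          by (simp add: C2_def N_def power_mult_distrib)
        finally show "(L\<^sup>2 + 4 * \<sigma>\<^sup>2) / real (Suc n) * (real (card Z') * exp (2 * r * lam n)) \<le> C2 * (real (nat \<lceil>lam n\<rceil>) ^ d / real (Suc n))" .
      qed
      finally show "(\<integral>\<^sup>+\<omega>. ennreal ((local_mean (linked (P n k \<omega>)) n (Dat \<omega>) - f0 (fst (Dat \<omega> 0)))\<^sup>2) \<partial>Pr) \<le> ennreal (rate n)" .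
    qed
    show ?thesis
    proof (rule forest_risk_le[where g="\<lambda>k \<omega>. local_mean (linked (P n k \<omega>)) n (Dat \<omega>)" and h="\<lambda>\<omega>. f0 (fst (Dat \<omega> 0))"])
      show "1 \<le> M n" by (rule hyp(25)[OF n])
      show "f (X 0 \<omega>) = f0 (fst (Dat \<omega> 0))" if "\<omega> \<in> space Pr" for \<omega>
        using X_W[OF that] by (simp add: Dat_def f0)
      fix k assume k: "k \<in> {1..M n}"
      note T = stit_tessellation_measurable[OF hyp(26)[OF n k]]
      have tess: "tessellation (P n k \<omega>)" if "\<omega> \<in> space Pr" for \<omega>
        using measurable_space[OF T that] by (simp add: space_tessellation_space)
      have comp: "(\<lambda>\<omega>. Dat \<omega> i) \<in> borel_measurable Pr" if "i \<in> {0..n}" for i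
        by (rule measurable_compose[OF Dat measurable_component_singleton[OF that]])
      have "(\<lambda>\<omega>. local_mean (linked (P n k \<omega>)) n (Dat \<omega>)) \<in> borel_measurable Pr"
        by (rule measurable_local_mean[OF comp T])
      moreover have "(\<lambda>\<omega>. f0 (fst (Dat \<omega> 0))) \<in> borel_measurable Pr"
        by (rule measurable_compose[OF measurable_compose[OF comp fst_b] f0_m]) simp
      ultimately show "(\<lambda>\<omega>. ennreal ((local_mean (linked (P n k \<omega>)) n (Dat \<omega>) - f0 (fst (Dat \<omega> 0)))\<^sup>2)) \<in> borel_measurable Pr"
        by measurable
      show "(\<integral>\<^sup>+\<omega>. ennreal ((local_mean (linked (P n k \<omega>)) n (Dat \<omega>) - f0 (fst (Dat \<omega> 0)))\<^sup>2) \<partial>Pr) \<le> ennreal (rate n)"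
        by (rule bound[OF k])
      show "AE \<omega> in Pr. tree_estimator n (\<lambda>i. (X i \<omega>, Y i \<omega>)) (restrict_tessellation (P n k \<omega>) W) (X 0 \<omega>) =
          local_mean (linked (P n k \<omega>)) n (Dat \<omega>)"
      proof (rule AE_mp[OF null[OF k]], rule AE_I2, rule impI)
        fix \<omega> assume \<omega>: "\<omega> \<in> space Pr" and nb: "\<forall>i\<in>{0..n}. fst (Dat \<omega> i) \<notin> boundary_union (P n k \<omega>)"
        have "X i \<omega> \<notin> boundary_union (P n k \<omega>)" if "i \<in> {0..n}" for i
          using bspec[OF nb that] that by (simp add: Dat_def)
        then show "tree_estimator n (\<lambda>i. (X i \<omega>, Y i \<omega>)) (restrict_tessellation (P n k \<omega>) W) (X 0 \<omega>) =
          local_mean (linked (P n k \<omega>)) n (Dat \<omega>)"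
          unfolding Dat_def by (intro tree_estimator_eq_local_mean[OF tess[OF \<omega>]] X_W[OF \<omega>])
      qed
    qed
  qed
  let ?r = "\<lambda>n. L powr (2 * real d / (real d + 2 * \<beta>)) * real n powr (- (2 * \<beta>) / (real d + 2 * \<beta>))"
  have "\<forall>\<^sub>F n in sequentially. forest_risk Pr W f X Y n (M n) (P n) < \<infinity>"
    using eventually_ge_at_top[of "1::nat"]
    by (rule eventually_mono) (use le_less_trans[OF risk ennreal_less_top] in simp)
  moreover have "(\<lambda>n. enn2real (forest_risk Pr W f X Y n (M n) (P n))) \<in> O(?r)"
  proof (rule landau_o.big_trans)
    show "(\<lambda>n. enn2real (forest_risk Pr W f X Y n (M n) (P n))) \<in> O(rate)"
    proof (rule bigoI[where c=1], rule eventually_mono[OF eventually_ge_at_top[of "1::nat"]])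
      fix n :: nat assume n: "1 \<le> n"
      have "0 \<le> rate n" using C by (simp add: rate_def)
      then have "enn2real (forest_risk Pr W f X Y n (M n) (P n)) \<le> rate n"
        using risk[OF n] by (intro enn2real_leI)
      then show "norm (enn2real (forest_risk Pr W f X Y n (M n) (P n))) \<le> 1 * norm (rate n)"
        using \<open>0 \<le> rate n\<close> by simp
    qed
    show "rate \<in> O(?r)"
      unfolding rate_def[abs_def] by (rule risk_rate[OF hyp(19,21) C hyp(24)])
  qed
  moreover have "?r \<in> \<Theta>(minimax_rate 0 \<beta> d)"
  proof -
    have "minimax_rate 0 \<beta> d = (\<lambda>n. real n powr (- (2 * \<beta>) / (real d + 2 * \<beta>)))"
      by (simp add: minimax_rate_def fun_eq_iff add.commute)
    then show ?thesis using hyp(21) by simp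
  qed
  ultimately show ?thesis by blast
qed

end
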